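(* Let $f_0$ be a convex density on $[0,\infty)$ with distribution function $F_0$. Assume that $f_0$ is positive and linear on $(a,b)$ for some $0\le a<b$, where $(a,b)$ is the largest such interval in the sense that there is no open interval $(a',b')$ with $(a,b)\subsetneq(a',b')\subseteq(0,\infty)$ on which $f_0$ is linear. Let $X(t)=\mathbb U(F_0(t))$ and $Y(t)=\int_0^tX(s)\,ds$, where $\mathbb U$ is a standard Brownian bridge on $[0,1]$. Then almost surely there exists a uniquely defined random continuously differentiable function $H_*$ on $[a,b]$ satisfying the following conditions: (1) $H_*(t)\ge Y(t)$ for every $t\in[a,b]$; (2) $H_*$ has convex second derivative on $(a,b)$; (3) $H_*(a)=Y(a)$ and $H_*'(a)=X(a)$; (4) $H_*(b)=Y(b)$ and $H_*'(b)=X(b)$; (5) $\int_a^b\big(H_*(t)-Y(t)\big)\,dH_*^{(3)}(t)=0$.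
   Context: Convex density means a probability density belonging to the cone of non-negative, continuous, convex and integrable functions on $[0,\infty)$. The derivative of a convex function is interpreted as either its left or its right derivative; in particular $H_*^{(3)}$ is such a derivative of the convex function $H_*^{(2)}$ and the integral in (5) is a Lebesgue–Stieltjes integral over $(a,b)$. The process $H_*$ depends on $a$, $b$ and $F_0$. *)

theory Defs
  imports "HOL-Probability.Probability"
begin

definition convex_density :: "(real \<Rightarrow> real) \<Rightarrow> bool" where
  "convex_density f \<longleftrightarrow>
     (\<forall>x\<ge>0. 0 \<le> f x) \<and> continuous_on {0..} f \<and> convex_on {0..} f \<and>
     set_integrable lborel {0..} f \<and> (LBINT x:{0..}. f x) = 1"

(* Densities live on [0,\<infinity>): the values of f on the negative half-line are discarded. *)
definition density_cdf :: "(real \<Rightarrow> real) \<Rightarrow> real \<Rightarrow> real" where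
  "density_cdf f = cdf (density lborel (\<lambda>x. ennreal (indicator {0..} x * f x)))"

definition affine_fun_on :: "real set \<Rightarrow> (real \<Rightarrow> real) \<Rightarrow> bool" where
  "affine_fun_on S f \<longleftrightarrow> (\<exists>c d. \<forall>x\<in>S. f x = c + d * x)"

(* Degenerate (a.s. constant) variables count as Gaussian; a Brownian bridge needs them,
   for example at times 0 and 1. *)
definition gaussian_rv :: "'w measure \<Rightarrow> ('w \<Rightarrow> real) \<Rightarrow> bool" where
  "gaussian_rv M Z \<longleftrightarrow> Z \<in> borel_measurable M \<and>
     ((\<exists>\<mu>. AE \<omega> in M. Z \<omega> = \<mu>) \<or>
      (\<exists>\<mu> \<sigma>. 0 < \<sigma> \<and> distributed M lborel Z (\<lambda>x. ennreal (normal_density \<mu> \<sigma> x))))"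

definition gaussian_process :: "'w measure \<Rightarrow> real set \<Rightarrow> (real \<Rightarrow> 'w \<Rightarrow> real) \<Rightarrow> bool" where
  "gaussian_process M T U \<longleftrightarrow>
     (\<forall>S c. finite S \<longrightarrow> S \<subseteq> T \<longrightarrow> gaussian_rv M (\<lambda>\<omega>. \<Sum>t\<in>S. c t * U t \<omega>))"

definition brownian_bridge :: "'w measure \<Rightarrow> (real \<Rightarrow> 'w \<Rightarrow> real) \<Rightarrow> bool" where
  "brownian_bridge M U \<longleftrightarrow>
     prob_space M \<and> gaussian_process M {0..1} U \<and>
     (\<forall>t\<in>{0..1}. (\<integral>\<omega>. U t \<omega> \<partial>M) = 0) \<and>
     (\<forall>s\<in>{0..1}. \<forall>t\<in>{0..1}. (\<integral>\<omega>. U s \<omega> * U t \<omega> \<partial>M) = min s t - s * t) \<and>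
     (AE \<omega> in M. continuous_on {0..1} (\<lambda>t. U t \<omega>))"

(* The Lebesgue-Stieltjes measure dF on the open interval (a,b). Unlike interval_measure, it
   allows F to be unbounded near a and b, as the third derivative of H may well be.
   The lemmas below show that it is the intended Borel measure. *)
definition stieltjes_on :: "real \<Rightarrow> real \<Rightarrow> (real \<Rightarrow> real) \<Rightarrow> real measure" where
  "stieltjes_on a b F =
     extend_measure {a<..<b} {(s, t). a < s \<and> s \<le> t \<and> t < b}
       (\<lambda>(s, t). {s<..t}) (\<lambda>(s, t). ennreal (F t - F s))"

lemma space_stieltjes_on: "space (stieltjes_on a b F) = {a<..<b}"
  unfolding stieltjes_on_def by (rule space_extend_measure) auto

lemma sets_stieltjes_on_sigma: "sets (stieltjes_on a b F) =
    sigma_sets {a<..<b} ((\<lambda>(s, t). {s<..t}) ` {(s, t). a < s \<and> s \<le> t \<and> t < b})"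
  unfolding stieltjes_on_def by (rule sets_extend_measure) auto

lemma sets_stieltjes_on: "sets (stieltjes_on a b F) = sets (restrict_space borel {a<..<b})"
proof -
  let ?C = "(\<lambda>(s, t). {s<..t}) ` {(s, t). a < s \<and> s \<le> t \<and> t < b}"
  let ?\<Omega> = "{a<..<b}"
  have "sigma_sets ?\<Omega> ?C \<subseteq> sets (restrict_space borel ?\<Omega>)"
    using sets.sigma_sets_subset[of ?C "restrict_space borel ?\<Omega>"]
    by (force simp: sets_restrict_space_iff space_restrict_space)
  moreover have "{s<..<t} \<in> sigma_sets ?\<Omega> ?C" if "a \<le> s" "t \<le> b" for s t
  proof (cases "s < t")
    case True
    let ?l = "\<lambda>n. s + (t - s) / (real n + 2)" and ?u = "\<lambda>n. t - (t - s) / (real n + 2)"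
    have *: "{?l n<..?u n} \<in> sigma_sets ?\<Omega> ?C" for n
    proof -
      define d where "d = (t - s) / (real n + 2)"
      have "d \<le> (t - s) / 2" unfolding d_def using True by (intro divide_left_mono) auto
      moreover have "0 < d" using True by (auto simp: d_def)
      ultimately have "a < s + d" "s + d \<le> t - d" "t - d < b" using True that by auto
      then have "a < ?l n" "?l n \<le> ?u n" "?u n < b" by (simp_all only: d_def)
      then show ?thesis by (intro sigma_sets.Basic) auto
    qed
    have "{s<..<t} = (\<Union>n. {?l n<..?u n})"
    proof (intro equalityI subsetI)
      fix x assume x: "x \<in> {s<..<t}"
      define e where "e = min (x - s) (t - x)"
      have e: "0 < e" using x by (auto simp: e_def)
      obtain n :: nat where n: "(t - s) / e < real n" using reals_Archimedean2 by blast
      have "(t - s) / (real n + 2) < e"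
        using n e True by (auto simp: field_simps)
      then have "?l n < x" "x \<le> ?u n" unfolding e_def by linarith+
      then have "x \<in> {?l n<..?u n}" by simp
      then show "x \<in> (\<Union>n. {?l n<..?u n})" by blast
    next
      fix x assume "x \<in> (\<Union>n. {?l n<..?u n})"
      then obtain n where "?l n < x" "x \<le> ?u n" by auto
      moreover have "0 < (t - s) / (real n + 2)" using True by auto
      ultimately have "s < x" "x < t" by linarith+
      then show "x \<in> {s<..<t}" by simp
    qed
    then show ?thesis using * by (simp only: sigma_sets.Union)
  qed (auto intro: sigma_sets.Empty)
  note ioo = this
  have "sets (restrict_space borel ?\<Omega>) \<subseteq> sigma_sets ?\<Omega> ?C"
  proof -
    have "sets (borel :: real measure) = sigma_sets UNIV (range (\<lambda>(s, t). {s<..<t}))"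
      by (simp add: borel_eq_box box_real)
    then have "sets (restrict_space borel ?\<Omega>)
        = (\<inter>) ?\<Omega> ` sigma_sets UNIV (range (\<lambda>(s, t). {s<..<t}))"
      by (simp add: sets_restrict_space)
    also have "\<dots> = sigma_sets ?\<Omega> ((\<inter>) ?\<Omega> ` range (\<lambda>(s, t). {s<..<t}))"
    proof (rule sigma_sets_Int)
      have "?\<Omega> \<in> range (\<lambda>(s, t). {s<..<t})" by (rule range_eqI[of _ _ "(a, b)"]) simp
      then show "?\<Omega> \<in> sigma_sets UNIV (range (\<lambda>(s, t). {s<..<t}))"
        by (rule sigma_sets.Basic)
    qed simp
    also have "\<dots> \<subseteq> sigma_sets ?\<Omega> ?C"
    proof (rule sigma_algebra.sigma_sets_subset)
      show "sigma_algebra ?\<Omega> (sigma_sets ?\<Omega> ?C)"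
        by (rule sigma_algebra_sigma_sets) auto
      show "(\<inter>) ?\<Omega> ` range (\<lambda>(s, t). {s<..<t}) \<subseteq> sigma_sets ?\<Omega> ?C"
      proof safe
        fix s t :: real
        have "?\<Omega> \<inter> {s<..<t} = {max s a<..<min t b}" by auto
        then show "?\<Omega> \<inter> {s<..<t} \<in> sigma_sets ?\<Omega> ?C"
          using ioo[of "max s a" "min t b"] by simp
      qed
    qed
    finally show ?thesis .
  qed
  ultimately show ?thesis unfolding sets_stieltjes_on_sigma by (intro equalityI)
qed

lemma emeasure_stieltjes_on:
  assumes mono: "mono_on {a<..<b} F"
    and rc: "\<And>x. x \<in> {a<..<b} \<Longrightarrow> continuous (at_right x) F"
    and st: "a < s" "s \<le> t" "t < b"
  shows "emeasure (stieltjes_on a b F) {s<..t} = ennreal (F t - F s)"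
proof -
  define I where "I = {y. \<exists>s\<in>{a<..<b}. \<exists>t\<in>{a<..<b}. F s < y \<and> y \<le> F t}"
  define G where "G y = Inf {x\<in>{a<..<b}. y \<le> F x}" for y
  have G: "G y \<in> {a<..<b}" "\<And>x. x \<in> {a<..<b} \<Longrightarrow> G y \<le> x \<longleftrightarrow> y \<le> F x" if y: "y \<in> I" for y
  proof -
    obtain s t where s: "s \<in> {a<..<b}" "F s < y" and t: "t \<in> {a<..<b}" "y \<le> F t"
      using y by (auto simp: I_def)
    let ?A = "{x\<in>{a<..<b}. y \<le> F x}"
    have lb: "s \<le> x" if "x \<in> ?A" for x
      using mono_onD[OF mono, of x s] that s by force
    have ne: "?A \<noteq> {}" using t by auto
    have bdd: "bdd_below ?A" using lb by (auto simp: bdd_below_def)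
    have "s \<le> G y" unfolding G_def using ne lb by (rule cInf_greatest)
    moreover have "G y \<le> t" unfolding G_def using t bdd by (intro cInf_lower) auto
    ultimately show Gin: "G y \<in> {a<..<b}" using s t by auto
    have "y \<le> F (G y)"
    proof (rule ccontr)
      assume "\<not> y \<le> F (G y)"
      moreover have "(F \<longlongrightarrow> F (G y)) (at_right (G y))"
        using rc[OF Gin] by (simp add: continuous_within)
      ultimately have "eventually (\<lambda>x. F x < y) (at_right (G y))"
        by (intro order_tendstoD(2)) auto
      then obtain c where c: "c > G y" "\<And>x. G y < x \<Longrightarrow> x < c \<Longrightarrow> F x < y"
        by (auto simp: eventually_at_right_field)
      have "\<exists>x\<in>?A. x < c"
        using cInf_lessD[OF ne] c(1) by (auto simp: G_def)
      then obtain x where x: "x \<in> ?A" "x < c" by blast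
      have "G y \<le> x" unfolding G_def using x(1) bdd by (intro cInf_lower)
      then have "x = G y" using c(2)[of x] x by force
      then show False using x(1) \<open>\<not> y \<le> F (G y)\<close> by auto
    qed
    then show "G y \<le> x \<longleftrightarrow> y \<le> F x" if "x \<in> {a<..<b}" for x
      using mono_onD[OF mono Gin that] bdd that
      by (auto simp: G_def intro!: cInf_lower)
  qed
  have pre: "G -` {u<..v} \<inter> I = {F u<..F v}" if "a < u" "u \<le> v" "v < b" for u v
  proof -
    have "u \<in> {a<..<b}" "v \<in> {a<..<b}" using that by auto
    then have *: "y \<in> I \<Longrightarrow> G y \<le> u \<longleftrightarrow> y \<le> F u" "y \<in> I \<Longrightarrow> G y \<le> v \<longleftrightarrow> y \<le> F v"
      "{F u<..F v} \<subseteq> I" for y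
      using G(2) \<open>u \<in> _\<close> \<open>v \<in> _\<close> unfolding I_def by (blast, blast, auto)
    show ?thesis
    proof (intro equalityI subsetI)
      fix y assume "y \<in> G -` {u<..v} \<inter> I"
      then show "y \<in> {F u<..F v}" using *(1,2)[of y] by (simp add: not_le[symmetric])
    next
      fix y assume y: "y \<in> {F u<..F v}"
      then have "y \<in> I" using *(3) by blast
      then show "y \<in> G -` {u<..v} \<inter> I" using y *(1,2)[of y] by (simp add: not_le[symmetric])
    qed
  qed
  have "is_interval I"
    unfolding is_interval_1 I_def by (blast intro: less_le_trans le_less_trans order_trans)
  then have I: "I \<in> sets borel" by (rule real_interval_borel_measurable)
  let ?M = "stieltjes_on a b F" and ?L = "restrict_space lborel I"
  have Gm: "G \<in> measurable ?L ?M"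
  proof (rule measurable_sigma_sets[OF sets_stieltjes_on_sigma])
    show "G \<in> space ?L \<rightarrow> {a<..<b}" using G(1) by (auto simp: space_restrict_space)
    fix y assume "y \<in> (\<lambda>(s, t). {s<..t}) ` {(s, t). a < s \<and> s \<le> t \<and> t < b}"
    then obtain u v where uv: "y = {u<..v}" "a < u" "u \<le> v" "v < b" by auto
    then have "G -` y \<inter> space ?L = {F u<..F v}" using pre by (simp add: space_restrict_space)
    moreover have "{F u<..F v} \<subseteq> I" using pre uv by blast
    ultimately show "G -` y \<inter> space ?L \<in> sets ?L"
      using I by (simp add: sets_restrict_space_iff)
  qed auto
  have D: "emeasure (distr ?L ?M G) {u<..v} = ennreal (F v - F u)"
    if uv: "a < u" "u \<le> v" "v < b" for u v
  proof -
    have "{u<..v} \<in> sets ?M"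
      unfolding sets_stieltjes_on_sigma using uv by (intro sigma_sets.Basic) auto
    then have "emeasure (distr ?L ?M G) {u<..v} = emeasure ?L {F u<..F v}"
      using Gm pre[OF uv] by (simp add: emeasure_distr space_restrict_space)
    also have "\<dots> = emeasure lborel {F u<..F v}"
      using I pre[OF uv] by (intro emeasure_restrict_space) auto
    also have "\<dots> = ennreal (F v - F u)"
      using mono_onD[OF mono, of u v] uv by simp
    finally show ?thesis .
  qed
  show ?thesis
  proof (rule emeasure_extend_measure_Pair[OF stieltjes_on_def, where \<mu>' = "emeasure (distr ?L ?M G)"])
    show "positive (sets ?M) (emeasure (distr ?L ?M G))"
      by (simp add: positive_def)
    show "countably_additive (sets ?M) (emeasure (distr ?L ?M G))"
      using emeasure_countably_additive[of "distr ?L ?M G"] by simp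
  qed (use D st in auto)
qed

(* H1, H2 and H3 are the successive derivatives of H, the first one one-sided at a and b. The
   derivative of the convex function H2 is taken to be its right derivative: it is
   right-continuous, and the left derivative has the same Stieltjes measure.
   Integrability in the last clause is stated because integrals of non-integrable functions
   are 0 by convention. *)
definition invelope_on ::
    "real \<Rightarrow> real \<Rightarrow> (real \<Rightarrow> real) \<Rightarrow> (real \<Rightarrow> real) \<Rightarrow> (real \<Rightarrow> real) \<Rightarrow> bool" where
  "invelope_on a b X Y H \<longleftrightarrow>
     (\<exists>H1 H2 H3.
        (\<forall>t\<in>{a..b}. (H has_real_derivative H1 t) (at t within {a..b})) \<and>
        continuous_on {a..b} H1 \<and>
        (\<forall>t\<in>{a..b}. Y t \<le> H t) \<and>
        (\<forall>t\<in>{a<..<b}. (H1 has_real_derivative H2 t) (at t)) \<and>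
        convex_on {a<..<b} H2 \<and>
        H a = Y a \<and> H1 a = X a \<and>
        H b = Y b \<and> H1 b = X b \<and>
        (\<forall>t\<in>{a<..<b}. (H2 has_real_derivative H3 t) (at_right t)) \<and>
        integrable (stieltjes_on a b H3) (\<lambda>t. H t - Y t) \<and>
        (\<integral>t. (H t - Y t) \<partial>stieltjes_on a b H3) = 0)"

end

theory Submission
  imports Defs "HOL-Complex_Analysis.Great_Picard"
begin

text \<open>
  The statement is deterministic up to measurability. Almost every path of \<open>X\<close> is continuous,
  because the bridge and the distribution function are, and for \<^emph>\<open>every\<close> continuous \<open>X\<close> on \<open>[a, b]\<close>
  with antiderivative \<open>Y\<close> the invelope exists, is unique and depends continuously on \<open>X\<close>.

  The last condition on \<open>H\<close> concerns a nonnegative integrand, so it says that the measure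
  \<open>dH\<^sup>(\<^sup>3\<^sup>)\<close> does not charge \<open>{Y < H}\<close>: the convex function \<open>H''\<close> is affine near every point
  where \<open>H\<close> is strictly above \<open>Y\<close>. The predicate \<open>contact_invelope\<close> records the conditions in
  this form; \<open>invelope_on_imp_contact_invelope\<close> and \<open>contact_invelope_imp_invelope_on\<close>
  translate between the two.

  Uniqueness (\<open>contact_invelope_unique\<close>). For the difference \<open>D\<close> of two invelopes the usual
  argument integrates \<open>(D'')\<^sup>2\<close> by parts, but here \<open>H''\<close> may blow up at the end points and the
  boundary terms are out of control. Instead consider \<open>P = (D')\<^sup>2 - D D''\<close>. Formally
  \<open>P'' = (D'')\<^sup>2 - D D''''\<close>, and \<open>D D'''' \<le> 0\<close> as a measure, because \<open>dH'''\<close> lives where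
  \<open>H = Y\<close>, hence where \<open>D \<le> 0\<close>, and similarly for the other invelope. So \<open>P\<close> is convex. If \<open>P\<close>
  were positive somewhere, it would stay bounded away from \<open>0\<close> towards one end point, where
  \<open>D'\<close> tends to \<open>0\<close>; then \<open>D D'' < 0\<close> near that end point, which contradicts \<open>D = D' = 0\<close> there.
  Hence \<open>(D')\<^sup>2 \<le> D D''\<close>, which makes \<open>D\<^sup>2\<close> convex; as \<open>D\<^sup>2\<close> vanishes at both ends, \<open>D = 0\<close>.

  Stability (\<open>contact_invelope_stable\<close>). Between two neighbouring contact points \<open>H'\<close> is the
  quadratic polynomial with the end values and the mean of \<open>X\<close>, and at contact points \<open>H' = X\<close>.
  Therefore a modulus of continuity of \<open>X\<close> gives one of \<open>H'\<close> on all of \<open>[a, b]\<close>, including the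
  end points (\<open>contact_invelope_modulus\<close>). If paths converge uniformly, the theorem of Arzela and
  Ascoli provides a convergent subsequence of the derivatives of their invelopes, and the limit is
  an invelope of the limit path, since convexity of the second derivatives turns the convergence
  into convergence of the second derivatives themselves (\<open>convex_derivative_limit\<close>).

  Existence. If \<open>X\<close> has a continuous derivative \<open>x\<close>, take for \<open>H''\<close> the projection of \<open>x\<close> onto the
  convex functions in \<open>L\<^sup>2(a, b)\<close> (\<open>contact_invelope_exists_smooth\<close>). Brownian paths have no
  derivative to project, and for them \<open>H''\<close> need not be square integrable; they are reached by
  approximating \<open>X\<close> with Bernstein polynomials and applying stability.

  Measurability. The invelope of the \<open>n\<close>-th Bernstein polynomial is a function of finitely many
  values of \<open>X\<close>, continuous by stability and uniqueness; the invelope of \<open>X\<close> is the limit of these.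
\<close>

section \<open>Convex functions of one variable and their right derivatives\<close>

lemma convex_on_three_slopes:
  fixes f :: "real \<Rightarrow> real"
  assumes "convex_on S f" "x \<in> S" "z \<in> S" "x < y" "y < z"
  shows "(f y - f x) / (y - x) \<le> (f z - f x) / (z - x)"
    and "(f z - f x) / (z - x) \<le> (f z - f y) / (z - y)"
    and "(f y - f x) / (y - x) \<le> (f z - f y) / (z - y)"
proof -
  have flip: "(p - q) / (r - s) = (q - p) / (s - r)" for p q r s :: real
    by (metis minus_diff_eq minus_divide_divide)
  show 1: "(f y - f x) / (y - x) \<le> (f z - f x) / (z - x)"
    using convex_on_slope_le(1)[OF assms] flip by metis
  show 2: "(f z - f x) / (z - x) \<le> (f z - f y) / (z - y)"
    using convex_on_slope_le(2)[OF assms] flip by metis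
  show "(f y - f x) / (y - x) \<le> (f z - f y) / (z - y)" using 1 2 by linarith
qed

text \<open>
  The slopes of the chords from \<open>t\<close> to the right decrease as the chords shrink and are bounded
  below by the slope of any chord ending at \<open>t\<close>, so they converge to their infimum.
\<close>
lemma convex_has_right_derivative:
  fixes f :: "real \<Rightarrow> real"
  assumes cvx: "convex_on {a<..<b} f"
  shows "\<exists>f'. \<forall>t\<in>{a<..<b}. (f has_real_derivative f' t) (at_right t)"
proof -
  have "\<exists>l. (f has_real_derivative l) (at_right t)" if t: "t \<in> {a<..<b}" for t
  proof -
    let ?q = "\<lambda>s. (f s - f t) / (s - t)"
    obtain r where r: "a < r" "r < t" using t dense by auto
    have lb: "(f t - f r) / (t - r) \<le> ?q s" if "t < s" "s < b" for s
      using convex_on_three_slopes(3)[OF cvx, of r s t] r t that by auto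
    define l where "l = Inf (?q ` {t<..<b})"
    have bdd: "bdd_below (?q ` {t<..<b})"
      by (rule bdd_belowI2[where m = "(f t - f r) / (t - r)"]) (use lb in auto)
    have ne: "?q ` {t<..<b} \<noteq> {}" using t by auto
    have "(?q \<longlongrightarrow> l) (at_right t)"
    proof (rule order_tendstoI)
      fix y assume "y < l"
      moreover have "l \<le> ?q s" if "t < s" "s < b" for s
        unfolding l_def using bdd that by (intro cInf_lower) auto
      ultimately show "eventually (\<lambda>s. y < ?q s) (at_right t)"
        using t by (auto simp: eventually_at_right_field intro!: exI[of _ b] intro: less_le_trans)
    next
      fix y assume "l < y"
      then obtain s0 where s0: "t < s0" "s0 < b" "?q s0 < y"
        using cInf_lessD[OF ne] by (fastforce simp: l_def)
      have "?q s < y" if "t < s" "s < s0" for s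
        using convex_on_three_slopes(1)[OF cvx, of t s0 s] s0 t that by auto
      then show "eventually (\<lambda>s. ?q s < y) (at_right t)"
        using s0 by (auto simp: eventually_at_right_field)
    qed
    then show ?thesis by (auto simp: has_field_derivative_iff)
  qed
  then show ?thesis by metis
qed

lemma convex_above_right_tangent:
  fixes f :: "real \<Rightarrow> real"
  assumes cvx: "convex_on {a<..<b} f" and t: "t \<in> {a<..<b}" and s: "s \<in> {a<..<b}"
    and d: "(f has_real_derivative l) (at_right t)"
  shows "f t + l * (s - t) \<le> f s"
proof -
  have lim: "((\<lambda>r. (f r - f t) / (r - t)) \<longlongrightarrow> l) (at_right t)"
    using d by (simp add: has_field_derivative_iff)
  consider "s < t" | "s = t" | "t < s" by linarith
  then show ?thesis
  proof cases
    case 1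
    have "eventually (\<lambda>r. (f t - f s) / (t - s) \<le> (f r - f t) / (r - t)) (at_right t)"
      using t s 1 convex_on_three_slopes(3)[OF cvx s, of _ t]
      by (auto simp: eventually_at_right_field intro!: exI[of _ b])
    from tendsto_lowerbound[OF lim this] have "(f t - f s) / (t - s) \<le> l" by simp
    then show ?thesis using 1 by (simp add: field_simps)
  next
    case 3
    have "eventually (\<lambda>r. (f r - f t) / (r - t) \<le> (f s - f t) / (s - t)) (at_right t)"
      using t s 3 convex_on_three_slopes(1)[OF cvx t s]
      by (auto simp: eventually_at_right_field intro!: exI[of _ s])
    from tendsto_upperbound[OF lim this] have "l \<le> (f s - f t) / (s - t)" by simp
    then show ?thesis using 3 by (simp add: field_simps)
  qed simp
qed

lemma convex_right_derivative_mono: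
  fixes f :: "real \<Rightarrow> real"
  assumes cvx: "convex_on {a<..<b} f"
    and d: "\<And>t. t \<in> {a<..<b} \<Longrightarrow> (f has_real_derivative f' t) (at_right t)"
  shows "mono_on {a<..<b} f'"
proof (rule mono_onI)
  fix s t assume st: "s \<in> {a<..<b}" "t \<in> {a<..<b}" "s \<le> t"
  have "f s + f' s * (t - s) \<le> f t" "f t + f' t * (s - t) \<le> f s"
    using convex_above_right_tangent[OF cvx] st d by auto
  then have "(f' s - f' t) * (t - s) \<le> 0" by (simp add: algebra_simps)
  then show "f' s \<le> f' t"
    using st by (cases "s = t") (auto simp: mult_le_0_iff)
qed

lemma convex_on_open_interval_continuous:
  fixes f :: "real \<Rightarrow> real"
  assumes "convex_on {a<..<b} f" "t \<in> {a<..<b}"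
  shows "isCont f t"
  using convex_on_continuous[OF _ assms(1)] assms(2) by (simp add: continuous_on_eq_continuous_at)

text \<open>
  A chord slope over \<open>[s, r]\<close> dominates \<open>f' s\<close> and depends continuously on \<open>s\<close>. Choosing \<open>r\<close>
  first so that the slope over \<open>[t, r]\<close> is close to \<open>f' t\<close> therefore bounds \<open>f'\<close> from above to the
  right of \<open>t\<close>; monotonicity gives the other bound.
\<close>
lemma convex_right_derivative_right_continuous:
  fixes f :: "real \<Rightarrow> real"
  assumes cvx: "convex_on {a<..<b} f"
    and d: "\<And>t. t \<in> {a<..<b} \<Longrightarrow> (f has_real_derivative f' t) (at_right t)"
    and t: "t \<in> {a<..<b}"
  shows "continuous (at_right t) f'"
  unfolding continuous_within
proof (rule order_tendstoI)
  have mono: "mono_on {a<..<b} f'" using convex_right_derivative_mono[OF cvx d] .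
  fix y assume "y < f' t"
  moreover have "f' t \<le> f' s" if "t < s" "s < b" for s
    using mono_onD[OF mono, of t s] t that by auto
  ultimately show "eventually (\<lambda>s. y < f' s) (at_right t)"
    using t by (auto simp: eventually_at_right_field intro!: exI[of _ b] intro: less_le_trans)
next
  fix y assume y: "f' t < y"
  have lim: "((\<lambda>r. (f r - f t) / (r - t)) \<longlongrightarrow> f' t) (at_right t)"
    using d[OF t] by (simp add: has_field_derivative_iff)
  have "eventually (\<lambda>r. (f r - f t) / (r - t) < y \<and> r < b) (at_right t)"
    using order_tendstoD(2)[OF lim y] t
    by (intro eventually_conj) (auto simp: eventually_at_right_field)
  then obtain r where r: "t < r" "(f r - f t) / (r - t) < y" "r < b"
    by (metis (mono_tags, lifting) eventually_at_right_field dense)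
  have "isCont f t" using convex_on_open_interval_continuous[OF cvx t] .
  then have "(f \<longlongrightarrow> f t) (at_right t)"
    by (auto simp: isCont_def intro: filterlim_mono at_le)
  then have "((\<lambda>s. (f r - f s) / (r - s)) \<longlongrightarrow> (f r - f t) / (r - t)) (at_right t)"
    using r by (intro tendsto_intros) auto
  from order_tendstoD(2)[OF this r(2)]
  have "eventually (\<lambda>s. (f r - f s) / (r - s) < y \<and> s < r) (at_right t)"
    using r by (intro eventually_conj) (auto simp: eventually_at_right_field)
  then obtain c where c: "c > t" "\<And>s. t < s \<Longrightarrow> s < c \<Longrightarrow> (f r - f s) / (r - s) < y \<and> s < r"
    by (auto simp: eventually_at_right_field)
  have "f' s < y" if s: "t < s" "s < c" for s
  proof -
    have "s < r" "(f r - f s) / (r - s) < y" using c(2)[OF s] by auto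
    moreover have "f s + f' s * (r - s) \<le> f r"
      using convex_above_right_tangent[OF cvx _ _ d] s r t \<open>s < r\<close> by auto
    ultimately have "f' s \<le> (f r - f s) / (r - s)" by (simp add: field_simps)
    then show ?thesis using \<open>(f r - f s) / (r - s) < y\<close> by linarith
  qed
  then show "eventually (\<lambda>s. f' s < y) (at_right t)"
    using c(1) by (auto simp: eventually_at_right_field)
qed

text \<open>
  A monotonicity criterion for functions with jumps, needed because third derivatives enter the
  quantities below: nonnegative lower right Dini derivatives and no downward jump from the left
  suffice. The point up to which the inequality with slack \<open>e\<close> persists cannot be smaller than
  \<open>v\<close>: the left condition carries the inequality to this point, the right condition past it.
\<close>
lemma le_if_lower_dini_derivative_nonneg:
  fixes \<phi> :: "real \<Rightarrow> real"
  assumes uv: "u \<le> v"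
    and right: "\<And>t e. u \<le> t \<Longrightarrow> t < v \<Longrightarrow> 0 < e \<Longrightarrow> \<forall>\<^sub>F s in at_right t. \<phi> t - e * (s - t) \<le> \<phi> s"
    and left: "\<And>t e. u < t \<Longrightarrow> t \<le> v \<Longrightarrow> 0 < e \<Longrightarrow> \<forall>\<^sub>F s in at_left t. \<phi> s - e \<le> \<phi> t"
  shows "\<phi> u \<le> \<phi> v"
proof -
  have "\<phi> u - e * (v - u) \<le> \<phi> v" if e: "0 < e" for e
  proof -
    \<comment> \<open>The initial stretch on which the inequality with slope \<open>- e\<close> holds.\<close>
    define S where "S = {s\<in>{u..v}. \<forall>r\<in>{u..s}. \<phi> u - e * (r - u) \<le> \<phi> r}"
    define c where "c = Sup S"
    have uS: "u \<in> S" using uv by (auto simp: S_def)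
    have bdd: "bdd_above S" by (auto simp: S_def bdd_above_def)
    have c: "u \<le> c" "c \<le> v"
      using uS bdd uv by (auto simp: c_def S_def intro!: cSup_upper cSup_least)
    have below: "\<phi> u - e * (r - u) \<le> \<phi> r" if r: "u \<le> r" "r < c" for r
    proof -
      obtain s where "s \<in> S" "r < s"
        using less_cSupE[of r S] uS r(2) unfolding c_def by (metis empty_iff)
      then show ?thesis using r by (auto simp: S_def)
    qed
    have atc: "\<phi> u - e * (c - u) \<le> \<phi> c"
    proof (cases "u = c")
      case False
      then have "u < c" using c by simp
      have "\<phi> u - e * (c - u) \<le> \<phi> c + e'" if "0 < e'" for e'
      proof -
        have "\<forall>\<^sub>F s in at_left c. \<phi> s - e' \<le> \<phi> c" using left \<open>u < c\<close> c that by auto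
        then obtain d where d: "d < c" "\<And>s. d < s \<Longrightarrow> s < c \<Longrightarrow> \<phi> s - e' \<le> \<phi> c"
          by (auto simp: eventually_at_left_field)
        obtain s where s: "max d u < s" "s < c" using dense[of "max d u" c] d \<open>u < c\<close> by auto
        have "\<phi> u - e * (s - u) \<le> \<phi> s" using below s by auto
        moreover have "\<phi> s - e' \<le> \<phi> c" using d s by auto
        moreover have "e * (s - u) \<le> e * (c - u)" using e s by auto
        ultimately show ?thesis by linarith
      qed
      then show ?thesis using field_le_epsilon by blast
    qed simp
    have "c = v"
    proof (rule ccontr)
      assume "c \<noteq> v"
      then have "c < v" using c by simp
      then have "\<forall>\<^sub>F s in at_right c. \<phi> c - e * (s - c) \<le> \<phi> s" using right c e by auto
      then obtain d where d: "d > c" "\<And>s. c < s \<Longrightarrow> s < d \<Longrightarrow> \<phi> c - e * (s - c) \<le> \<phi> s"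
        by (auto simp: eventually_at_right_field)
      obtain s where s: "c < s" "s < min d v" using dense[of c "min d v"] d \<open>c < v\<close> by auto
      have "\<phi> u - e * (r - u) \<le> \<phi> r" if "u \<le> r" "r \<le> s" for r
      proof -
        consider "r < c" | "r = c" | "c < r" by linarith
        then show ?thesis
        proof cases
          case 3
          then have "\<phi> c - e * (r - c) \<le> \<phi> r" using d s that by auto
          then show ?thesis using atc by (simp add: algebra_simps)
        qed (use below atc that in auto)
      qed
      then have "s \<in> S" using s c by (auto simp: S_def)
      then have "s \<le> c" unfolding c_def using bdd by (intro cSup_upper)
      then show False using s by simp
    qed
    then show ?thesis using atc by simp
  qed
  note * = this
  show ?thesis
  proof (cases "u = v")
    case False
    then have "0 < v - u" using uv by simp
    show ?thesis
    proof (rule field_le_epsilon)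
      fix e :: real assume "0 < e"
      then show "\<phi> u \<le> \<phi> v + e"
        using *[of "e / (v - u)"] \<open>0 < v - u\<close> by simp
    qed
  qed simp
qed

lemma has_right_derivative_eventually_ge:
  fixes f :: "real \<Rightarrow> real"
  assumes "(f has_real_derivative l) (at_right t)" "0 < e"
  shows "\<forall>\<^sub>F s in at_right t. f t + (l - e) * (s - t) \<le> f s"
proof -
  have "\<forall>\<^sub>F s in at_right t. l - e < (f s - f t) / (s - t)"
    using assms by (intro order_tendstoD(1)) (auto simp: has_field_derivative_iff)
  moreover have "\<forall>\<^sub>F s in at_right t. t < s"
    by (auto simp: eventually_at_right_field intro: gt_ex)
  ultimately show ?thesis
    by eventually_elim (simp add: field_simps)
qed

lemma right_derivative_nonneg_imp_le:
  fixes f :: "real \<Rightarrow> real"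
  assumes "u \<le> v" "continuous_on {u..v} f"
    and d: "\<And>t. u \<le> t \<Longrightarrow> t < v \<Longrightarrow> (f has_real_derivative f' t) (at_right t)"
    and nn: "\<And>t. u \<le> t \<Longrightarrow> t < v \<Longrightarrow> 0 \<le> f' t"
  shows "f u \<le> f v"
proof (rule le_if_lower_dini_derivative_nonneg[OF assms(1)])
  fix t e :: real assume t: "u \<le> t" "t < v" and "0 < e"
  have "\<forall>\<^sub>F s in at_right t. f t + (f' t - e) * (s - t) \<le> f s"
    using has_right_derivative_eventually_ge[OF d] t \<open>0 < e\<close> by auto
  moreover have "\<forall>\<^sub>F s in at_right t. t < s"
    by (auto simp: eventually_at_right_field intro: gt_ex)
  ultimately show "\<forall>\<^sub>F s in at_right t. f t - e * (s - t) \<le> f s"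
  proof eventually_elim
    case (elim s)
    have "0 \<le> f' t * (s - t)" using nn t elim by simp
    then show ?case using elim by (simp add: algebra_simps)
  qed
next
  fix t e :: real assume t: "u < t" "t \<le> v" and "0 < e"
  have "(f \<longlongrightarrow> f t) (at t within {u..v})"
    using assms(2) t by (auto simp: continuous_on_def)
  then have "\<forall>\<^sub>F s in at t within {u..v}. f s < f t + e"
    using \<open>0 < e\<close> by (intro order_tendstoD(2)) auto
  then obtain d where d: "0 < d" "\<And>s. s \<in> {u..v} \<Longrightarrow> s \<noteq> t \<Longrightarrow> dist s t < d \<Longrightarrow> f s < f t + e"
    by (auto simp: eventually_at)
  show "\<forall>\<^sub>F s in at_left t. f s - e \<le> f t"
    unfolding eventually_at_left_field
  proof (intro exI[of _ "max u (t - d)"] conjI allI impI)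
    fix s assume "s > max u (t - d)" "s < t"
    then show "f s - e \<le> f t" using d(2)[of s] t by (auto simp: dist_real_def)
  qed (use t d in auto)
qed

text \<open>
  With a monotone right derivative, the graph lies above each of its right tangents; every function
  with a supporting line at each point is convex.
\<close>
lemma convex_on_if_right_derivative_mono:
  fixes f :: "real \<Rightarrow> real"
  assumes cont: "continuous_on {a<..<b} f"
    and d: "\<And>t. t \<in> {a<..<b} \<Longrightarrow> (f has_real_derivative f' t) (at_right t)"
    and mono: "mono_on {a<..<b} f'"
  shows "convex_on {a<..<b} f"
proof -
  have tan: "f y + f' y * (x - y) \<le> f x" if x: "x \<in> {a<..<b}" and y: "y \<in> {a<..<b}" for x y
  proof (cases "y \<le> x")
    case True
    have "f y - f' y * y \<le> f x - f' y * x"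
    proof (rule right_derivative_nonneg_imp_le[OF True, where f' = "\<lambda>t. f' t - f' y"])
      show "continuous_on {y..x} (\<lambda>t. f t - f' y * t)"
        using x y by (intro continuous_intros continuous_on_subset[OF cont]) auto
      fix t assume t: "y \<le> t" "t < x"
      then show "((\<lambda>t. f t - f' y * t) has_real_derivative f' t - f' y) (at_right t)"
        using x y by (auto intro!: derivative_eq_intros d)
      show "0 \<le> f' t - f' y" using mono_onD[OF mono, of y t] t x y by auto
    qed
    then show ?thesis by (simp add: algebra_simps)
  next
    case False
    then have xy: "x \<le> y" by simp
    have "f' y * x - f x \<le> f' y * y - f y"
    proof (rule right_derivative_nonneg_imp_le[OF xy, where f' = "\<lambda>t. f' y - f' t"])
      show "continuous_on {x..y} (\<lambda>t. f' y * t - f t)"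
        using x y by (intro continuous_intros continuous_on_subset[OF cont]) auto
      fix t assume t: "x \<le> t" "t < y"
      then show "((\<lambda>t. f' y * t - f t) has_real_derivative f' y - f' t) (at_right t)"
        using x y by (auto intro!: derivative_eq_intros d)
      show "0 \<le> f' y - f' t" using mono_onD[OF mono, of t y] t x y by auto
    qed
    then show ?thesis by (simp add: algebra_simps)
  qed
  show ?thesis
  proof (rule convex_onI)
    fix s x y :: real
    assume s: "0 < s" "s < 1" and xy: "x \<in> {a<..<b}" "y \<in> {a<..<b}"
    define m where "m = (1 - s) *\<^sub>R x + s *\<^sub>R y"
    have m: "m \<in> {a<..<b}" unfolding m_def
      using convexD_alt[of "{a<..<b}" x y s] s xy by auto
    have "(1 - s) * (f m + f' m * (x - m)) + s * (f m + f' m * (y - m)) \<le> (1 - s) * f x + s * f y"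
      using tan[OF xy(1) m] tan[OF xy(2) m] s by (intro add_mono mult_left_mono) auto
    moreover have "(1 - s) * (f m + f' m * (x - m)) + s * (f m + f' m * (y - m)) = f m"
    proof -
      have "(1 - s) * (f m + f' m * (x - m)) + s * (f m + f' m * (y - m))
        = f m + f' m * ((1 - s) * x + s * y - m)" by (simp add: algebra_simps)
      then show ?thesis by (simp add: m_def)
    qed
    ultimately show "f ((1 - s) *\<^sub>R x + s *\<^sub>R y) \<le> (1 - s) * f x + s * f y"
      unfolding m_def[symmetric] by simp
  qed simp
qed

section \<open>Invelopes described through their contact set\<close>

text \<open>
  The first conditions are those of \<open>invelope_on\<close>; the vanishing Stieltjes integral is replaced by
  the requirement that \<open>H2\<close> is affine near each point where \<open>H\<close> does not touch \<open>Y\<close>. This local form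
  avoids third derivatives and survives limits.
\<close>
definition contact_invelope ::
    "real \<Rightarrow> real \<Rightarrow> (real \<Rightarrow> real) \<Rightarrow> (real \<Rightarrow> real) \<Rightarrow> (real \<Rightarrow> real) \<Rightarrow> (real \<Rightarrow> real) \<Rightarrow> (real \<Rightarrow> real) \<Rightarrow> bool" where
  "contact_invelope a b X Y H H1 H2 \<longleftrightarrow>
     (\<forall>t\<in>{a..b}. (H has_real_derivative H1 t) (at t within {a..b})) \<and>
     continuous_on {a..b} H1 \<and>
     (\<forall>t\<in>{a..b}. Y t \<le> H t) \<and>
     (\<forall>t\<in>{a<..<b}. (H1 has_real_derivative H2 t) (at t)) \<and>
     convex_on {a<..<b} H2 \<and>
     H a = Y a \<and> H1 a = X a \<and> H b = Y b \<and> H1 b = X b \<and>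
     (\<forall>t\<in>{a<..<b}. Y t < H t \<longrightarrow>
        (\<exists>c d. a < c \<and> c < t \<and> t < d \<and> d < b \<and> affine_fun_on {c..d} H2))"

lemma contact_invelopeD:
  assumes "contact_invelope a b X Y H H1 H2"
  shows "\<And>t. t \<in> {a..b} \<Longrightarrow> (H has_real_derivative H1 t) (at t within {a..b})"
    and "continuous_on {a..b} H1"
    and "\<And>t. t \<in> {a..b} \<Longrightarrow> Y t \<le> H t"
    and "\<And>t. t \<in> {a<..<b} \<Longrightarrow> (H1 has_real_derivative H2 t) (at t)"
    and "convex_on {a<..<b} H2"
    and "H a = Y a" "H1 a = X a" "H b = Y b" "H1 b = X b"
    and "\<And>t. t \<in> {a<..<b} \<Longrightarrow> Y t < H t \<Longrightarrow>
        \<exists>c d. a < c \<and> c < t \<and> t < d \<and> d < b \<and> affine_fun_on {c..d} H2"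
  using assms unfolding contact_invelope_def by blast+

text \<open>
  If the right derivative does not increase over \<open>[s, t]\<close>, the tangents at \<open>s\<close> and at \<open>x\<close> have the
  same slope and bound each other.
\<close>
lemma affine_if_right_derivative_eq:
  fixes f :: "real \<Rightarrow> real"
  assumes cvx: "convex_on {a<..<b} f"
    and d: "\<And>t. t \<in> {a<..<b} \<Longrightarrow> (f has_real_derivative f' t) (at_right t)"
    and st: "a < s" "s \<le> t" "t < b" and le: "f' t \<le> f' s"
  shows "affine_fun_on {s..t} f"
proof -
  have mono: "mono_on {a<..<b} f'" using convex_right_derivative_mono[OF cvx d] .
  have "f x = (f s - f' s * s) + f' s * x" if x: "x \<in> {s..t}" for x
  proof -
    have "f' x = f' s"
      using mono_onD[OF mono, of s x] mono_onD[OF mono, of x t] x st le by auto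
    moreover have "f s + f' s * (x - s) \<le> f x" "f x + f' x * (s - x) \<le> f s"
      using convex_above_right_tangent[OF cvx] x st d by auto
    ultimately show ?thesis by (auto simp: algebra_simps)
  qed
  then show ?thesis unfolding affine_fun_on_def by blast
qed

lemma right_derivative_of_affine:
  fixes f :: "real \<Rightarrow> real"
  assumes cvx: "convex_on {a<..<b} f"
    and d: "\<And>t. t \<in> {a<..<b} \<Longrightarrow> (f has_real_derivative f' t) (at_right t)"
    and st: "a < s" "t < b" and aff: "affine_fun_on {s..t} f"
    and xy: "s < x" "x < t" "s < y" "y < t"
  shows "f' x = f' y"
proof -
  obtain p q where pq: "\<And>x. x \<in> {s..t} \<Longrightarrow> f x = p + q * x"
    using aff by (auto simp: affine_fun_on_def)
  have "f' x = q" if x: "s < x" "x < t" for x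
  proof -
    have "f x + f' x * (s - x) \<le> f s" "f x + f' x * (t - x) \<le> f t"
      using convex_above_right_tangent[OF cvx] x st d by auto
    then have "(f' x - q) * (s - x) \<le> 0" "(f' x - q) * (t - x) \<le> 0"
      using pq[of x] pq[of s] pq[of t] x by (auto simp: algebra_simps)
    then show ?thesis using x by (auto simp: mult_le_0_iff)
  qed
  then show ?thesis using xy by simp
qed

section \<open>Uniqueness\<close>

text \<open>
  Integration by parts as an inequality. By the product rule the function in question has, formally,
  derivative \<open>D d\<phi>'\<close>: the two terms \<open>D1 \<phi>'\<close> cancel, and \<open>D2 \<phi>\<close> cancels against the derivative
  of \<open>R\<close>. It is nondecreasing, since \<open>d\<phi>'\<close> is a nonnegative measure that does not charge \<open>{D < 0}\<close>. Both
  the uniqueness proof and the optimality conditions of the least squares problem rest on this.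
\<close>
lemma integration_by_parts_monotone:
  fixes D D1 D2 R \<phi> \<phi>' :: "real \<Rightarrow> real"
  assumes D: "\<And>t. t \<in> {a<..<b} \<Longrightarrow> (D has_real_derivative D1 t) (at t)"
    and D1: "\<And>t. t \<in> {a<..<b} \<Longrightarrow> (D1 has_real_derivative D2 t) (at t)"
    and R: "\<And>t. t \<in> {a<..<b} \<Longrightarrow> (R has_real_derivative D2 t * \<phi> t) (at t)"
    and cvx: "convex_on {a<..<b} \<phi>"
    and \<phi>': "\<And>t. t \<in> {a<..<b} \<Longrightarrow> (\<phi> has_real_derivative \<phi>' t) (at_right t)"
    and loc: "\<And>t. t \<in> {a<..<b} \<Longrightarrow> D t < 0 \<Longrightarrow> \<forall>\<^sub>F s in at t. \<phi>' s = \<phi>' t"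
  shows "mono_on {a<..<b} (\<lambda>t. R t - D1 t * \<phi> t + D t * \<phi>' t)"
proof (rule mono_onI)
  fix u v assume uv: "u \<in> {a<..<b}" "v \<in> {a<..<b}" "u \<le> v"
  have mono: "mono_on {a<..<b} \<phi>'" using convex_right_derivative_mono[OF cvx \<phi>'] .
  show "R u - D1 u * \<phi> u + D u * \<phi>' u \<le> R v - D1 v * \<phi> v + D v * \<phi>' v"
  proof (rule le_if_lower_dini_derivative_nonneg[OF uv(3)])
    fix t e :: real assume "u \<le> t" "t < v" and e: "0 < e"
    then have t: "t \<in> {a<..<b}" using uv by auto
    let ?W = "\<lambda>s. R s - D1 s * \<phi> s + (D s - D t) * \<phi>' s"
    \<comment> \<open>Although \<open>\<phi>'\<close> is only right-continuous, the product is differentiable from the right,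
        as its other factor vanishes at \<open>t\<close>.\<close>
    have "((\<lambda>s. (D s - D t) * \<phi>' s) has_real_derivative D1 t * \<phi>' t) (at_right t)"
    proof -
      have "(\<phi>' \<longlongrightarrow> \<phi>' t) (at_right t)"
        using convex_right_derivative_right_continuous[OF cvx \<phi>' t] by (simp add: continuous_within)
      moreover have "((\<lambda>s. (D s - D t) / (s - t)) \<longlongrightarrow> D1 t) (at_right t)"
        using has_field_derivative_at_within[OF D[OF t]] by (simp add: has_field_derivative_iff)
      ultimately have "((\<lambda>s. (D s - D t) / (s - t) * \<phi>' s) \<longlongrightarrow> D1 t * \<phi>' t) (at_right t)"
        by (intro tendsto_intros)
      then show ?thesis by (simp add: has_field_derivative_iff)
    qed
    then have "(?W has_real_derivative
        D2 t * \<phi> t - (D2 t * \<phi> t + D1 t * \<phi>' t) + D1 t * \<phi>' t) (at_right t)"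
      by (intro DERIV_add DERIV_diff has_field_derivative_at_within[OF R[OF t]])
        (auto intro!: derivative_eq_intros has_field_derivative_at_within[OF D1[OF t]] \<phi>'[OF t])
    then have "(?W has_real_derivative 0) (at_right t)" by simp
    from has_right_derivative_eventually_ge[OF this e]
    have "\<forall>\<^sub>F s in at_right t. ?W t + (0 - e) * (s - t) \<le> ?W s" .
    moreover have "\<forall>\<^sub>F s in at_right t. 0 \<le> D t * (\<phi>' s - \<phi>' t)"
    proof (cases "D t < 0")
      case True
      then have "\<forall>\<^sub>F s in at_right t. \<phi>' s = \<phi>' t"
        using loc[OF t] by (auto intro: filter_leD[OF at_le])
      then show ?thesis by eventually_elim simp
    next
      case False
      have "\<phi>' t \<le> \<phi>' s" if "t < s" "s < b" for s
        using mono_onD[OF mono t, of s] t that by auto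
      then show ?thesis
        using False t by (auto simp: eventually_at_right_field intro!: exI[of _ b] mult_nonneg_nonneg)
    qed
    ultimately show "\<forall>\<^sub>F s in at_right t. R t - D1 t * \<phi> t + D t * \<phi>' t - e * (s - t)
        \<le> R s - D1 s * \<phi> s + D s * \<phi>' s"
      by eventually_elim (simp add: algebra_simps)
  next
    fix t e :: real assume "u < t" "t \<le> v" and e: "0 < e"
    then have t: "t \<in> {a<..<b}" "u < t" using uv by auto
    let ?W = "\<lambda>s. R s - D1 s * \<phi> s + (D s - D t) * \<phi>' s"
    have "(?W \<longlongrightarrow> R t - D1 t * \<phi> t + 0) (at_left t)"
    proof (intro tendsto_intros)
      have lim: "(f \<longlongrightarrow> f t) (at_left t)" if "isCont f t" for f :: "real \<Rightarrow> real"
        using that by (auto simp: isCont_def intro: filterlim_mono at_le)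
      show "(R \<longlongrightarrow> R t) (at_left t)" using DERIV_isCont[OF R[OF t(1)]] by (rule lim)
      show "(D1 \<longlongrightarrow> D1 t) (at_left t)" using DERIV_isCont[OF D1[OF t(1)]] by (rule lim)
      show "(\<phi> \<longlongrightarrow> \<phi> t) (at_left t)"
        using convex_on_open_interval_continuous[OF cvx t(1)] by (rule lim)
      have "((\<lambda>s. D s - D t) \<longlongrightarrow> 0) (at_left t)"
        using lim[OF DERIV_isCont[OF D[OF t(1)]]] by (simp add: LIM_zero)
      moreover have "\<forall>\<^sub>F s in at_left t. norm (\<phi>' s) \<le> max \<bar>\<phi>' u\<bar> \<bar>\<phi>' t\<bar>"
        unfolding eventually_at_left_field
      proof (intro exI[of _ u] conjI allI impI)
        fix s assume "u < s" "s < t"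
        then have "\<phi>' u \<le> \<phi>' s" "\<phi>' s \<le> \<phi>' t"
          using mono_onD[OF mono, of u s] mono_onD[OF mono, of s t] uv t by auto
        then show "norm (\<phi>' s) \<le> max \<bar>\<phi>' u\<bar> \<bar>\<phi>' t\<bar>" by auto
      qed (use t in auto)
      ultimately show "((\<lambda>s. (D s - D t) * \<phi>' s) \<longlongrightarrow> 0) (at_left t)"
        by (intro lim_null_mult_right_bounded)
    qed
    then have "\<forall>\<^sub>F s in at_left t. ?W s < R t - D1 t * \<phi> t + e"
      using e by (intro order_tendstoD(2)) auto
    moreover have "\<forall>\<^sub>F s in at_left t. D t * (\<phi>' s - \<phi>' t) \<le> 0"
    proof (cases "D t < 0")
      case True
      then have "\<forall>\<^sub>F s in at_left t. \<phi>' s = \<phi>' t"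
        using loc[OF t(1)] by (auto intro: filter_leD[OF at_le])
      then show ?thesis by eventually_elim simp
    next
      case False
      have "\<phi>' s \<le> \<phi>' t" if "a < s" "s < t" for s
        using mono_onD[OF mono _ t(1), of s] t that by auto
      then show ?thesis
        using False t by (auto simp: eventually_at_left_field intro!: exI[of _ a] mult_nonneg_nonpos)
    qed
    ultimately show "\<forall>\<^sub>F s in at_left t. R s - D1 s * \<phi> s + D s * \<phi>' s - e
        \<le> R t - D1 t * \<phi> t + D t * \<phi>' t"
      by eventually_elim (simp add: algebra_simps)
  qed
qed

lemma mean_value_open_interval:
  fixes f f' :: "real \<Rightarrow> real"
  assumes "a < b" "continuous_on {a..b} f"
    and "\<And>x. a < x \<Longrightarrow> x < b \<Longrightarrow> (f has_real_derivative f' x) (at x)"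
  obtains z where "a < z" "z < b" "f b - f a = (b - a) * f' z"
proof -
  obtain z where "z \<in> {a<..<b}" "f b - f a = f' z * (b - a)"
    using mvt[OF assms(1,2), of "\<lambda>x. (*) (f' x)"] assms(3) by (auto simp: has_field_derivative_def)
  then show ?thesis using that by (auto simp: mult.commute)
qed

text \<open>
  If \<open>D\<close> and \<open>D''\<close> had opposite signs throughout, \<open>D\<close> would keep one sign, say positive, and
  be concave; a concave function that starts with value and slope zero is not positive.
\<close>
lemma clamped_not_opposite_to_second_derivative:
  fixes D D1 D2 :: "real \<Rightarrow> real"
  assumes "a < b"
    and D: "\<And>t. t \<in> {a<..<b} \<Longrightarrow> (D has_real_derivative D1 t) (at t)"
    and D1: "\<And>t. t \<in> {a<..<b} \<Longrightarrow> (D1 has_real_derivative D2 t) (at t)"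
    and cont: "continuous_on {a..<b} D" "continuous_on {a..<b} D1"
    and clamp: "D a = 0" "D1 a = 0"
  shows "\<exists>t\<in>{a<..<b}. 0 \<le> D t * D2 t"
proof (rule ccontr)
  assume neg: "\<not> (\<exists>t\<in>{a<..<b}. 0 \<le> D t * D2 t)"
  obtain t where t: "a < t" "t < b" using dense \<open>a < b\<close> by blast
  obtain z where z: "a < z" "z < t" "D t - D a = (t - a) * D1 z"
    by (rule mean_value_open_interval[of a t D D1]) (use t D in \<open>auto intro: continuous_on_subset[OF cont(1)]\<close>)
  obtain w where w: "a < w" "w < z" "D1 z - D1 a = (z - a) * D2 w"
    by (rule mean_value_open_interval[of a z D1 D2]) (use z t D1 in \<open>auto intro: continuous_on_subset[OF cont(2)]\<close>)
  have Dt: "D t = (t - a) * (z - a) * D2 w" using z w clamp by simp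
  have conn: "connected (D ` {a<..<b})"
    by (intro connected_continuous_image continuous_on_subset[OF cont(1)]) auto
  have nz: "0 \<notin> D ` {a<..<b}" 
  proof
    assume "0 \<in> D ` {a<..<b}"
    then obtain x where "x \<in> {a<..<b}" "D x = 0" by auto
    then show False using neg bexI[of "\<lambda>t. 0 \<le> D t * D2 t" x "{a<..<b}"] by simp
  qed
  have "0 < D t * D w"
  proof (rule ccontr)
    assume "\<not> 0 < D t * D w"
    then have "D t \<le> 0 \<and> 0 \<le> D w \<or> D w \<le> 0 \<and> 0 \<le> D t"
      by (auto simp: not_less mult_le_0_iff)
    moreover have "D t \<in> D ` {a<..<b}" "D w \<in> D ` {a<..<b}" using t z w by auto
    ultimately have "0 \<in> D ` {a<..<b}" using connectedD_interval[OF conn] by blast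
    then show False using nz by simp
  qed
  moreover have "D w * D2 w < 0"
  proof (rule ccontr)
    assume "\<not> D w * D2 w < 0"
    then show False using neg t z w bexI[of "\<lambda>t. 0 \<le> D t * D2 t" w "{a<..<b}"] by simp
  qed
  moreover have "D t * D w = (t - a) * (z - a) * (D w * D2 w)" using Dt by simp
  moreover have "0 < (t - a) * (z - a)" using t z by simp
  ultimately show False using mult_pos_neg[of "(t - a) * (z - a)" "D w * D2 w"] by simp
qed

lemma contact_invelope_right_derivative_locally_constant:
  assumes inv: "contact_invelope a b X Y H H1 H2"
    and H3: "\<And>t. t \<in> {a<..<b} \<Longrightarrow> (H2 has_real_derivative H3 t) (at_right t)"
    and t: "t \<in> {a<..<b}" "Y t < H t"
  shows "\<forall>\<^sub>F s in at t. H3 s = H3 t"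
proof -
  obtain c d where cd: "a < c" "c < t" "t < d" "d < b" "affine_fun_on {c..d} H2"
    using contact_invelopeD(10)[OF inv t] by blast
  note cvx = contact_invelopeD(5)[OF inv]
  have "H3 s = H3 t" if "c < s" "s < d" for s
    by (rule right_derivative_of_affine[OF cvx H3 cd(1,4,5) that cd(2,3)])
  moreover have "\<forall>\<^sub>F s in at t. s \<in> {c<..<d}"
    using cd by (intro eventually_at_in_open') auto
  ultimately show ?thesis by (elim eventually_mono) simp
qed

lemma antiderivative_on_open_interval:
  fixes f :: "real \<Rightarrow> real"
  assumes "a < b" "\<And>t. t \<in> {a<..<b} \<Longrightarrow> isCont f t"
  obtains R where "\<And>t. t \<in> {a<..<b} \<Longrightarrow> (R has_real_derivative f t) (at t)"
proof -
  have "\<exists>R. \<forall>t. ereal a < ereal t \<longrightarrow> ereal t < ereal b \<longrightarrow> (R has_vector_derivative f t) (at t)"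
    using assms by (intro einterval_antiderivative) auto
  then obtain R where "\<forall>t. a < t \<longrightarrow> t < b \<longrightarrow> (R has_vector_derivative f t) (at t)" by auto
  then show ?thesis
    by (intro that[of R]) (simp add: has_real_derivative_iff_has_vector_derivative)
qed

text \<open>
  The hypothesis says \<open>(D\<^sup>2)'' \<ge> 0\<close>. A function that vanishes at both ends and is positive in
  between has a positive slope followed by a negative one, against monotonicity of the slope.
\<close>
lemma clamped_product_bound_imp_zero:
  fixes D D1 D2 :: "real \<Rightarrow> real"
  assumes D: "\<And>t. t \<in> {a<..<b} \<Longrightarrow> (D has_real_derivative D1 t) (at t)"
    and D1: "\<And>t. t \<in> {a<..<b} \<Longrightarrow> (D1 has_real_derivative D2 t) (at t)"
    and cont: "continuous_on {a..b} D" and ends: "D a = 0" "D b = 0"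
    and nn: "\<And>t. t \<in> {a<..<b} \<Longrightarrow> 0 \<le> D1 t * D1 t + D t * D2 t"
    and t: "t \<in> {a..b}"
  shows "D t = 0"
proof (rule ccontr)
  assume "D t \<noteq> 0"
  then have t: "a < t" "t < b" using t ends by (auto simp: less_le)
  let ?Q = "\<lambda>t. D t * D t"
  have Q: "(?Q has_real_derivative 2 * D t * D1 t) (at t)" if "a < t" "t < b" for t
    using that by (auto intro!: derivative_eq_intros D)
  have Q': "((\<lambda>t. 2 * D t * D1 t) has_real_derivative 2 * (D1 t * D1 t + D t * D2 t)) (at t)"
    if "a < t" "t < b" for t
    using that by (auto intro!: derivative_eq_intros D D1 simp: algebra_simps)
  have contQ: "continuous_on {a..b} ?Q" by (intro continuous_intros cont)
  obtain y where y: "a < y" "y < t" "?Q t - ?Q a = (t - a) * (2 * D y * D1 y)"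
    by (rule mean_value_open_interval[OF t(1), of ?Q "\<lambda>t. 2 * D t * D1 t"])
      (use Q t in \<open>auto intro: continuous_on_subset[OF contQ]\<close>)
  obtain z where z: "t < z" "z < b" "?Q b - ?Q t = (b - t) * (2 * D z * D1 z)"
    by (rule mean_value_open_interval[OF t(2), of ?Q "\<lambda>t. 2 * D t * D1 t"])
      (use Q t in \<open>auto intro: continuous_on_subset[OF contQ]\<close>)
  have "y < z" using y z by simp
  moreover have "continuous_on {y..z} (\<lambda>t. 2 * D t * D1 t)"
  proof (rule DERIV_continuous_on)
    fix t assume "t \<in> {y..z}"
    then show "((\<lambda>t. 2 * D t * D1 t) has_real_derivative 2 * (D1 t * D1 t + D t * D2 t)) (at t within {y..z})"
      using y z by (intro has_field_derivative_at_within[OF Q']) auto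
  qed
  ultimately obtain w where w: "y < w" "w < z" "2 * D z * D1 z - 2 * D y * D1 y
      = (z - y) * (2 * (D1 w * D1 w + D w * D2 w))"
    by (rule mean_value_open_interval[of y z "\<lambda>t. 2 * D t * D1 t" "\<lambda>t. 2 * (D1 t * D1 t + D t * D2 t)"])
      (use Q' y z in auto)
  have pos: "0 < ?Q t" using \<open>D t \<noteq> 0\<close> by (auto simp: zero_less_mult_iff)
  have "0 < (t - a) * (2 * D y * D1 y)" "(b - t) * (2 * D z * D1 z) < 0"
    unfolding y(3)[symmetric] z(3)[symmetric] using ends pos by auto
  then have "0 < 2 * D y * D1 y" "2 * D z * D1 z < 0"
    using t zero_less_mult_pos[of "t - a" "2 * D y * D1 y"]
      zero_less_mult_pos[of "b - t" "- (2 * D z * D1 z)"] by auto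
  moreover have "0 \<le> (z - y) * (2 * (D1 w * D1 w + D w * D2 w))"
    using nn[of w] w(1,2) y(1) z(2) \<open>y < z\<close> by (intro mult_nonneg_nonneg) auto
  ultimately show False using w(3) by linarith
qed

text \<open>
  Convexity of \<open>P = (D')\<^sup>2 - D D''\<close> is expressed through its right derivative \<open>B\<close>. Integration by
  parts is applied to the two invelopes separately, since each second derivative satisfies a support
  condition of its own.
\<close>
lemma contact_invelope_unique:
  fixes X Y :: "real \<Rightarrow> real"
  assumes ab: "a < b" and H: "contact_invelope a b X Y H H1 H2"
    and G: "contact_invelope a b X Y G G1 G2" and t: "t \<in> {a..b}"
  shows "H t = G t"
proof -
  let ?I = "{a<..<b}"
  define D D1 D2 where defs: "D = (\<lambda>t. H t - G t)" "D1 = (\<lambda>t. H1 t - G1 t)" "D2 = (\<lambda>t. H2 t - G2 t)"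
  note HD = contact_invelopeD[OF H] and GD = contact_invelopeD[OF G]
  have cvx: "convex_on ?I H2" "convex_on ?I G2" using HD(5) GD(5) by auto
  have within: "(D has_real_derivative D1 t) (at t within {a..b})" if "t \<in> {a..b}" for t
    unfolding defs using that by (intro DERIV_diff HD(1) GD(1))
  have D: "(D has_real_derivative D1 t) (at t)" if "t \<in> ?I" for t
    using within[of t] that at_within_Icc_at[of a t b] by auto
  have D1: "(D1 has_real_derivative D2 t) (at t)" if "t \<in> ?I" for t
    unfolding defs using that by (intro DERIV_diff HD(4) GD(4))
  have D2cont: "isCont D2 t" if "t \<in> ?I" for t
    using that cvx unfolding defs by (intro continuous_intros convex_on_open_interval_continuous) auto
  have contD: "continuous_on {a..b} D" using within by (rule DERIV_continuous_on)
  have contD1: "continuous_on {a..b} D1" unfolding defs by (intro continuous_intros HD(2) GD(2))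
  have ends: "D a = 0" "D1 a = 0" "D b = 0" "D1 b = 0" using HD(6-9) GD(6-9) by (auto simp: defs)
  obtain H3 where H3: "\<And>t. t \<in> ?I \<Longrightarrow> (H2 has_real_derivative H3 t) (at_right t)"
    using convex_has_right_derivative[OF cvx(1)] by blast
  obtain G3 where G3: "\<And>t. t \<in> ?I \<Longrightarrow> (G2 has_real_derivative G3 t) (at_right t)"
    using convex_has_right_derivative[OF cvx(2)] by blast
  have cont2: "isCont H2 t" "isCont G2 t" if "t \<in> ?I" for t
    using that convex_on_open_interval_continuous cvx by blast+
  have "isCont (\<lambda>t. D2 t * G2 t) t" if "t \<in> ?I" for t
    by (intro continuous_mult D2cont cont2 that)
  from antiderivative_on_open_interval[OF ab this]
  obtain R where R: "\<And>t. t \<in> ?I \<Longrightarrow> (R has_real_derivative D2 t * G2 t) (at t)" by blast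
  have "isCont (\<lambda>t. (- D2 t) * H2 t) t" if "t \<in> ?I" for t
    by (intro continuous_mult continuous_minus D2cont cont2 that)
  from antiderivative_on_open_interval[OF ab this]
  obtain S where S: "\<And>t. t \<in> ?I \<Longrightarrow> (S has_real_derivative (- D2 t) * H2 t) (at t)" by blast
  have monoG: "mono_on ?I (\<lambda>t. R t - D1 t * G2 t + D t * G3 t)"
  proof (rule integration_by_parts_monotone[OF D D1 R cvx(2) G3])
    fix t assume t: "t \<in> ?I" "D t < 0"
    then have "Y t < G t" using HD(3)[of t] by (auto simp: defs)
    then show "\<forall>\<^sub>F s in at t. G3 s = G3 t"
      by (intro contact_invelope_right_derivative_locally_constant[OF G _ t(1)] G3)
  qed
  have monoH: "mono_on ?I (\<lambda>t. S t - (- D1 t) * H2 t + (- D t) * H3 t)"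
  proof (rule integration_by_parts_monotone[where D = "\<lambda>t. - D t" and ?D1.0 = "\<lambda>t. - D1 t" and ?D2.0 = "\<lambda>t. - D2 t",
        OF DERIV_minus[OF D] DERIV_minus[OF D1] S cvx(1) H3])
    fix t assume t: "t \<in> ?I" "- D t < 0"
    then have "Y t < H t" using GD(3)[of t] by (auto simp: defs)
    then show "\<forall>\<^sub>F s in at t. H3 s = H3 t"
      by (intro contact_invelope_right_derivative_locally_constant[OF H _ t(1)] H3)
  qed
  \<comment> \<open>The right derivative of \<open>P\<close> below; formally \<open>B' = (D'')\<^sup>2 - D D''''\<close>.\<close>
  define B where "B t = D1 t * D2 t - D t * (H3 t - G3 t)" for t
  have monoB: "mono_on ?I B"
  proof (rule mono_onI)
    fix u v assume uv: "u \<in> ?I" "v \<in> ?I" "u \<le> v"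
    have "- (R u + S u) \<le> - (R v + S v)"
    proof (rule DERIV_nonneg_imp_nondecreasing[OF uv(3)])
      fix t assume "u \<le> t" "t \<le> v"
      then have "((\<lambda>t. - (R t + S t)) has_real_derivative - (D2 t * G2 t + (- D2 t) * H2 t)) (at t)"
        using uv by (intro DERIV_minus DERIV_add R S) auto
      moreover have "- (D2 t * G2 t + (- D2 t) * H2 t) = D2 t * D2 t" by (simp add: defs algebra_simps)
      ultimately show "\<exists>y. ((\<lambda>t. - (R t + S t)) has_real_derivative y) (at t) \<and> 0 \<le> y"
        by (intro exI[of _ "D2 t * D2 t"]) simp
    qed
    moreover have B: "B t = (R t - D1 t * G2 t + D t * G3 t) + (S t - (- D1 t) * H2 t + (- D t) * H3 t)
        + - (R t + S t)" for t
      by (simp add: B_def defs algebra_simps)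
    ultimately show "B u \<le> B v"
      using mono_onD[OF monoG uv] mono_onD[OF monoH uv] B[of u] B[of v] by linarith
  qed
  define P where "P t = D1 t * D1 t - D t * D2 t" for t
  have cvxP: "convex_on ?I P"
  proof (rule convex_on_if_right_derivative_mono[OF _ _ monoB])
    have "continuous_on ?I D2" using D2cont by (simp add: continuous_on_eq_continuous_at)
    then show "continuous_on ?I P" unfolding P_def
      by (intro continuous_intros continuous_on_subset[OF contD] continuous_on_subset[OF contD1]) auto
    fix t assume t: "t \<in> ?I"
    note D' = has_field_derivative_at_within[OF D[OF t]]
    note D1' = has_field_derivative_at_within[OF D1[OF t]]
    have "(D2 has_real_derivative H3 t - G3 t) (at_right t)"
      unfolding defs using t by (intro DERIV_diff H3 G3)
    from DERIV_diff[OF DERIV_mult[OF D1' D1'] DERIV_mult[OF D' this]]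
    show "(P has_real_derivative B t) (at_right t)"
      unfolding P_def B_def by (rule DERIV_cong) (simp add: algebra_simps)
  qed
  have P_nonpos: "P t \<le> 0" if t: "t \<in> ?I" for t
  proof (rule ccontr)
    assume "\<not> P t \<le> 0"
    then have p: "0 < P t" by simp
    \<comment> \<open>A convex function stays above its value at \<open>t\<close> on at least one side of \<open>t\<close>.\<close>
    have "(\<forall>s\<in>{a<..t}. P t \<le> P s) \<or> (\<forall>s\<in>{t..<b}. P t \<le> P s)"
    proof (rule ccontr)
      assume "\<not> ?thesis"
      then obtain r s where "r \<in> {a<..t}" "\<not> P t \<le> P r" "s \<in> {t..<b}" "\<not> P t \<le> P s"
        by blast
      then have rs: "a < r" "r \<le> t" "t \<le> s" "s < b" "P r < P t" "P s < P t" by simp_all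
      then have "r < t" "t < s" unfolding less_le by blast+
      then have "(P t - P r) / (t - r) \<le> (P s - P t) / (s - t)"
        using convex_on_three_slopes(3)[OF cvxP, of r s t] rs by auto
      moreover have "0 < (P t - P r) / (t - r)" "(P s - P t) / (s - t) < 0"
        using rs \<open>r < t\<close> \<open>t < s\<close> by (auto simp: divide_less_0_iff)
      ultimately show False by linarith
    qed
    then show False
    proof
      assume le: "\<forall>s\<in>{a<..t}. P t \<le> P s"
      have "((\<lambda>s. D1 s * D1 s) \<longlongrightarrow> D1 a * D1 a) (at_right a)"
        using contD1 ab by (intro tendsto_intros continuous_on_Icc_at_rightD) auto
      then have "\<forall>\<^sub>F s in at_right a. D1 s * D1 s < P t"
        using ends p by (intro order_tendstoD(2)) auto
      then obtain c where c: "a < c" "\<And>s. a < s \<Longrightarrow> s < c \<Longrightarrow> D1 s * D1 s < P t"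
        by (auto simp: eventually_at_right_field)
      have "\<exists>s\<in>{a<..<min c t}. 0 \<le> D s * D2 s"
        using t c ends
        by (intro clamped_not_opposite_to_second_derivative[where ?D1.0 = D1] D D1
            continuous_on_subset[OF contD] continuous_on_subset[OF contD1]) auto
      then obtain s where s: "a < s" "s < c" "s < t" "0 \<le> D s * D2 s" by auto
      then have "P t \<le> P s" using le by auto
      then show False using c(2)[OF s(1,2)] s(4) by (simp add: P_def)
    next
      assume le: "\<forall>s\<in>{t..<b}. P t \<le> P s"
      have "((\<lambda>s. D1 s * D1 s) \<longlongrightarrow> D1 b * D1 b) (at_left b)"
        using contD1 ab by (intro tendsto_intros continuous_on_Icc_at_leftD) auto
      then have "\<forall>\<^sub>F s in at_left b. D1 s * D1 s < P t"
        using ends p by (intro order_tendstoD(2)) auto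
      then obtain c where c: "c < b" "\<And>s. c < s \<Longrightarrow> s < b \<Longrightarrow> D1 s * D1 s < P t"
        by (auto simp: eventually_at_left_field)
      \<comment> \<open>The end point \<open>b\<close> is reduced to the previous case by reflection.\<close>
      have "\<exists>s\<in>{-b<..<- max c t}. 0 \<le> D (- s) * D2 (- s)"
      proof (rule clamped_not_opposite_to_second_derivative[where ?D1.0 = "\<lambda>s. - D1 (- s)"])
        show "- b < - max c t" using c t by auto
        fix s assume s: "s \<in> {-b<..<- max c t}"
        have "((\<lambda>s. D (- s)) has_real_derivative D1 (- s) * (- 1)) (at s)"
          using s c t by (intro DERIV_chain2[OF D] derivative_eq_intros) auto
        then show "((\<lambda>s. D (- s)) has_real_derivative - D1 (- s)) (at s)" by simp
        have "((\<lambda>s. D1 (- s)) has_real_derivative D2 (- s) * (- 1)) (at s)"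
          using s c t by (intro DERIV_chain2[OF D1] derivative_eq_intros) auto
        from DERIV_minus[OF this]
        show "((\<lambda>s. - D1 (- s)) has_real_derivative D2 (- s)) (at s)" by simp
      next
        show "continuous_on {-b..<- max c t} (\<lambda>s. D (- s))"
          using c t by (intro continuous_on_compose2[OF contD] continuous_intros) auto
        show "continuous_on {-b..<- max c t} (\<lambda>s. - D1 (- s))"
          using c t by (intro continuous_on_compose2[OF contD1] continuous_intros) auto
      qed (use ends in auto)
      then obtain r where r: "- b < r" "r < - max c t" "0 \<le> D (- r) * D2 (- r)" by auto
      define s where "s = - r"
      have s: "t < s" "s < b" "c < s" "0 \<le> D s * D2 s" using r by (auto simp: s_def)
      then have "P t \<le> P s" using le by auto
      then show False using c(2)[OF s(3,2)] s(4) by (simp add: P_def)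
    qed
  qed
  have "D t = 0"
  proof (rule clamped_product_bound_imp_zero[OF D D1 contD ends(1,3) _ t])
    fix s assume "s \<in> ?I"
    then show "0 \<le> D1 s * D1 s + D s * D2 s"
      using P_nonpos[of s] zero_le_square[of "D1 s"] unfolding P_def by linarith
  qed
  then show ?thesis by (simp add: defs)
qed

section \<open>The contact condition and the Stieltjes integral\<close>

text \<open>
  A nonnegative integrand with integral zero vanishes almost everywhere, so the Stieltjes measure of
  a small interval inside \<open>{Y < H}\<close> is zero and \<open>H3\<close> is constant there.
\<close>
lemma invelope_on_imp_contact_invelope:
  assumes Y: "continuous_on {a..b} Y" and inv: "invelope_on a b X Y H"
  shows "\<exists>H1 H2. contact_invelope a b X Y H H1 H2"
proof -
  obtain H1 H2 H3 where
      H1: "\<forall>t\<in>{a..b}. (H has_real_derivative H1 t) (at t within {a..b})" "continuous_on {a..b} H1"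
    and above: "\<forall>t\<in>{a..b}. Y t \<le> H t"
    and H2: "\<forall>t\<in>{a<..<b}. (H1 has_real_derivative H2 t) (at t)" "convex_on {a<..<b} H2"
    and ends: "H a = Y a" "H1 a = X a" "H b = Y b" "H1 b = X b"
    and H3: "\<forall>t\<in>{a<..<b}. (H2 has_real_derivative H3 t) (at_right t)"
    and int: "integrable (stieltjes_on a b H3) (\<lambda>t. H t - Y t)"
             "(\<integral>t. (H t - Y t) \<partial>stieltjes_on a b H3) = 0"
    using inv unfolding invelope_on_def by blast
  let ?M = "stieltjes_on a b H3"
  have mono: "mono_on {a<..<b} H3"
    by (rule convex_right_derivative_mono[OF H2(2)]) (use H3 in blast)
  have rc: "continuous (at_right t) H3" if "t \<in> {a<..<b}" for t
    by (rule convex_right_derivative_right_continuous[OF H2(2) _ that]) (use H3 in blast)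
  have "AE t in ?M. 0 \<le> H t - Y t"
    using above by (intro AE_I2) (auto simp: space_stieltjes_on)
  then have AE: "AE t in ?M. H t - Y t = 0"
    using integral_nonneg_eq_0_iff_AE[OF int(1)] int(2) by blast
  have "continuous_on {a..b} H"
    by (rule DERIV_continuous_on) (use H1 in blast)
  then have contD: "continuous_on {a..b} (\<lambda>t. H t - Y t)" using Y by (intro continuous_intros)
  have "\<exists>c d. a < c \<and> c < t \<and> t < d \<and> d < b \<and> affine_fun_on {c..d} H2"
    if t: "t \<in> {a<..<b}" "Y t < H t" for t
  proof -
    have "continuous (at t) (\<lambda>t. H t - Y t)"
      using continuous_on_interior[OF contD, of t] t by simp
    then have "\<forall>\<^sub>F s in at t. 0 < H s - Y s"
      using t by (intro order_tendstoD(1)[of _ "H t - Y t"]) (auto simp: isCont_def)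
    moreover have "\<forall>\<^sub>F s in at t. s \<in> {a<..<b}"
      using t by (intro eventually_at_in_open') auto
    ultimately have "\<forall>\<^sub>F s in at t. 0 < H s - Y s \<and> s \<in> {a<..<b}" by (rule eventually_conj)
    then obtain e where e: "0 < e" "\<forall>s. s \<noteq> t \<and> dist s t < e \<longrightarrow> 0 < H s - Y s \<and> s \<in> {a<..<b}"
      by (auto simp: eventually_at)
    have near: "0 < H s - Y s \<and> s \<in> {a<..<b}" if "\<bar>s - t\<bar> < e" for s
      using e(2) t that by (cases "s = t") (auto simp: dist_real_def)
    define c d where "c = t - e / 2" and "d = t + e / 2"
    have cd: "a < c" "c < t" "t < d" "d < b"
      using near[of c] near[of d] e(1) by (auto simp: c_def d_def)
    have "{c<..d} \<subseteq> {s \<in> space ?M. \<not> H s - Y s = 0}"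
    proof
      fix s assume "s \<in> {c<..d}"
      then have "\<bar>s - t\<bar> < e" using e(1) by (auto simp: c_def d_def abs_if)
      then show "s \<in> {s \<in> space ?M. \<not> H s - Y s = 0}"
        using near[of s] by (simp add: space_stieltjes_on)
    qed
    moreover obtain N where "{s \<in> space ?M. \<not> H s - Y s = 0} \<subseteq> N" "N \<in> sets ?M" "emeasure ?M N = 0"
      using AE by (auto elim!: AE_E)
    ultimately have "emeasure ?M {c<..d} = 0"
      using emeasure_mono[of "{c<..d}" N ?M] by auto
    moreover have "emeasure ?M {c<..d} = ennreal (H3 d - H3 c)"
      using cd by (intro emeasure_stieltjes_on mono rc) auto
    ultimately have "H3 d \<le> H3 c" by (simp add: ennreal_eq_0_iff)
    then have "affine_fun_on {c..d} H2"
      using cd H3 by (intro affine_if_right_derivative_eq[OF H2(2)]) auto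
    then show ?thesis using cd by blast
  qed
  then have "contact_invelope a b X Y H H1 H2"
    unfolding contact_invelope_def using H1 above H2 ends by blast
  then show ?thesis by blast
qed

text \<open>
  Rational intervals on which \<open>H3\<close> does not increase cover \<open>{Y < H}\<close>. There are countably many of
  them and each is a null set, so the integrand vanishes almost everywhere; this also gives the
  integrability.
\<close>
lemma contact_invelope_imp_invelope_on:
  assumes Y: "continuous_on {a..b} Y" and inv: "contact_invelope a b X Y H H1 H2"
  shows "invelope_on a b X Y H"
proof -
  note HD = contact_invelopeD[OF inv]
  obtain H3 where H3: "\<forall>t\<in>{a<..<b}. (H2 has_real_derivative H3 t) (at_right t)"
    using convex_has_right_derivative[OF HD(5)] by blast
  let ?M = "stieltjes_on a b H3"
  have mono: "mono_on {a<..<b} H3"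
    by (rule convex_right_derivative_mono[OF HD(5)]) (use H3 in blast)
  have rc: "continuous (at_right t) H3" if "t \<in> {a<..<b}" for t
    by (rule convex_right_derivative_right_continuous[OF HD(5) _ that]) (use H3 in blast)
  define Q where "Q = {(p, q). p \<in> \<rat> \<and> q \<in> \<rat> \<and> a < p \<and> p \<le> q \<and> q < b \<and> H3 q = H3 p}"
  have "(\<Union>(p, q)\<in>Q. {p<..q}) \<in> null_sets ?M"
  proof (rule null_sets_UN')
    have "Q \<subseteq> \<rat> \<times> \<rat>" by (auto simp: Q_def)
    then show "countable Q" by (rule countable_subset) (intro countable_SIGMA countable_rat)
  next
    fix pq assume "pq \<in> Q"
    then obtain p q where pq: "pq = (p, q)" "a < p" "p \<le> q" "q < b" "H3 q = H3 p"
      by (auto simp: Q_def)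
    have "{p<..q} \<in> sets ?M"
      unfolding sets_stieltjes_on_sigma using pq by (intro sigma_sets.Basic) auto
    moreover have "emeasure ?M {p<..q} = ennreal (H3 q - H3 p)"
      using pq by (intro emeasure_stieltjes_on mono rc) auto
    ultimately show "(case pq of (p, q) \<Rightarrow> {p<..q}) \<in> null_sets ?M"
      using pq by (simp add: null_sets_def)
  qed
  moreover have "{t \<in> space ?M. \<not> H t - Y t = 0} \<subseteq> (\<Union>(p, q)\<in>Q. {p<..q})"
  proof
    fix t assume "t \<in> {t \<in> space ?M. \<not> H t - Y t = 0}"
    then have t: "t \<in> {a<..<b}" "Y t < H t" using HD(3)[of t] by (auto simp: space_stieltjes_on)
    then obtain c d where cd: "a < c" "c < t" "t < d" "d < b" "affine_fun_on {c..d} H2"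
      using HD(10) by blast
    obtain p where p: "p \<in> \<rat>" "c < p" "p < t" using Rats_dense_in_real[OF cd(2)] by blast
    obtain q where q: "q \<in> \<rat>" "t < q" "q < d" using Rats_dense_in_real[OF cd(3)] by blast
    have "H3 q = H3 p"
      by (rule right_derivative_of_affine[OF HD(5) _ cd(1,4,5)]) (use H3 p q in auto)
    then have "(p, q) \<in> Q" using p q cd by (auto simp: Q_def)
    moreover have "t \<in> {p<..q}" using p q by auto
    ultimately show "t \<in> (\<Union>(p, q)\<in>Q. {p<..q})" by blast
  qed
  ultimately have AE: "AE t in ?M. H t - Y t = 0" by (rule AE_I')
  have "continuous_on {a..b} H"
    by (rule DERIV_continuous_on) (use HD(1) in blast)
  then have "continuous_on {a<..<b} (\<lambda>t. H t - Y t)"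
    using Y by (intro continuous_intros) (auto intro: continuous_on_subset)
  then have "(\<lambda>t. H t - Y t) \<in> borel_measurable (restrict_space borel {a<..<b})"
    by (rule borel_measurable_continuous_on_restrict)
  then have meas: "(\<lambda>t. H t - Y t) \<in> borel_measurable ?M"
    using measurable_cong_sets[OF sets_stieltjes_on refl] by blast
  have "integrable ?M (\<lambda>t. H t - Y t) \<longleftrightarrow> integrable ?M (\<lambda>t. 0 :: real)"
    using meas AE by (intro integrable_cong_AE) auto
  then have "integrable ?M (\<lambda>t. H t - Y t)" by simp
  moreover have "(\<integral>t. (H t - Y t) \<partial>?M) = 0" using AE by (rule integral_eq_zero_AE)
  ultimately show ?thesis
    unfolding invelope_on_def using HD H3 by blast
qed

section \<open>Limits of convex functions through their antiderivatives\<close>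

text \<open>
  Above, \<open>f s\<close> is at most the mean of \<open>f\<close> over a symmetric interval around \<open>s\<close>. Below, the mean of
  \<open>f\<close> over \<open>[s, s + d]\<close> is attained at some \<open>r\<close>, and \<open>f r\<close> is at most the average of \<open>f s\<close> and
  the value at the reflected point \<open>2 r - s\<close>, to which the upper bound applies.
\<close>
lemma convex_antiderivative_bound:
  fixes f F :: "real \<Rightarrow> real"
  assumes cvx: "convex_on {a<..<b} f"
    and F: "\<forall>t\<in>{a<..<b}. (F has_real_derivative f t) (at t)"
    and M: "\<forall>t\<in>{a<..<b}. \<bar>F t\<bar> \<le> M"
    and d: "0 < d" and s: "a + d < s" "s + 3 * d < b"
  shows "\<bar>f s\<bar> \<le> 5 * M / d"
proof -
  have upper: "f s \<le> M / d" if s: "a + d < s" "s + d < b" for s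
  proof -
    have der: "((\<lambda>h. F (s + h) - F (s - h)) has_real_derivative f (s + h) + f (s - h)) (at h)"
      if "0 \<le> h" "h \<le> d" for h
    proof -
      have "((\<lambda>h. F (s + h)) has_real_derivative f (s + h) * 1) (at h)"
        using that s F by (intro DERIV_chain2[where f = F] derivative_eq_intros) auto
      moreover have "((\<lambda>h. F (s - h)) has_real_derivative f (s - h) * (- 1)) (at h)"
        using that s F by (intro DERIV_chain2[where f = F] derivative_eq_intros) auto
      ultimately show ?thesis using DERIV_diff by fastforce
    qed
    \<comment> \<open>Mean value theorem for the symmetric difference of \<open>F\<close> around \<open>s\<close>.\<close>
    obtain h where h: "0 < h" "h < d"
      "(F (s + d) - F (s - d)) - (F (s + 0) - F (s - 0)) = (d - 0) * (f (s + h) + f (s - h))"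
      using MVT2[OF d, of "\<lambda>h. F (s + h) - F (s - h)" "\<lambda>h. f (s + h) + f (s - h)"] der by blast
    have "f s \<le> (f (s + h) + f (s - h)) / 2"
      using convex_onD[OF cvx, of "1/2" "s + h" "s - h"] h s by (simp add: field_simps)
    then have "2 * d * f s \<le> F (s + d) - F (s - d)"
      using h d mult_left_mono[of "f s" "(f (s + h) + f (s - h)) / 2" "2 * d"] by simp
    also have "\<dots> \<le> 2 * M" using M[rule_format, of "s + d"] M[rule_format, of "s - d"] s d by auto
    finally show ?thesis using d by (simp add: field_simps)
  qed
  have M0: "0 \<le> M" using M[rule_format, of s] s d by auto
  obtain r where r: "s < r" "r < s + d" "F (s + d) - F s = (s + d - s) * f r"
    using MVT2[of s "s + d" F f] F s d by auto
  have "- (2 * M) \<le> d * f r"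
    using r M[rule_format, of s] M[rule_format, of "s + d"] s d by auto
  then have 1: "- (2 * M / d) \<le> f r" using d by (simp add: field_simps)
  have 2: "f (2 * r - s) \<le> M / d" using upper[of "2 * r - s"] r s d by auto
  have "f r \<le> (f s + f (2 * r - s)) / 2"
    using convex_onD[OF cvx, of "1/2" s "2 * r - s"] r s d by (simp add: field_simps)
  then have "- (5 * M / d) \<le> f s" using 1 2 by (simp add: field_simps)
  moreover have "M / d \<le> 5 * M / d" using M0 d by (simp add: field_simps)
  moreover have "f s \<le> M / d" using upper[of s] s d by auto
  ultimately show ?thesis by linarith
qed

text \<open>
  A convex function with a bound on a neighbourhood is Lipschitz on a smaller one. The point of the
  estimate is that the constant depends on \<open>f\<close> only through the bound on its antiderivative.
\<close>
lemma convex_antiderivative_taylor: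
  fixes f F :: "real \<Rightarrow> real"
  assumes cvx: "convex_on {a<..<b} f"
    and F: "\<forall>t\<in>{a<..<b}. (F has_real_derivative f t) (at t)"
    and M: "\<forall>t\<in>{a<..<b}. \<bar>F t\<bar> \<le> M"
    and d: "0 < d" and t: "a + 5 * d < t" "t + 5 * d < b" and s: "\<bar>s - t\<bar> < d"
  shows "\<bar>F s - F t - f t * (s - t)\<bar> \<le> 5 * M / d\<^sup>2 * (s - t)\<^sup>2"
proof -
  let ?L = "5 * M / d\<^sup>2"
  have bd: "\<bar>f t\<bar> \<le> 5 * M / d" "\<bar>f (t + 2 * d)\<bar> \<le> 5 * M / d" "\<bar>f (t - 2 * d)\<bar> \<le> 5 * M / d"
    using t d by (auto intro!: convex_antiderivative_bound[OF cvx F M d])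
  have "(f (t + 2 * d) - f t) / (2 * d) \<le> (2 * (5 * M / d)) / (2 * d)"
       "(2 * - (5 * M / d)) / (2 * d) \<le> (f t - f (t - 2 * d)) / (2 * d)"
    using bd d by (intro divide_right_mono; simp)+
  then have sl: "(f (t + 2 * d) - f t) / (2 * d) \<le> ?L" "- ?L \<le> (f t - f (t - 2 * d)) / (2 * d)"
    using d by (simp_all add: power2_eq_square)
  have lip: "\<bar>f r - f t\<bar> \<le> ?L * \<bar>r - t\<bar>" if r: "\<bar>r - t\<bar> < d" for r
  proof -
    consider "r < t" | "r = t" | "t < r" by linarith
    then show ?thesis
    proof cases
      case 1
      have "(f t - f (t - 2 * d)) / (t - (t - 2 * d)) \<le> (f t - f r) / (t - r)"
        using 1 r t d by (intro convex_on_three_slopes(2)[OF cvx]) auto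
      moreover have "(f t - f r) / (t - r) \<le> (f (t + 2 * d) - f t) / (t + 2 * d - t)"
        using 1 r t d by (intro convex_on_three_slopes(3)[OF cvx]) auto
      ultimately have "- ?L \<le> (f t - f r) / (t - r)" "(f t - f r) / (t - r) \<le> ?L" using sl by auto
      then have "- ?L * (t - r) \<le> f t - f r" "f t - f r \<le> ?L * (t - r)"
        using 1 by (simp_all only: pos_le_divide_eq pos_divide_le_eq diff_gt_0_iff_gt)
      then show ?thesis using 1 by (simp add: abs_le_iff)
    next
      case 3
      have "(f t - f (t - 2 * d)) / (t - (t - 2 * d)) \<le> (f r - f t) / (r - t)"
        using 3 r t d by (intro convex_on_three_slopes(3)[OF cvx]) auto
      moreover have "(f r - f t) / (r - t) \<le> (f (t + 2 * d) - f t) / (t + 2 * d - t)"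
        using 3 r t d by (intro convex_on_three_slopes(1)[OF cvx]) auto
      ultimately have "- ?L \<le> (f r - f t) / (r - t)" "(f r - f t) / (r - t) \<le> ?L" using sl by auto
      then have "- ?L * (r - t) \<le> f r - f t" "f r - f t \<le> ?L * (r - t)"
        using 3 by (simp_all only: pos_le_divide_eq pos_divide_le_eq diff_gt_0_iff_gt)
      then show ?thesis using 3 by (simp add: abs_le_iff)
    qed simp
  qed
  have "0 \<le> 5 * M / d" using bd(1) by linarith
  then have L0: "0 \<le> ?L" using d by (simp add: zero_le_divide_iff)
  have "\<exists>r. \<bar>r - t\<bar> \<le> \<bar>s - t\<bar> \<and> F s - F t = (s - t) * f r"
  proof (cases s t rule: linorder_cases)
    case less
    obtain r where "s < r" "r < t" "F t - F s = (t - s) * f r"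
      using MVT2[OF less, of F f] F s t d by auto
    then show ?thesis by (intro exI[of _ r]) (auto simp: algebra_simps)
  next
    case greater
    obtain r where "t < r" "r < s" "F s - F t = (s - t) * f r"
      using MVT2[OF greater, of F f] F s t d by auto
    then show ?thesis by (intro exI[of _ r]) (auto simp: algebra_simps)
  qed auto
  then obtain r where r: "\<bar>r - t\<bar> \<le> \<bar>s - t\<bar>" "F s - F t = (s - t) * f r" by blast
  have "\<bar>F s - F t - f t * (s - t)\<bar> = \<bar>f r - f t\<bar> * \<bar>s - t\<bar>"
    unfolding r(2) by (simp add: abs_mult[symmetric] algebra_simps)
  also have "\<dots> \<le> (?L * \<bar>r - t\<bar>) * \<bar>s - t\<bar>"
    using lip[of r] r(1) s by (intro mult_right_mono) auto
  also have "\<dots> \<le> (?L * \<bar>s - t\<bar>) * \<bar>s - t\<bar>"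
    using r(1) L0 by (intro mult_right_mono mult_left_mono) auto
  also have "\<dots> = ?L * (s - t)\<^sup>2" by (simp add: power2_eq_square)
  finally show ?thesis .
qed

text \<open>
  Convexity upgrades convergence of antiderivatives to convergence of the functions: by the uniform
  Taylor estimate, difference quotients of \<open>F n\<close> approximate \<open>f n\<close> at a rate independent of \<open>n\<close>, and
  the difference quotients for a fixed increment converge.
\<close>
lemma convex_derivative_limit:
  fixes f F :: "nat \<Rightarrow> real \<Rightarrow> real"
  assumes cvx: "\<And>n. convex_on {a<..<b} (f n)"
    and F: "\<And>n. \<forall>t\<in>{a<..<b}. (F n has_real_derivative f n t) (at t)"
    and M: "\<And>n. \<forall>t\<in>{a<..<b}. \<bar>F n t\<bar> \<le> M"
    and lim: "\<And>t. t \<in> {a<..<b} \<Longrightarrow> (\<lambda>n. F n t) \<longlonglongrightarrow> G t"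
  shows "\<exists>g. convex_on {a<..<b} g \<and> (\<forall>t\<in>{a<..<b}. (G has_real_derivative g t) (at t)) \<and>
             (\<forall>t\<in>{a<..<b}. (\<lambda>n. f n t) \<longlonglongrightarrow> g t)"
proof -
  have main: "\<exists>l. (\<lambda>n. f n t) \<longlonglongrightarrow> l \<and> (G has_real_derivative l) (at t)" if t: "t \<in> {a<..<b}" for t
  proof -
    define d where "d = min (t - a) (b - t) / 6"
    have "0 < d" "6 * d \<le> t - a" "6 * d \<le> b - t" using t by (auto simp: d_def)
    then have d: "0 < d" "a + 5 * d < t" "t + 5 * d < b" by linarith+
    define L where "L = 5 * M / d\<^sup>2"
    have "0 \<le> M" using M[of 0] t by fastforce
    then have L0: "0 \<le> L" by (simp add: L_def)
    have taylor: "\<bar>F n s - F n t - f n t * (s - t)\<bar> \<le> L * (s - t)\<^sup>2" if "\<bar>s - t\<bar> < d" for n s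
      unfolding L_def by (rule convex_antiderivative_taylor[OF cvx F M d that])
    have "Cauchy (\<lambda>n. f n t)"
    proof (rule CauchyI)
      fix e :: real assume e: "0 < e"
      \<comment> \<open>With this increment the Taylor error \<open>L h\<close> is below \<open>e / 4\<close> for all \<open>n\<close> at once.\<close>
      define h where "h = min (d / 2) (e / (4 * (L + 1)))"
      have h: "0 < h" "h < d" "h \<le> e / (4 * (L + 1))" using d e L0 by (auto simp: h_def)
      then have "4 * ((L + 1) * h) \<le> e" using L0 by (simp add: field_simps)
      then have Lh: "4 * (L * h) < e" using h(1) by (simp add: algebra_simps)
      have q: "\<bar>(F n (t + h) - F n t) / h - f n t\<bar> \<le> L * h" for n
      proof -
        have "(F n (t + h) - F n t) / h - f n t = (F n (t + h) - F n t - f n t * h) / h"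
          using h by (simp add: field_simps)
        then have "\<bar>(F n (t + h) - F n t) / h - f n t\<bar> \<le> (L * h\<^sup>2) / h"
          using taylor[of "t + h" n] h by (simp add: divide_right_mono)
        then show ?thesis using h by (simp add: power2_eq_square)
      qed
      have "(\<lambda>n. (F n (t + h) - F n t) / h) \<longlonglongrightarrow> (G (t + h) - G t) / h"
        using t d h by (intro tendsto_intros lim) auto
      then have "Cauchy (\<lambda>n. (F n (t + h) - F n t) / h)" by (rule LIMSEQ_imp_Cauchy)
      from CauchyD[OF this, of "e / 2"] e obtain N where
        N: "\<And>m n. m \<ge> N \<Longrightarrow> n \<ge> N \<Longrightarrow>
             \<bar>(F m (t + h) - F m t) / h - (F n (t + h) - F n t) / h\<bar> < e / 2" by auto
      have "\<bar>f m t - f n t\<bar> < e" if "m \<ge> N" "n \<ge> N" for m n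
        using N[OF that] q[of m] q[of n] Lh by linarith
      then show "\<exists>N. \<forall>m\<ge>N. \<forall>n\<ge>N. norm (f m t - f n t) < e" by auto
    qed
    then obtain l where l: "(\<lambda>n. f n t) \<longlonglongrightarrow> l" by (auto simp: Cauchy_convergent_iff convergent_def)
    have bd: "\<bar>G s - G t - l * (s - t)\<bar> \<le> L * (s - t)\<^sup>2" if "\<bar>s - t\<bar> < d" for s
    proof (rule Lim_bounded)
      show "(\<lambda>n. \<bar>F n s - F n t - f n t * (s - t)\<bar>) \<longlonglongrightarrow> \<bar>G s - G t - l * (s - t)\<bar>"
        using t d that by (intro tendsto_intros lim l) auto
      show "\<forall>n\<ge>0. \<bar>F n s - F n t - f n t * (s - t)\<bar> \<le> L * (s - t)\<^sup>2" using taylor[OF that] by blast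
    qed
    have "((\<lambda>s. (G s - G t) / (s - t)) \<longlongrightarrow> l) (at t)"
    proof (rule Lim_transform2)
      show "((\<lambda>s. l) \<longlongrightarrow> l) (at t)" by simp
      have "((\<lambda>s. L * \<bar>s - t\<bar>) \<longlongrightarrow> L * \<bar>t - t\<bar>) (at t)" by (intro tendsto_intros)
      then have lim0: "((\<lambda>s. L * \<bar>s - t\<bar>) \<longlongrightarrow> 0) (at t)" by simp
      have "\<forall>\<^sub>F s in at t. norm (l - (G s - G t) / (s - t)) \<le> L * \<bar>s - t\<bar>"
        unfolding eventually_at
      proof (intro exI[of _ d] conjI ballI impI d(1))
        fix s assume "s \<noteq> t \<and> dist s t < d"
        then have s: "s \<noteq> t" "\<bar>s - t\<bar> < d" by (auto simp: dist_real_def)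
        have "l - (G s - G t) / (s - t) = - (G s - G t - l * (s - t)) / (s - t)"
          using s by (simp add: field_simps)
        then have "norm (l - (G s - G t) / (s - t)) = \<bar>G s - G t - l * (s - t)\<bar> / \<bar>s - t\<bar>"
          by (simp only: real_norm_def abs_divide abs_minus_cancel)
        also have "\<dots> \<le> (L * (s - t)\<^sup>2) / \<bar>s - t\<bar>" using bd[OF s(2)] by (intro divide_right_mono) auto
        also have "\<dots> = L * \<bar>s - t\<bar>"
          using s by (simp add: field_simps power2_eq_square abs_mult_self_eq)
        finally show "norm (l - (G s - G t) / (s - t)) \<le> L * \<bar>s - t\<bar>" .
      qed
      then show "((\<lambda>s. l - (G s - G t) / (s - t)) \<longlongrightarrow> 0) (at t)"
        using lim0 by (rule Lim_null_comparison)
    qed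
    then have "(G has_real_derivative l) (at t)" by (simp add: has_field_derivative_iff)
    with l show ?thesis by blast
  qed
  then obtain g where g: "\<And>t. t \<in> {a<..<b} \<Longrightarrow> (\<lambda>n. f n t) \<longlonglongrightarrow> g t"
      "\<And>t. t \<in> {a<..<b} \<Longrightarrow> (G has_real_derivative g t) (at t)" by metis
  have "convex_on {a<..<b} g"
  proof (rule convex_onI)
    fix u x y :: real assume u: "0 < u" "u < 1" and xy: "x \<in> {a<..<b}" "y \<in> {a<..<b}"
    then have m: "(1 - u) *\<^sub>R x + u *\<^sub>R y \<in> {a<..<b}"
      using convexD_alt[of "{a<..<b}" x y u] by auto
    show "g ((1 - u) *\<^sub>R x + u *\<^sub>R y) \<le> (1 - u) * g x + u * g y"
    proof (rule LIMSEQ_le[OF g(1)[OF m]])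
      show "(\<lambda>n. (1 - u) * f n x + u * f n y) \<longlonglongrightarrow> (1 - u) * g x + u * g y"
        by (intro tendsto_intros g xy)
      show "\<exists>N. \<forall>n\<ge>N. f n ((1 - u) *\<^sub>R x + u *\<^sub>R y) \<le> (1 - u) * f n x + u * f n y"
        using convex_onD[OF cvx] u xy by auto
    qed
  qed simp
  then show ?thesis using g by blast
qed

section \<open>The modulus of continuity of the derivative of an invelope\<close>

lemma locally_affine_imp_affine:
  fixes f :: "real \<Rightarrow> real"
  assumes "\<forall>t\<in>{c<..<d}. \<exists>p q. p < t \<and> t < q \<and> affine_fun_on {p..q} f"
  shows "affine_fun_on {c<..<d} f"
proof -
  have loc: "\<exists>p q u v. p < t \<and> t < q \<and> (\<forall>x\<in>{p<..<q}. f x = u + v * x \<and> (f has_real_derivative v) (at x))"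
    if t: "t \<in> {c<..<d}" for t
  proof -
    obtain p q u v where pq: "p < t" "t < q" "\<And>x. x \<in> {p..q} \<Longrightarrow> f x = u + v * x"
      using assms t unfolding affine_fun_on_def by blast
    have "(f has_real_derivative v) (at x)" if x: "x \<in> {p<..<q}" for x
    proof (rule has_field_derivative_transform_within_open[where S = "{p<..<q}"])
      show "((\<lambda>x. u + v * x) has_real_derivative v) (at x)" by (auto intro!: derivative_eq_intros)
    qed (use x pq in auto)
    then show ?thesis using pq by (intro exI[of _ p] exI[of _ q] exI[of _ u] exI[of _ v]) auto
  qed
  have "\<exists>v. \<forall>t\<in>{c<..<d}. deriv f t = v"
  proof (rule has_field_derivative_zero_constant)
    fix t assume "t \<in> {c<..<d}"
    then obtain p q u v where pq: "p < t" "t < q" "\<forall>x\<in>{p<..<q}. (f has_real_derivative v) (at x)"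
      using loc by blast
    have "(deriv f has_real_derivative 0) (at t)"
    proof (rule has_field_derivative_transform_within_open[where S = "{p<..<q}" and f = "\<lambda>x. v"])
      show "v = deriv f x" if "x \<in> {p<..<q}" for x
        using pq(3) that by (metis DERIV_imp_deriv)
    qed (use pq in auto)
    then show "(deriv f has_real_derivative 0) (at t within {c<..<d})"
      by (rule has_field_derivative_at_within)
  qed simp
  then obtain v where v: "\<And>t. t \<in> {c<..<d} \<Longrightarrow> deriv f t = v" by blast
  have "\<exists>u. \<forall>t\<in>{c<..<d}. f t - v * t = u"
  proof (rule has_field_derivative_zero_constant)
    fix t assume t: "t \<in> {c<..<d}"
    then obtain v' where v': "(f has_real_derivative v') (at t)" using loc[OF t] by fastforce
    then have "v' = v" using v[OF t] DERIV_imp_deriv by blast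
    with v' have "((\<lambda>t. f t - v * t) has_real_derivative 0) (at t)"
      by (auto intro!: derivative_eq_intros)
    then show "((\<lambda>t. f t - v * t) has_real_derivative 0) (at t within {c<..<d})"
      by (rule has_field_derivative_at_within)
  qed simp
  then obtain u where u: "\<forall>t\<in>{c<..<d}. f t - v * t = u" by blast
  show ?thesis unfolding affine_fun_on_def
    by (intro exI[of _ u] exI[of _ v]) (use u in \<open>auto simp: algebra_simps\<close>)
qed

lemma contact_invelope_affine_between:
  assumes inv: "contact_invelope a b X Y H H1 H2"
    and "a \<le> c" "d \<le> b" "\<forall>t\<in>{c<..<d}. Y t < H t"
  shows "affine_fun_on {c<..<d} H2"
proof (intro locally_affine_imp_affine ballI)
  fix t assume t: "t \<in> {c<..<d}"
  then have "t \<in> {a<..<b}" "Y t < H t" using assms(2-) by auto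
  from contact_invelopeD(10)[OF inv this]
  show "\<exists>p q. p < t \<and> t < q \<and> affine_fun_on {p..q} H2" by blast
qed

text \<open>
  At an interior contact point \<open>H - Y\<close> is minimal, so its derivative vanishes.
\<close>
lemma contact_invelope_slope_at_contact:
  assumes inv: "contact_invelope a b X Y H H1 H2"
    and Y: "\<forall>t\<in>{a..b}. (Y has_real_derivative X t) (at t within {a..b})"
    and t: "t \<in> {a..b}" "H t = Y t"
  shows "H1 t = X t"
proof (cases "t = a \<or> t = b")
  case False
  then have t': "a < t" "t < b" using t by auto
  note HD = contact_invelopeD[OF inv]
  have "((\<lambda>t. H t - Y t) has_real_derivative H1 t - X t) (at t within {a..b})"
    using HD(1)[OF t(1)] Y t(1) by (intro DERIV_diff) auto
  then have der: "((\<lambda>t. H t - Y t) has_real_derivative H1 t - X t) (at t)"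
    using t' by (simp add: at_within_Icc_at)
  have "H1 t - X t = 0"
  proof (rule DERIV_local_min[OF der, of "min (t - a) (b - t)"])
    show "\<forall>y. \<bar>t - y\<bar> < min (t - a) (b - t) \<longrightarrow> H t - Y t \<le> H y - Y y"
    proof (intro allI impI)
      fix y assume "\<bar>t - y\<bar> < min (t - a) (b - t)"
      then have "y \<in> {a..b}" by (auto simp: abs_less_iff)
      then show "H t - Y t \<le> H y - Y y" using HD(3)[of y] t(2) by simp
    qed
  qed (use t' in auto)
  then show ?thesis by simp
qed (use contact_invelopeD(7,9)[OF inv] in auto)

text \<open>
  The contact set is compact and contains both end points. The last contact point before \<open>t\<close> and the
  first one after it bound the gap around \<open>t\<close>; they coincide with \<open>t\<close> if \<open>t\<close> is a contact point.
\<close>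
lemma contact_invelope_gap:
  assumes inv: "contact_invelope a b X Y H H1 H2" and Y: "continuous_on {a..b} Y"
    and t: "t \<in> {a..b}"
  obtains l r where "a \<le> l" "l \<le> t" "t \<le> r" "r \<le> b" "H l = Y l" "H r = Y r"
    "\<And>x. l < x \<Longrightarrow> x < r \<Longrightarrow> Y x < H x"
proof -
  note HD = contact_invelopeD[OF inv]
  have contH: "continuous_on {a..b} H" by (rule DERIV_continuous_on) (use HD(1) in blast)
  have closed: "closed {x\<in>S. H x = Y x}" if "closed S" "S \<subseteq> {a..b}" for S
    using that continuous_on_subset[OF contH] continuous_on_subset[OF Y]
    by (intro continuous_closed_preimage_constant[of S "\<lambda>x. H x - Y x" 0, simplified]) (auto intro!: continuous_intros)
  have cmp: "compact {x\<in>{a..t}. H x = Y x}" "compact {x\<in>{t..b}. H x = Y x}"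
    using closed[of "{a..t}"] closed[of "{t..b}"] t
    by (auto simp: compact_eq_bounded_closed intro: bounded_subset[OF bounded_closed_interval])
  obtain l where l: "l \<in> {x\<in>{a..t}. H x = Y x}" "\<And>x. x \<in> {x\<in>{a..t}. H x = Y x} \<Longrightarrow> x \<le> l"
    using compact_attains_sup[OF cmp(1)] HD(6) t by auto
  obtain r where r: "r \<in> {x\<in>{t..b}. H x = Y x}" "\<And>x. x \<in> {x\<in>{t..b}. H x = Y x} \<Longrightarrow> r \<le> x"
    using compact_attains_inf[OF cmp(2)] HD(8) t by auto
  show ?thesis
  proof (rule that[of l r])
    fix x assume x: "l < x" "x < r"
    have "H x \<noteq> Y x"
    proof
      assume "H x = Y x"
      then show False using l(2)[of x] r(2)[of x] l(1) r(1) x by (cases "x \<le> t") auto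
    qed
    moreover have "Y x \<le> H x" using HD(3)[of x] x l(1) r(1) t by auto
    ultimately show "Y x < H x" by simp
  qed (use l r in auto)
qed

text \<open>
  In a gap \<open>H''\<close> is affine, so \<open>H'\<close> is quadratic. It is determined by its end values \<open>X l\<close> and
  \<open>X r\<close> and its mean, which equals the mean of \<open>X\<close> and hence a value \<open>X m\<close>. All three differ from
  \<open>X l\<close> by at most \<open>W\<close>, which bounds the two higher coefficients after rescaling the gap to unit
  length.
\<close>
lemma derivative_modulus_on_gap:
  assumes inv: "contact_invelope a b X Y H H1 H2"
    and Y: "\<forall>t\<in>{a..b}. (Y has_real_derivative X t) (at t within {a..b})"
    and lr: "a \<le> l" "l < r" "r \<le> b" "H l = Y l" "H r = Y r"
    and gap: "\<And>x. l < x \<Longrightarrow> x < r \<Longrightarrow> Y x < H x"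
    and W: "\<And>x. x \<in> {l..r} \<Longrightarrow> \<bar>X x - X l\<bar> \<le> W"
    and st: "s \<in> {l..r}" "t \<in> {l..r}"
  shows "\<bar>H1 s - H1 t\<bar> \<le> 26 * W * \<bar>s - t\<bar> / (r - l)"
proof -
  note HD = contact_invelopeD[OF inv]
  have "affine_fun_on {l<..<r} H2"
    by (rule contact_invelope_affine_between[OF inv]) (use lr gap in auto)
  then obtain u v where uv: "\<And>x. x \<in> {l<..<r} \<Longrightarrow> H2 x = u + v * x"
    unfolding affine_fun_on_def by blast
  define A B C where "A = H1 l" and "B = u + v * l" and "C = v / 2"
  define L where "L = r - l"
  have L: "0 < L" using lr by (simp add: L_def)
  have H1: "H1 x = A + B * (x - l) + C * (x - l)\<^sup>2" if x: "x \<in> {l..r}" for x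
  proof -
    let ?E = "\<lambda>x. H1 x - (A + B * (x - l) + C * (x - l)\<^sup>2)"
    have "?E x = ?E l"
    proof (rule DERIV_isconst2[OF lr(2)])
      show "continuous_on {l..r} ?E"
        using lr by (intro continuous_intros continuous_on_subset[OF HD(2)]) auto
      fix y assume y: "l < y" "y < r"
      have "(?E has_real_derivative H2 y - (B + C * (2 * (y - l)))) (at y)"
        using y lr by (intro DERIV_diff HD(4)) (auto intro!: derivative_eq_intros)
      moreover have "H2 y - (B + C * (2 * (y - l))) = 0"
        using uv[of y] y by (simp add: B_def C_def algebra_simps)
      ultimately show "(?E has_real_derivative 0) (at y)" by simp
    qed (use x in auto)
    then show ?thesis by (simp add: A_def)
  qed
  have der: "(H has_real_derivative H1 x) (at x)" "(Y has_real_derivative X x) (at x)"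
    if "l < x" "x < r" for x
    using that lr HD(1)[of x] Y[rule_format, of x] by (auto simp: at_within_Icc_at)
  have cont: "continuous_on {l..r} H" "continuous_on {l..r} Y"
    by (rule continuous_on_subset[of "{a..b}"], rule DERIV_continuous_on, use HD(1) Y lr in auto)+
  have "H r - H l = A * L + B * L\<^sup>2 / 2 + C * L ^ 3 / 3"
  proof -
    let ?E = "\<lambda>x. H x - (A * (x - l) + B * (x - l)\<^sup>2 / 2 + C * (x - l) ^ 3 / 3)"
    have "?E r = ?E l"
    proof (rule DERIV_isconst2[OF lr(2)])
      show "continuous_on {l..r} ?E" by (intro continuous_intros cont ballI) simp_all
      fix y assume y: "l < y" "y < r"
      have "(?E has_real_derivative H1 y - (A + B * (2 * (y - l)) / 2 + C * (3 * (y - l)\<^sup>2) / 3)) (at y)"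
        by (intro DERIV_diff der y) (auto intro!: derivative_eq_intros)
      then show "(?E has_real_derivative 0) (at y)"
        by (rule DERIV_cong) (use H1[of y] y in simp)
    qed (use lr in auto)
    then show ?thesis by (simp add: L_def)
  qed
  moreover obtain m where m: "l < m" "m < r" "Y r - Y l = (r - l) * X m"
    by (rule mean_value_open_interval[OF lr(2) cont(2)]) (use der in auto)
  ultimately have "L * X m = L * (A + B * L / 2 + C * L\<^sup>2 / 3)"
    using lr by (simp add: L_def[symmetric] algebra_simps power2_eq_square power3_eq_cube)
  then have Xm: "X m = A + B * L / 2 + C * L\<^sup>2 / 3" using L by simp
  have "H1 l = X l" "H1 r = X r"
    using contact_invelope_slope_at_contact[OF inv Y] lr by auto
  then have Xl: "X l = A" and Xr: "X r = A + B * L + C * L\<^sup>2"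
    using H1[of r] lr by (auto simp: A_def L_def)
  define p n where "p = X r - X l" and "n = X m - X l"
  have pn: "\<bar>p\<bar> \<le> W" "\<bar>n\<bar> \<le> W" using W[of r] W[of m] m lr by (auto simp: p_def n_def)
  \<comment> \<open>The coefficients of the quadratic with value \<open>0\<close> at the left end, \<open>p\<close> at the right end and
      mean \<open>n\<close> on the unit interval.\<close>
  have BL: "B * L = 6 * n - 2 * p" and CL: "C * L\<^sup>2 = 3 * p - 6 * n"
    using Xm Xl Xr by (simp_all add: p_def n_def)
  define y z where "y = (s - l) / L" and "z = (t - l) / L"
  have yz: "0 \<le> y" "y \<le> 1" "0 \<le> z" "z \<le> 1" using st L by (auto simp: y_def z_def L_def)
  have s: "s - l = L * y" and t: "t - l = L * z" using L by (auto simp: y_def z_def)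
  have "H1 s - H1 t = B * (L * y - L * z) + C * ((L * y)\<^sup>2 - (L * z)\<^sup>2)"
    unfolding H1[OF st(1)] H1[OF st(2)] s t by (simp add: algebra_simps)
  also have "\<dots> = (B * L + C * L\<^sup>2 * (y + z)) * (y - z)"
    by (simp add: algebra_simps power2_eq_square)
  finally have "\<bar>H1 s - H1 t\<bar> = \<bar>B * L + C * L\<^sup>2 * (y + z)\<bar> * \<bar>y - z\<bar>" by (simp add: abs_mult)
  also have "\<dots> \<le> (26 * W) * \<bar>y - z\<bar>"
  proof (rule mult_right_mono)
    have "\<bar>B * L + C * L\<^sup>2 * (y + z)\<bar> \<le> \<bar>B * L\<bar> + \<bar>C * L\<^sup>2\<bar> * \<bar>y + z\<bar>"
      by (metis abs_mult abs_triangle_ineq)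
    also have "\<dots> \<le> 8 * W + (9 * W) * 2"
      using pn yz unfolding BL CL by (intro add_mono mult_mono) auto
    finally show "\<bar>B * L + C * L\<^sup>2 * (y + z)\<bar> \<le> 26 * W" by simp
  qed simp
  also have "\<bar>y - z\<bar> = \<bar>s - t\<bar> / (r - l)"
    using L by (simp add: y_def z_def L_def diff_divide_distrib[symmetric])
  finally show ?thesis by simp
qed

text \<open>
  Within one gap there are two cases. A gap shorter than \<open>\<delta>\<close> sees only the oscillation \<open>w\<close> of \<open>X\<close>;
  on a longer gap the slope of \<open>H'\<close> is at most of order \<open>M / \<delta>\<close>, which is harmless for
  increments below \<open>\<eta>\<close>. Two points in different gaps are joined through the contact points between
  them, where \<open>H'\<close> agrees with \<open>X\<close>; this gives \<open>26 + 1 + 26 = 53\<close>.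
\<close>
lemma contact_invelope_modulus:
  assumes inv: "contact_invelope a b X Y H H1 H2"
    and Y: "\<forall>t\<in>{a..b}. (Y has_real_derivative X t) (at t within {a..b})"
    and M: "\<forall>t\<in>{a..b}. \<bar>X t\<bar> \<le> M"
    and w: "\<forall>s\<in>{a..b}. \<forall>t\<in>{a..b}. \<bar>s - t\<bar> \<le> \<delta> \<longrightarrow> \<bar>X s - X t\<bar> \<le> w"
    and \<eta>: "0 < \<delta>" "\<eta> \<le> \<delta>" "2 * M * \<eta> \<le> w * \<delta>"
    and st: "s \<in> {a..b}" "t \<in> {a..b}" "\<bar>s - t\<bar> \<le> \<eta>"
  shows "\<bar>H1 s - H1 t\<bar> \<le> 53 * w"
proof -
  have contY: "continuous_on {a..b} Y" by (rule DERIV_continuous_on) (use Y in blast)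
  have M0: "0 \<le> M" using M st by fastforce
  have w0: "0 \<le> w" using w[rule_format, OF st(1,1)] \<eta> by simp
  have common: "\<bar>H1 x - H1 y\<bar> \<le> 26 * w"
    if lr: "a \<le> l" "r \<le> b" "H l = Y l" "H r = Y r" "\<And>x. l < x \<Longrightarrow> x < r \<Longrightarrow> Y x < H x"
      and xy: "x \<in> {l..r}" "y \<in> {l..r}" "\<bar>x - y\<bar> \<le> \<eta>" for l r x y
  proof (cases "l < r")
    case True
    note bd = derivative_modulus_on_gap[OF inv Y lr(1) True lr(2-5) _ xy(1,2)]
    show ?thesis
    proof (cases "r - l \<le> \<delta>")
      case small: True
      have "\<bar>H1 x - H1 y\<bar> \<le> 26 * w * \<bar>x - y\<bar> / (r - l)"
        using w lr True small by (intro bd) auto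
      also have "\<dots> \<le> 26 * w * (r - l) / (r - l)"
        using xy True w0 by (intro divide_right_mono mult_left_mono) auto
      finally show ?thesis using True by simp
    next
      case False
      have XM: "\<bar>X z - X l\<bar> \<le> 2 * M" if "z \<in> {l..r}" for z
      proof -
        have "\<bar>X z\<bar> \<le> M" "\<bar>X l\<bar> \<le> M" using M that lr True by auto
        then show ?thesis by linarith
      qed
      have "\<bar>H1 x - H1 y\<bar> \<le> 26 * (2 * M) * \<bar>x - y\<bar> / (r - l)"
        by (rule bd) (assumption | erule XM)+
      also have "\<dots> \<le> 26 * (2 * M) * \<eta> / \<delta>"
        using xy(3) False \<eta> M0 by (intro frac_le mult_left_mono mult_nonneg_nonneg) auto
      also have "\<dots> \<le> 26 * (w * \<delta>) / \<delta>"
        using \<eta> by (intro divide_right_mono) (auto simp: mult_ac)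
      finally show ?thesis using \<eta> by simp
    qed
  next
    case False
    then have "x = y" using xy by auto
    then show ?thesis using w0 by simp
  qed
  have main: "\<bar>H1 s - H1 t\<bar> \<le> 53 * w"
    if st: "s \<in> {a..b}" "t \<in> {a..b}" "\<bar>s - t\<bar> \<le> \<eta>" "s \<le> t" for s t
  proof -
    obtain l r where lr: "a \<le> l" "l \<le> s" "s \<le> r" "r \<le> b" "H l = Y l" "H r = Y r"
      "\<And>x. l < x \<Longrightarrow> x < r \<Longrightarrow> Y x < H x"
      using contact_invelope_gap[OF inv contY st(1)] by blast
    obtain l' r' where lr': "a \<le> l'" "l' \<le> t" "t \<le> r'" "r' \<le> b" "H l' = Y l'" "H r' = Y r'"
      "\<And>x. l' < x \<Longrightarrow> x < r' \<Longrightarrow> Y x < H x"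
      using contact_invelope_gap[OF inv contY st(2)] by blast
    show ?thesis
    proof (cases "t \<le> r")
      case True
      have "\<bar>H1 s - H1 t\<bar> \<le> 26 * w"
        using common[OF lr(1,4-7), of s t] lr st True by auto
      then show ?thesis using w0 by simp
    next
      case False
      then have "r \<le> l'" using lr'(7)[of r] lr(6) lr'(3) by fastforce
      have "\<bar>H1 s - H1 r\<bar> \<le> 26 * w"
        using common[OF lr(1,4-7), of s r] lr st False by auto
      moreover have "\<bar>H1 l' - H1 t\<bar> \<le> 26 * w"
        using common[OF lr'(1,4-7), of l' t] lr lr' st \<open>r \<le> l'\<close> by auto
      moreover have "H1 r = X r" "H1 l' = X l'"
        using contact_invelope_slope_at_contact[OF inv Y] lr lr' st by auto
      moreover have "\<bar>X r - X l'\<bar> \<le> w"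
        using lr lr' st \<eta> \<open>r \<le> l'\<close> by (intro w[rule_format]) auto
      ultimately show ?thesis by linarith
    qed
  qed
  show ?thesis
  proof (cases "s \<le> t")
    case True
    then show ?thesis using main[of s t] st by simp
  next
    case False
    then have "\<bar>t - s\<bar> \<le> \<eta>" "t \<le> s" using st(3) by (simp_all add: abs_minus_commute)
    then show ?thesis using main[of t s] st by (simp add: abs_minus_commute)
  qed
qed

section \<open>Stability under uniform convergence of the paths\<close>

text \<open>
  From some index on, the modulus of the limit serves all functions; the finitely many remaining ones
  are uniformly continuous each.
\<close>
lemma uniform_limit_equicontinuous:
  fixes F :: "nat \<Rightarrow> real \<Rightarrow> real"
  assumes F: "\<And>n. continuous_on {a..b} (F n)" and f: "continuous_on {a..b} f"
    and lim: "uniform_limit {a..b} F f sequentially" and e: "0 < e"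
  shows "\<exists>d>0. \<forall>n. \<forall>s\<in>{a..b}. \<forall>t\<in>{a..b}. \<bar>s - t\<bar> \<le> d \<longrightarrow> \<bar>F n s - F n t\<bar> \<le> e"
proof -
  have uc: "\<exists>d>0. \<forall>s\<in>{a..b}. \<forall>t\<in>{a..b}. \<bar>s - t\<bar> \<le> d \<longrightarrow> \<bar>g s - g t\<bar> \<le> e'"
    if g: "continuous_on {a..b} g" and e': "0 < e'" for g :: "real \<Rightarrow> real" and e'
  proof -
    have "uniformly_continuous_on {a..b} g"
      using g by (intro compact_uniformly_continuous) auto
    then obtain d where d: "0 < d" "\<forall>t\<in>{a..b}. \<forall>s\<in>{a..b}. dist s t < d \<longrightarrow> dist (g s) (g t) < e'"
      unfolding uniformly_continuous_on_def using e' by blast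
    then have "\<bar>g s - g t\<bar> \<le> e'" if "s \<in> {a..b}" "t \<in> {a..b}" "\<bar>s - t\<bar> \<le> d / 2" for s t
    proof -
      have "dist s t < d" using that(3) d(1) by (simp add: dist_real_def)
      then have "dist (g s) (g t) < e'" using d(2) that(1,2) by blast
      then show ?thesis by (simp add: dist_real_def)
    qed
    then show ?thesis using d(1) by (intro exI[of _ "d / 2"]) auto
  qed
  have e3: "0 < e / 3" using e by simp
  obtain N where N: "\<And>n t. n \<ge> N \<Longrightarrow> t \<in> {a..b} \<Longrightarrow> dist (F n t) (f t) < e / 3"
    using uniform_limitD[OF lim e3] unfolding eventually_sequentially by blast
  obtain d0 where d0: "0 < d0" "\<And>s t. s \<in> {a..b} \<Longrightarrow> t \<in> {a..b} \<Longrightarrow> \<bar>s - t\<bar> \<le> d0 \<Longrightarrow> \<bar>f s - f t\<bar> \<le> e / 3"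
    using uc[OF f e3] by blast
  obtain d where d: "\<And>n. 0 < d n" "\<And>n s t. s \<in> {a..b} \<Longrightarrow> t \<in> {a..b} \<Longrightarrow> \<bar>s - t\<bar> \<le> d n \<Longrightarrow> \<bar>F n s - F n t\<bar> \<le> e"
    using uc[OF F e] by metis
  define \<delta> where "\<delta> = Min (insert d0 (d ` {..<N}))"
  have "0 < \<delta>" unfolding \<delta>_def using d d0 by (subst Min_gr_iff) auto
  moreover have "\<bar>F n s - F n t\<bar> \<le> e" if st: "s \<in> {a..b}" "t \<in> {a..b}" "\<bar>s - t\<bar> \<le> \<delta>" for n s t
  proof (cases "n < N")
    case True
    then have "\<delta> \<le> d n" unfolding \<delta>_def by (intro Min_le) auto
    then show ?thesis using d(2) st by auto
  next
    case False
    have "\<delta> \<le> d0" unfolding \<delta>_def by (intro Min_le) auto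
    then have "\<bar>f s - f t\<bar> \<le> e / 3" using d0(2) st by auto
    moreover have "\<bar>F n s - f s\<bar> < e / 3" "\<bar>F n t - f t\<bar> < e / 3"
      using N[of n] st False by (auto simp: dist_real_def)
    ultimately show ?thesis by linarith
  qed
  ultimately show ?thesis by blast
qed

lemma uniform_limit_uniformly_bounded:
  fixes F :: "nat \<Rightarrow> real \<Rightarrow> real"
  assumes F: "\<And>n. continuous_on {a..b} (F n)" and f: "continuous_on {a..b} f"
    and lim: "uniform_limit {a..b} F f sequentially"
  shows "\<exists>M. \<forall>n. \<forall>t\<in>{a..b}. \<bar>F n t\<bar> \<le> M"
proof -
  have bd: "\<exists>M. \<forall>t\<in>{a..b}. \<bar>g t\<bar> \<le> M" if "continuous_on {a..b} g" for g :: "real \<Rightarrow> real"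
    using compact_imp_bounded[OF compact_continuous_image[OF that compact_Icc]]
    by (auto simp: bounded_iff)
  obtain N where N: "\<And>n t. n \<ge> N \<Longrightarrow> t \<in> {a..b} \<Longrightarrow> dist (F n t) (f t) < 1"
    using uniform_limitD[OF lim zero_less_one] unfolding eventually_sequentially by blast
  obtain m0 where m0: "\<And>t. t \<in> {a..b} \<Longrightarrow> \<bar>f t\<bar> \<le> m0" using bd[OF f] by blast
  obtain m where m: "\<And>n t. t \<in> {a..b} \<Longrightarrow> \<bar>F n t\<bar> \<le> m n" using bd[OF F] by metis
  have "\<bar>F n t\<bar> \<le> Max (insert (m0 + 1) (m ` {..<N}))" if t: "t \<in> {a..b}" for n t
  proof (cases "n < N")
    case True
    then have "m n \<le> Max (insert (m0 + 1) (m ` {..<N}))" by (intro Max_ge) auto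
    then show ?thesis using m[OF t, of n] by linarith
  next
    case False
    then have "\<bar>F n t\<bar> \<le> m0 + 1" using N[of n t] m0[OF t] t by (auto simp: dist_real_def)
    also have "\<dots> \<le> Max (insert (m0 + 1) (m ` {..<N}))" by (intro Max_ge) auto
    finally show ?thesis .
  qed
  then show ?thesis by blast
qed

abbreviation primitive :: "real \<Rightarrow> (real \<Rightarrow> real) \<Rightarrow> real \<Rightarrow> real" where
  "primitive a f \<equiv> \<lambda>t. integral {a..t} f"

lemma uniform_limit_primitive:
  fixes F :: "nat \<Rightarrow> real \<Rightarrow> real"
  assumes F: "\<And>n. continuous_on {a..b} (F n)" and f: "continuous_on {a..b} f"
    and lim: "uniform_limit {a..b} F f sequentially"
  shows "uniform_limit {a..b} (\<lambda>n. primitive a (F n)) (primitive a f) sequentially"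
proof (rule uniform_limitI)
  fix e :: real assume e: "0 < e"
  define d where "d = e / (\<bar>b - a\<bar> + 1)"
  have d: "0 < d" using e by (simp add: d_def)
  have "\<forall>\<^sub>F n in sequentially. \<forall>t\<in>{a..b}. dist (F n t) (f t) < d"
    by (rule uniform_limitD[OF lim d])
  then show "\<forall>\<^sub>F n in sequentially. \<forall>t\<in>{a..b}. dist (primitive a (F n) t) (primitive a f t) < e"
  proof (eventually_elim, intro ballI)
    fix n t assume n: "\<forall>t\<in>{a..b}. dist (F n t) (f t) < d" and t: "t \<in> {a..b}"
    have cont: "continuous_on {a..t} (F n)" "continuous_on {a..t} f"
      using continuous_on_subset[OF F] continuous_on_subset[OF f] t by auto
    have "norm (integral {a..t} (\<lambda>s. F n s - f s)) \<le> d * (t - a)"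
    proof (rule integral_bound)
      show "norm (F n s - f s) \<le> d" if "s \<in> {a..t}" for s
        using n t that by (force simp: dist_norm)
    qed (use t cont in \<open>auto intro!: continuous_intros\<close>)
    also have "\<dots> \<le> d * \<bar>b - a\<bar>" using t d by (intro mult_left_mono) auto
    also have "\<dots> < d * (\<bar>b - a\<bar> + 1)" using d by simp
    also have "\<dots> = e" by (simp add: d_def)
    finally have "norm (integral {a..t} (\<lambda>s. F n s - f s)) < e" .
    moreover have "integral {a..t} (\<lambda>s. F n s - f s) = integral {a..t} (F n) - integral {a..t} f"
      by (intro integral_diff integrable_continuous_real cont)
    ultimately show "dist (primitive a (F n) t) (primitive a f t) < e" by (simp only: dist_norm)
  qed
qed

lemma primitive_eq:
  fixes f F :: "real \<Rightarrow> real"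
  assumes F: "\<forall>t\<in>{a..b}. (F has_real_derivative f t) (at t within {a..b})" and "F a = 0"
    and t: "t \<in> {a..b}"
  shows "primitive a f t = F t"
proof -
  have "(f has_integral F t - F a) {a..t}"
  proof (rule fundamental_theorem_of_calculus)
    fix x assume "x \<in> {a..t}"
    then have "x \<in> {a..b}" "{a..t} \<subseteq> {a..b}" using t by auto
    then have "(F has_real_derivative f x) (at x within {a..t})"
      using F DERIV_subset by blast
    then show "(F has_vector_derivative f x) (at x within {a..t})"
      by (simp add: has_real_derivative_iff_has_vector_derivative)
  qed (use t in auto)
  then show ?thesis using assms(2) by (simp add: integral_unique)
qed

text \<open>
  Being affine on \<open>[c, d]\<close> means agreeing with the chord, which is an equation between finitely many
  values and passes to pointwise limits.
\<close>
lemma affine_fun_on_limit: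
  fixes f :: "nat \<Rightarrow> real \<Rightarrow> real"
  assumes "c < d" and aff: "\<forall>\<^sub>F n in sequentially. affine_fun_on {c..d} (f n)"
    and lim: "\<And>t. t \<in> {c..d} \<Longrightarrow> (\<lambda>n. f n t) \<longlonglongrightarrow> g t"
  shows "affine_fun_on {c..d} g"
proof -
  let ?chord = "\<lambda>f t. f c + (f d - f c) / (d - c) * (t - c) :: real"
  have chord: "g t = ?chord g t" if t: "t \<in> {c..d}" for t
  proof (rule LIMSEQ_unique[OF lim[OF t]])
    have "\<forall>\<^sub>F n in sequentially. ?chord (f n) t = f n t"
      using aff
    proof eventually_elim
      case (elim n)
      then obtain p q where "\<And>x. x \<in> {c..d} \<Longrightarrow> f n x = p + q * x" unfolding affine_fun_on_def by blast
      then have "f n c = p + q * c" "f n d = p + q * d" "f n t = p + q * t" using t \<open>c < d\<close> by auto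
      moreover have "(p + q * d - (p + q * c)) / (d - c) = q" using \<open>c < d\<close> by (simp add: field_simps)
      ultimately show ?case by (simp add: algebra_simps)
    qed
    moreover have "(\<lambda>n. ?chord (f n) t) \<longlonglongrightarrow> ?chord g t"
      using \<open>c < d\<close> by (intro tendsto_intros lim) auto
    ultimately show "(\<lambda>n. f n t) \<longlonglongrightarrow> ?chord g t" by (rule Lim_transform_eventually[rotated])
  qed
  have "g t = (g c - (g d - g c) / (d - c) * c) + (g d - g c) / (d - c) * t" if "t \<in> {c..d}" for t
    by (rule trans[OF chord[OF that]]) (simp add: right_diff_distrib del: times_divide_eq_left)
  then show ?thesis unfolding affine_fun_on_def by blast
qed

text \<open>
  Equicontinuity of the derivatives up to the end points is what keeps the four boundary conditions
  in the limit. For the contact condition, a point strictly above the limit obstacle has a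
  neighbourhood on which the approximating invelopes are eventually strictly above theirs, so that
  their second derivatives are affine on one common interval.
\<close>
theorem contact_invelope_stable:
  fixes X :: "real \<Rightarrow> real" and Xs :: "nat \<Rightarrow> real \<Rightarrow> real"
  assumes ab: "a < b" and Xs: "\<And>n. continuous_on {a..b} (Xs n)" and X: "continuous_on {a..b} X"
    and lim: "uniform_limit {a..b} Xs X sequentially"
    and inv: "\<And>n. contact_invelope a b (Xs n) (primitive a (Xs n)) (H n) (H1 n) (H2 n)"
  shows "\<exists>k G G1 G2. strict_mono (k :: nat \<Rightarrow> nat) \<and> contact_invelope a b X (primitive a X) G G1 G2 \<and>
           (\<forall>t\<in>{a..b}. (\<lambda>n. H (k n) t) \<longlonglongrightarrow> G t)"
proof -
  note HD = contact_invelopeD[OF inv]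
  have Yder: "\<forall>t\<in>{a..b}. (primitive a g has_real_derivative g t) (at t within {a..b})"
    if "continuous_on {a..b} g" for g :: "real \<Rightarrow> real"
    using integral_has_real_derivative[OF that] by blast
  obtain M where M: "\<And>n. \<forall>t\<in>{a..b}. \<bar>Xs n t\<bar> \<le> M"
    using uniform_limit_uniformly_bounded[OF Xs X lim] by blast
  have M0: "0 \<le> M" using M[of 0] ab by fastforce
  have equi: "\<exists>\<eta>>0. \<forall>n. \<forall>s\<in>{a..b}. \<forall>t\<in>{a..b}. \<bar>s - t\<bar> \<le> \<eta> \<longrightarrow> \<bar>H1 n s - H1 n t\<bar> \<le> 53 * w" if w: "0 < w" for w
  proof -
    obtain \<delta> where \<delta>: "0 < \<delta>"
      "\<And>n. \<forall>s\<in>{a..b}. \<forall>t\<in>{a..b}. \<bar>s - t\<bar> \<le> \<delta> \<longrightarrow> \<bar>Xs n s - Xs n t\<bar> \<le> w"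
      using uniform_limit_equicontinuous[OF Xs X lim w] by blast
    \<comment> \<open>The denominator \<open>2 M + 1\<close> instead of \<open>2 M\<close> covers \<open>M = 0\<close>.\<close>
    define \<eta> where "\<eta> = min \<delta> (w * \<delta> / (2 * M + 1))"
    have \<eta>: "0 < \<eta>" "\<eta> \<le> \<delta>" using \<delta> w M0 by (auto simp: \<eta>_def)
    have "\<eta> \<le> w * \<delta> / (2 * M + 1)" by (simp add: \<eta>_def)
    then have "(2 * M + 1) * \<eta> \<le> w * \<delta>" using M0 by (simp add: field_simps)
    then have "2 * M * \<eta> \<le> w * \<delta>" using \<eta> by (simp add: algebra_simps)
    then have "\<bar>H1 n s - H1 n t\<bar> \<le> 53 * w" if "s \<in> {a..b}" "t \<in> {a..b}" "\<bar>s - t\<bar> \<le> \<eta>" for n s t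
      by (rule contact_invelope_modulus[OF inv Yder[OF Xs] M \<delta>(2,1) \<eta>(2)]) fact+
    then show ?thesis using \<eta>(1) by blast
  qed
  have bound: "\<exists>B. \<forall>n. \<forall>t\<in>{a..b}. \<bar>H1 n t\<bar> \<le> B"
  proof -
    have w: "\<bar>Xs n s - Xs n t\<bar> \<le> 2 * M + 1" if "s \<in> {a..b}" "t \<in> {a..b}" for n s t
    proof -
      have "\<bar>Xs n s\<bar> \<le> M" "\<bar>Xs n t\<bar> \<le> M" using M that by auto
      then show ?thesis by linarith
    qed
    \<comment> \<open>The trivial modulus, with \<open>w = 2 M + 1\<close> and both thresholds equal to \<open>b - a\<close>, gives a uniform
        bound.\<close>
    have le: "2 * M * (b - a) \<le> (2 * M + 1) * (b - a)" using ab by simp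
    have 1: "\<bar>H1 n t - H1 n a\<bar> \<le> 53 * (2 * M + 1)" if "t \<in> {a..b}" for n t
      by (rule contact_invelope_modulus[OF inv Yder[OF Xs] M, where \<delta> = "b - a" and \<eta> = "b - a"])
        (use w ab that le in auto)
    have 2: "\<bar>H1 n a\<bar> \<le> M" for n using HD(7) M[of n] ab by auto
    have "\<bar>H1 n t\<bar> \<le> 53 * (2 * M + 1) + M" if "t \<in> {a..b}" for n t
      using 1[OF that, of n] 2[of n] by linarith
    then show ?thesis by blast
  qed
  then obtain B where B: "\<And>n t. t \<in> {a..b} \<Longrightarrow> \<bar>H1 n t\<bar> \<le> B" by blast
  obtain G1 k where G1: "continuous_on {a..b} G1" and k: "strict_mono (k :: nat \<Rightarrow> nat)"
    and unif: "\<And>e. 0 < e \<Longrightarrow> \<exists>N. \<forall>n x. n \<ge> N \<and> x \<in> {a..b} \<longrightarrow> norm (H1 (k n) x - G1 x) < e"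
  proof (rule Arzela_Ascoli[of "{a..b}" H1 B])
    fix x e :: real assume x: "x \<in> {a..b}" and e: "0 < e"
    obtain \<eta> where \<eta>: "0 < \<eta>"
      "\<And>n s t. s \<in> {a..b} \<Longrightarrow> t \<in> {a..b} \<Longrightarrow> \<bar>s - t\<bar> \<le> \<eta> \<Longrightarrow> \<bar>H1 n s - H1 n t\<bar> \<le> 53 * (e / 106)"
      using equi[of "e / 106"] e by (metis divide_pos_pos zero_less_numeral)
    show "\<exists>d>0. \<forall>n y. y \<in> {a..b} \<and> norm (x - y) < d \<longrightarrow> norm (H1 n x - H1 n y) < e"
    proof (intro exI[of _ \<eta>] conjI allI impI \<eta>(1))
      fix n y assume "y \<in> {a..b} \<and> norm (x - y) < \<eta>"
      then show "norm (H1 n x - H1 n y) < e" using \<eta>(2)[of x y n] x e by simp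
    qed
  qed (use B in auto)
  have lim1: "uniform_limit {a..b} (\<lambda>n. H1 (k n)) G1 sequentially"
    unfolding uniform_limit_sequentially_iff dist_norm using unif by blast
  define G where "G = (\<lambda>t. primitive a X a + primitive a G1 t)"
  define Y where "Y = primitive a X"
  have limk: "uniform_limit {a..b} (\<lambda>n. Xs (k n)) X sequentially"
    using filterlim_compose[OF lim filterlim_subseq[OF k]] .
  have limY: "uniform_limit {a..b} (\<lambda>n. primitive a (Xs (k n))) Y sequentially"
    unfolding Y_def by (intro uniform_limit_primitive Xs X limk)
  have H_eq: "H n t = primitive a (H1 n) t" if "t \<in> {a..b}" for n t
    using primitive_eq[of a b "H n" "H1 n" t] HD(1,6) that by auto
  have "uniform_limit {a..b} (\<lambda>n. primitive a (H1 (k n))) (primitive a G1) sequentially"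
    by (intro uniform_limit_primitive HD(2) G1 lim1)
  then have limH: "uniform_limit {a..b} (\<lambda>n. H (k n)) G sequentially"
    by (subst uniform_limit_cong'[where g = "\<lambda>n. primitive a (H1 (k n))" and i = "primitive a G1"])
      (simp_all add: H_eq G_def)
  have pH: "(\<lambda>n. H (k n) t) \<longlonglongrightarrow> G t" and pH1: "(\<lambda>n. H1 (k n) t) \<longlonglongrightarrow> G1 t"
    and pX: "(\<lambda>n. Xs (k n) t) \<longlonglongrightarrow> X t"
    and pY: "(\<lambda>n. primitive a (Xs (k n)) t) \<longlonglongrightarrow> Y t" if "t \<in> {a..b}" for t
    using tendsto_uniform_limitI[OF limH that] tendsto_uniform_limitI[OF lim1 that]
      tendsto_uniform_limitI[OF limk that] tendsto_uniform_limitI[OF limY that] by auto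
  have "\<exists>g. convex_on {a<..<b} g \<and> (\<forall>t\<in>{a<..<b}. (G1 has_real_derivative g t) (at t)) \<and>
             (\<forall>t\<in>{a<..<b}. (\<lambda>n. H2 (k n) t) \<longlonglongrightarrow> g t)"
    by (rule convex_derivative_limit[where F = "\<lambda>n. H1 (k n)" and M = B]) (use HD(4,5) B pH1 in auto)
  then obtain G2 where G2: "convex_on {a<..<b} G2"
    "\<And>t. t \<in> {a<..<b} \<Longrightarrow> (G1 has_real_derivative G2 t) (at t)"
    "\<And>t. t \<in> {a<..<b} \<Longrightarrow> (\<lambda>n. H2 (k n) t) \<longlonglongrightarrow> G2 t" by blast
  have contG: "continuous_on {a..b} G"
    unfolding G_def by (intro continuous_intros indefinite_integral_continuous_1 integrable_continuous_real G1)
  have contY: "continuous_on {a..b} Y"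
    unfolding Y_def by (intro indefinite_integral_continuous_1 integrable_continuous_real X)
  have "contact_invelope a b X Y G G1 G2"
    unfolding contact_invelope_def
  proof (intro conjI ballI impI)
    fix t assume t: "t \<in> {a..b}"
    show "(G has_real_derivative G1 t) (at t within {a..b})"
      unfolding G_def using Yder[OF G1] t by (auto intro!: derivative_eq_intros)
    show "Y t \<le> G t"
      using pY[OF t] pH[OF t] by (rule LIMSEQ_le) (use HD(3) t in auto)
  next
    have "a \<in> {a..b}" "b \<in> {a..b}" using ab by auto
    note ends = pH[OF this(1)] pH[OF this(2)] pH1[OF this(1)] pH1[OF this(2)]
      pX[OF this(1)] pX[OF this(2)] pY[OF this(1)] pY[OF this(2)]
    show "G a = Y a" using ends(1,7) unfolding HD(6) by (rule LIMSEQ_unique)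
    show "G1 a = X a" using ends(3,5) unfolding HD(7) by (rule LIMSEQ_unique)
    show "G b = Y b" using ends(2,8) unfolding HD(8) by (rule LIMSEQ_unique)
    show "G1 b = X b" using ends(4,6) unfolding HD(9) by (rule LIMSEQ_unique)
  next
    fix t assume t: "t \<in> {a<..<b}" "Y t < G t"
    have "continuous (at t) (\<lambda>t. G t - Y t)"
      using continuous_on_interior[OF continuous_on_diff[OF contG contY], of t] t by simp
    then have "\<forall>\<^sub>F s in at t. (G t - Y t) / 2 < G s - Y s"
      using t by (intro order_tendstoD(1)[of _ "G t - Y t"]) (auto simp: isCont_def)
    moreover have "\<forall>\<^sub>F s in at t. s \<in> {a<..<b}"
      using t by (intro eventually_at_in_open') auto
    ultimately have "\<forall>\<^sub>F s in at t. (G t - Y t) / 2 < G s - Y s \<and> s \<in> {a<..<b}"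
      by (rule eventually_conj)
    then obtain e where e: "0 < e"
      "\<forall>s. s \<noteq> t \<and> dist s t < e \<longrightarrow> (G t - Y t) / 2 < G s - Y s \<and> s \<in> {a<..<b}"
      by (auto simp: eventually_at)
    have near: "(G t - Y t) / 2 < G s - Y s \<and> s \<in> {a<..<b}" if "\<bar>s - t\<bar> < e" for s
      using e(2) t that by (cases "s = t") (auto simp: dist_real_def)
    define m where "m = (G t - Y t) / 2"
    have m: "0 < m" using t by (simp add: m_def)
    \<comment> \<open>Smaller than the interval of length \<open>e\<close> used below, so that closed intervals with affine
        second derivative fit inside.\<close>
    define c d where "c = t - e / 3" and "d = t + e / 3"
    have cd: "a < c" "c < t" "t < d" "d < b" "c < d"
      using near[of c] near[of d] e(1) by (auto simp: c_def d_def)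
    have "\<forall>\<^sub>F n in sequentially. affine_fun_on {c..d} (H2 (k n))"
    proof -
      have "\<forall>\<^sub>F n in sequentially. \<forall>s\<in>{a..b}. dist (H (k n) s) (G s) < m / 2"
        by (rule uniform_limitD[OF limH half_gt_zero[OF m]])
      moreover have "\<forall>\<^sub>F n in sequentially. \<forall>s\<in>{a..b}. dist (primitive a (Xs (k n)) s) (Y s) < m / 2"
        by (rule uniform_limitD[OF limY half_gt_zero[OF m]])
      ultimately show ?thesis
      proof eventually_elim
        case (elim n)
        have "affine_fun_on {t - e / 2<..<t + e / 2} (H2 (k n))"
        proof (rule contact_invelope_affine_between[OF inv])
          show "a \<le> t - e / 2" "t + e / 2 \<le> b"
            using near[of "t - e / 2"] near[of "t + e / 2"] e(1) by auto
          show "\<forall>s\<in>{t - e / 2<..<t + e / 2}. primitive a (Xs (k n)) s < H (k n) s"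
          proof
            fix s assume "s \<in> {t - e / 2<..<t + e / 2}"
            then have "t - e / 2 < s" "s < t + e / 2" by simp_all
            then have "\<bar>s - t\<bar> < e" using e(1) by linarith
            then have "m < G s - Y s" and s: "s \<in> {a..b}" using near[of s] by (simp_all add: m_def)
            moreover have "\<bar>H (k n) s - G s\<bar> < m / 2" "\<bar>primitive a (Xs (k n)) s - Y s\<bar> < m / 2"
              using elim s by (auto simp: dist_real_def)
            ultimately show "primitive a (Xs (k n)) s < H (k n) s"
              by linarith
          qed
        qed
        moreover have "{c..d} \<subseteq> {t - e / 2<..<t + e / 2}" using e(1) by (auto simp: c_def d_def)
        ultimately show ?case unfolding affine_fun_on_def by blast
      qed
    qed
    then have "affine_fun_on {c..d} G2"
      by (rule affine_fun_on_limit[OF cd(5)]) (use G2(3) cd in auto)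
    then show "\<exists>c d. a < c \<and> c < t \<and> t < d \<and> d < b \<and> affine_fun_on {c..d} G2"
      using cd by blast
  qed (use G1 G2 in auto)
  then show ?thesis using k pH unfolding Y_def by blast
qed

section \<open>Convex least squares\<close>

abbreviation interval_lborel :: "real \<Rightarrow> real \<Rightarrow> real measure" where
  "interval_lborel a b \<equiv> restrict_space lborel {a<..<b}"

lemma measurable_interval_lborel:
  fixes f :: "real \<Rightarrow> real"
  assumes "continuous_on {a<..<b} f"
  shows "f \<in> borel_measurable (interval_lborel a b)"
proof -
  have "sets (restrict_space lborel {a<..<b}) = sets (restrict_space borel {a<..<b})"
    by (rule sets_restrict_space_cong) simp
  then show ?thesis
    using borel_measurable_continuous_on_restrict[OF assms] measurable_cong_sets by blast
qed

lemma integral_interval_lborel: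
  fixes f :: "real \<Rightarrow> real"
  assumes "integrable (interval_lborel a b) f"
  shows "(f has_integral (\<integral>t. f t \<partial>interval_lborel a b)) {a..b}"
proof -
  have "set_integrable lborel {a<..<b} f"
    using assms by (simp add: set_integrable_def integrable_restrict_space)
  from set_borel_integral_eq_integral[OF this]
  have "(f has_integral (LINT t:{a<..<b}|lborel. f t)) {a<..<b}"
    by (simp add: has_integral_iff)
  moreover have "(LINT t:{a<..<b}|lborel. f t) = (\<integral>t. f t \<partial>interval_lborel a b)"
    by (simp add: set_lebesgue_integral_def integral_restrict_space)
  ultimately show ?thesis by (simp add: has_integral_Icc_iff_Ioo)
qed

lemma integral_interval_lborel_FTC:
  fixes f F :: "real \<Rightarrow> real"
  assumes "a \<le> b" "finite S" "integrable (interval_lborel a b) f" "continuous_on {a..b} F"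
    and "\<And>t. t \<in> {a<..<b} - S \<Longrightarrow> (F has_real_derivative f t) (at t)"
  shows "(\<integral>t. f t \<partial>interval_lborel a b) = F b - F a"
proof -
  have "(f has_integral F b - F a) {a..b}"
    using assms by (intro fundamental_theorem_of_calculus_interior_strong[OF assms(2,1)])
      (auto simp: has_real_derivative_iff_has_vector_derivative)
  then show ?thesis using integral_interval_lborel[OF assms(3)] has_integral_unique by blast
qed

lemma integrable_continuous_interval_lborel:
  fixes f :: "real \<Rightarrow> real"
  assumes "continuous_on {a..b} f"
  shows "integrable (interval_lborel a b) f"
proof -
  have "set_integrable lborel {a..b} f"
    unfolding set_integrable_def using assms by (intro borel_integrable_compact) auto
  then have "set_integrable lborel {a<..<b} f"
    by (rule set_integrable_subset) auto
  then show ?thesis by (simp add: set_integrable_def integrable_restrict_space)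
qed

lemma integrable_mult_squares:
  fixes f g :: "'a \<Rightarrow> real"
  assumes "f \<in> borel_measurable M" "g \<in> borel_measurable M"
    and "integrable M (\<lambda>x. (f x)\<^sup>2)" "integrable M (\<lambda>x. (g x)\<^sup>2)"
  shows "integrable M (\<lambda>x. f x * g x)"
proof (rule Bochner_Integration.integrable_bound)
  show "integrable M (\<lambda>x. (f x)\<^sup>2 + (g x)\<^sup>2)" using assms by simp
  have "\<bar>f x * g x\<bar> \<le> (f x)\<^sup>2 + (g x)\<^sup>2" for x
  proof -
    have "0 \<le> (\<bar>f x\<bar> - \<bar>g x\<bar>)\<^sup>2" by simp
    then have "2 * (\<bar>f x\<bar> * \<bar>g x\<bar>) \<le> (f x)\<^sup>2 + (g x)\<^sup>2" by (simp add: power2_diff)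
    moreover have "0 \<le> \<bar>f x\<bar> * \<bar>g x\<bar>" by simp
    ultimately show ?thesis unfolding abs_mult by linarith
  qed
  then show "AE x in M. norm (f x * g x) \<le> norm ((f x)\<^sup>2 + (g x)\<^sup>2)" by auto
qed (use assms in auto)

lemma primitive_interior_derivative:
  fixes f :: "real \<Rightarrow> real"
  assumes "f integrable_on {a..b}" "t \<in> {a<..<b}" "isCont f t"
  shows "(primitive a f has_real_derivative f t) (at t)"
proof -
  have "(primitive a f has_vector_derivative f t) (at t within {a..b} - {})"
    using assms by (intro integral_has_vector_derivative_continuous_at)
      (auto intro: continuous_at_imp_continuous_within)
  then show ?thesis
    using assms(2) by (simp add: has_real_derivative_iff_has_vector_derivative at_within_Icc_at)
qed

text \<open>
  By \<open>2 \<bar>y\<bar> \<le> \<eta> y\<^sup>2 + 1 / \<eta>\<close>, a substitute for the Cauchy-Schwarz inequality: a bound on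
  the \<open>L\<^sup>2\<close> norm makes antiderivatives equicontinuous when \<open>\<eta>\<close> is chosen small before \<open>\<bar>s - t\<bar>\<close>.
\<close>
lemma primitive_increment_bound:
  fixes f :: "real \<Rightarrow> real"
  assumes f: "f integrable_on {a..b}" "(\<lambda>t. (f t)\<^sup>2) integrable_on {a..b}"
    and C: "integral {a..b} (\<lambda>t. (f t)\<^sup>2) \<le> C"
    and st: "s \<in> {a..b}" "t \<in> {a..b}" and \<eta>: "0 < \<eta>"
  shows "\<bar>primitive a f s - primitive a f t\<bar> \<le> \<eta> * C + \<bar>s - t\<bar> / \<eta>"
proof -
  have main: "\<bar>primitive a f t - primitive a f s\<bar> \<le> \<eta> * C + (t - s) / \<eta>"
    if st: "s \<in> {a..b}" "t \<in> {a..b}" "s \<le> t" for s t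
  proof -
    have sub: "{s..t} \<subseteq> {a..b}" "{a..t} \<subseteq> {a..b}" using st by auto
    note int = integrable_subinterval_real[OF f(1) sub(1)] integrable_subinterval_real[OF f(2) sub(1)]
    have "primitive a f t - primitive a f s = integral {s..t} f"
      using Henstock_Kurzweil_Integration.integral_combine[where a = a and c = s and b = t and f = f] st integrable_subinterval_real[OF f(1) sub(2)] by simp
    also have "norm \<dots> \<le> integral {s..t} (\<lambda>u. \<eta> * (f u)\<^sup>2 + 1 / \<eta>)"
    proof (rule integral_norm_bound_integral[OF int(1)])
      show "(\<lambda>u. \<eta> * (f u)\<^sup>2 + 1 / \<eta>) integrable_on {s..t}"
        by (intro integrable_add integrable_on_mult_right int integrable_const_ivl)
      fix u
      have "0 \<le> (\<eta> * \<bar>f u\<bar> - 1)\<^sup>2 / \<eta>" using \<eta> by simp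
      also have "\<dots> = \<eta> * (f u)\<^sup>2 + 1 / \<eta> - 2 * \<bar>f u\<bar>"
        using \<eta> by (simp add: power2_eq_square field_simps)
      finally show "norm (f u) \<le> \<eta> * (f u)\<^sup>2 + 1 / \<eta>" by simp
    qed
    also have "\<dots> = \<eta> * integral {s..t} (\<lambda>u. (f u)\<^sup>2) + (t - s) / \<eta>"
      using st int by (subst integral_add) (auto intro!: integrable_on_mult_right)
    also have "integral {s..t} (\<lambda>u. (f u)\<^sup>2) \<le> integral {a..b} (\<lambda>u. (f u)\<^sup>2)"
      by (intro integral_subset_le sub int f) auto
    then have "\<eta> * integral {s..t} (\<lambda>u. (f u)\<^sup>2) + (t - s) / \<eta> \<le> \<eta> * C + (t - s) / \<eta>"
      using C \<eta> by (intro add_right_mono mult_left_mono) auto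
    finally show ?thesis by simp
  qed
  show ?thesis
  proof (cases "s \<le> t")
    case True
    then show ?thesis using main[OF st True] by (simp add: abs_minus_commute)
  next
    case False
    then show ?thesis using main[OF st(2,1)] by simp
  qed
qed

lemma convex_integrable_of_square:
  fixes f x :: "real \<Rightarrow> real"
  assumes x: "continuous_on {a..b} x" and f: "convex_on {a<..<b} f"
    and sq: "integrable (interval_lborel a b) (\<lambda>t. (f t - x t)\<^sup>2)"
  shows "integrable (interval_lborel a b) (\<lambda>t. (f t)\<^sup>2)" "integrable (interval_lborel a b) f"
    "(\<integral>t. (f t)\<^sup>2 \<partial>interval_lborel a b)
       \<le> 2 * (\<integral>t. (f t - x t)\<^sup>2 \<partial>interval_lborel a b) + 2 * (\<integral>t. (x t)\<^sup>2 \<partial>interval_lborel a b)"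
proof -
  let ?M = "interval_lborel a b"
  have fm: "f \<in> borel_measurable ?M"
    using convex_on_open_interval_continuous[OF f]
    by (intro measurable_interval_lborel) (simp add: continuous_on_eq_continuous_at)
  have x2: "integrable ?M (\<lambda>t. (x t)\<^sup>2)"
    by (intro integrable_continuous_interval_lborel continuous_intros x)
  have le: "(f t)\<^sup>2 \<le> 2 * (f t - x t)\<^sup>2 + 2 * (x t)\<^sup>2" for t
  proof -
    have "2 * (f t - x t)\<^sup>2 + 2 * (x t)\<^sup>2 - (f t)\<^sup>2 = (f t - 2 * x t)\<^sup>2"
      by (simp add: power2_eq_square algebra_simps)
    then show ?thesis using zero_le_power2[of "f t - 2 * x t"] by linarith
  qed
  show f2: "integrable ?M (\<lambda>t. (f t)\<^sup>2)"
  proof (rule Bochner_Integration.integrable_bound)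
    show "integrable ?M (\<lambda>t. 2 * (f t - x t)\<^sup>2 + 2 * (x t)\<^sup>2)" using sq x2 by simp
    show "AE t in ?M. norm ((f t)\<^sup>2) \<le> norm (2 * (f t - x t)\<^sup>2 + 2 * (x t)\<^sup>2)" using le by auto
  qed (use fm in simp)
  have "integrable ?M (\<lambda>t. f t * 1)"
    by (intro integrable_mult_squares fm f2 integrable_continuous_interval_lborel) auto
  then show "integrable ?M f" by simp
  have "(\<integral>t. (f t)\<^sup>2 \<partial>?M) \<le> (\<integral>t. 2 * (f t - x t)\<^sup>2 + 2 * (x t)\<^sup>2 \<partial>?M)"
    using f2 sq x2 le by (intro integral_mono) auto
  then show "(\<integral>t. (f t)\<^sup>2 \<partial>?M) \<le> 2 * (\<integral>t. (f t - x t)\<^sup>2 \<partial>?M) + 2 * (\<integral>t. (x t)\<^sup>2 \<partial>?M)"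
    using sq x2 by simp
qed

text \<open>
  The antiderivatives of a minimizing sequence are equicontinuous, so a subsequence of them converges
  uniformly. Since the functions are convex, they converge pointwise themselves, to a
  convex function, and Fatou's lemma shows that this function attains the infimum.
\<close>
theorem convex_least_squares_exists:
  fixes x :: "real \<Rightarrow> real"
  assumes ab: "a < b" and x: "continuous_on {a..b} x"
  shows "\<exists>g G. convex_on {a<..<b} g \<and> continuous_on {a..b} G \<and>
     (\<forall>t\<in>{a<..<b}. (G has_real_derivative g t) (at t)) \<and>
     integrable (interval_lborel a b) (\<lambda>t. (g t - x t)\<^sup>2) \<and>
     (\<forall>f. convex_on {a<..<b} f \<longrightarrow> integrable (interval_lborel a b) (\<lambda>t. (f t - x t)\<^sup>2) \<longrightarrow>
        (\<integral>t. (g t - x t)\<^sup>2 \<partial>interval_lborel a b) \<le> (\<integral>t. (f t - x t)\<^sup>2 \<partial>interval_lborel a b))"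
proof -
  let ?M = "interval_lborel a b"
  define K where "K = {f. convex_on {a<..<b} f \<and> integrable ?M (\<lambda>t. (f t - x t)\<^sup>2)}"
  define J where "J f = (\<integral>t. (f t - x t)\<^sup>2 \<partial>?M)" for f
  define m where "m = Inf (J ` K)"
  have xm: "x \<in> borel_measurable ?M"
    by (intro measurable_interval_lborel continuous_on_subset[OF x]) auto
  have meas: "f \<in> borel_measurable ?M" if "convex_on {a<..<b} f" for f
    using convex_on_open_interval_continuous[OF that]
    by (intro measurable_interval_lborel) (simp add: continuous_on_eq_continuous_at)
  have "(\<lambda>t. 0) \<in> K"
    unfolding K_def by (auto intro!: integrable_continuous_interval_lborel continuous_intros x simp: convex_on_const)
  then have ne: "J ` K \<noteq> {}" by blast
  have J0: "0 \<le> J f" for f by (simp add: J_def)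
  then have bdd: "bdd_below (J ` K)" by (intro bdd_belowI[of _ 0]) auto
  have "\<exists>f\<in>K. J f < m + 1 / Suc n" for n
  proof -
    have "Inf (J ` K) < m + 1 / Suc n" by (simp add: m_def)
    from cInf_lessD[OF ne this] show ?thesis by blast
  qed
  then have "\<forall>n. \<exists>f. f \<in> K \<and> J f < m + 1 / Suc n" by blast
  from choice[OF this] obtain f where f: "\<And>n. f n \<in> K" "\<And>n. J (f n) < m + 1 / Suc n" by blast
  have cvx: "convex_on {a<..<b} (f n)" and sq: "integrable ?M (\<lambda>t. (f n t - x t)\<^sup>2)" for n
    using f(1)[of n] by (auto simp: K_def)
  note int = convex_integrable_of_square[OF x cvx sq]
  define C where "C = 2 * (m + 1) + 2 * (\<integral>t. (x t)\<^sup>2 \<partial>?M)"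
  have hk: "f n integrable_on {a..b}" "(\<lambda>t. (f n t)\<^sup>2) integrable_on {a..b}"
    "integral {a..b} (\<lambda>t. (f n t)\<^sup>2) \<le> C" for n
  proof -
    show "f n integrable_on {a..b}" "(\<lambda>t. (f n t)\<^sup>2) integrable_on {a..b}"
      using integral_interval_lborel[OF int(1)] integral_interval_lborel[OF int(2)] by blast+
    have "J (f n) \<le> m + 1" 
    proof -
      have "1 / real (Suc n) \<le> 1" by simp
      then show ?thesis using f(2)[of n] by linarith
    qed
    then have "(\<integral>t. (f n t)\<^sup>2 \<partial>?M) \<le> C" using int(3)[of n] by (simp add: C_def J_def)
    then show "integral {a..b} (\<lambda>t. (f n t)\<^sup>2) \<le> C"
      using integral_unique[OF integral_interval_lborel[OF int(1)]] by simp
  qed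
  define F where "F n = primitive a (f n)" for n
  have inc: "\<bar>F n s - F n t\<bar> \<le> \<eta> * C + \<bar>s - t\<bar> / \<eta>"
    if "s \<in> {a..b}" "t \<in> {a..b}" "0 < \<eta>" for n s t \<eta>
    unfolding F_def by (rule primitive_increment_bound[OF hk that])
  have C0: "0 \<le> C"
    using integral_nonneg[OF hk(2)[of 0]] hk(3)[of 0] by auto
  have Fb: "\<bar>F n t\<bar> \<le> C + (b - a)" if "t \<in> {a..b}" for n t
    using inc[of t a 1 n] that ab by (auto simp: F_def)
  obtain G k where G: "continuous_on {a..b} G" and k: "strict_mono (k :: nat \<Rightarrow> nat)"
    and unif: "\<And>e. 0 < e \<Longrightarrow> \<exists>N. \<forall>n x. n \<ge> N \<and> x \<in> {a..b} \<longrightarrow> norm (F (k n) x - G x) < e"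
  proof (rule Arzela_Ascoli[of "{a..b}" F "C + (b - a)"])
    fix s e :: real assume s: "s \<in> {a..b}" and e: "0 < e"
    \<comment> \<open>Chosen such that \<open>\<eta> C < e / 2\<close>.\<close>
    define \<eta> where "\<eta> = e / (2 * (C + 1))"
    have \<eta>: "0 < \<eta>" using e C0 by (simp add: \<eta>_def)
    have "\<eta> * (2 * (C + 1)) = e" using C0 by (simp add: \<eta>_def)
    then have "2 * (\<eta> * C) < e" using \<eta> by (simp add: algebra_simps)
    show "\<exists>d>0. \<forall>n y. y \<in> {a..b} \<and> norm (s - y) < d \<longrightarrow> norm (F n s - F n y) < e"
    proof (intro exI[of _ "\<eta> * (e / 2)"] conjI allI impI)
      fix n y assume y: "y \<in> {a..b} \<and> norm (s - y) < \<eta> * (e / 2)"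
      then have "\<bar>s - y\<bar> / \<eta> < e / 2" using \<eta> by (simp add: field_simps)
      then show "norm (F n s - F n y) < e"
        using inc[OF s conjunct1[OF y] \<eta>, of n] \<open>2 * (\<eta> * C) < e\<close>
        unfolding real_norm_def by linarith
    qed (use \<eta> e in simp)
  qed (use Fb in auto)
  have lim: "(\<lambda>n. F (k n) t) \<longlonglongrightarrow> G t" if "t \<in> {a..b}" for t
    using unif that by (intro LIMSEQ_I) blast
  have "\<exists>g. convex_on {a<..<b} g \<and> (\<forall>t\<in>{a<..<b}. (G has_real_derivative g t) (at t)) \<and>
             (\<forall>t\<in>{a<..<b}. (\<lambda>n. f (k n) t) \<longlonglongrightarrow> g t)"
  proof (rule convex_derivative_limit[where F = "\<lambda>n. F (k n)" and M = "C + (b - a)"])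
    show "\<forall>t\<in>{a<..<b}. (F (k n) has_real_derivative f (k n) t) (at t)" for n
      unfolding F_def
      using primitive_interior_derivative[OF hk(1)] convex_on_open_interval_continuous[OF cvx] by blast
  qed (use cvx Fb lim in auto)
  then obtain g where g: "convex_on {a<..<b} g"
    "\<And>t. t \<in> {a<..<b} \<Longrightarrow> (G has_real_derivative g t) (at t)"
    "\<And>t. t \<in> {a<..<b} \<Longrightarrow> (\<lambda>n. f (k n) t) \<longlonglongrightarrow> g t" by blast
  have "(\<integral>\<^sup>+t. ennreal ((g t - x t)\<^sup>2) \<partial>?M)
      = (\<integral>\<^sup>+t. liminf (\<lambda>n. ennreal ((f (k n) t - x t)\<^sup>2)) \<partial>?M)"
  proof (rule nn_integral_cong)
    fix t assume "t \<in> space ?M"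
    then have t: "t \<in> {a<..<b}" by (simp add: space_restrict_space)
    have "(\<lambda>n. ennreal ((f (k n) t - x t)\<^sup>2)) \<longlonglongrightarrow> ennreal ((g t - x t)\<^sup>2)"
      by (intro tendsto_intros g(3) t)
    then show "ennreal ((g t - x t)\<^sup>2) = liminf (\<lambda>n. ennreal ((f (k n) t - x t)\<^sup>2))"
      by (intro lim_imp_Liminf[symmetric]) auto
  qed
  also have "\<dots> \<le> liminf (\<lambda>n. \<integral>\<^sup>+t. ennreal ((f (k n) t - x t)\<^sup>2) \<partial>?M)"
    using meas[OF cvx] xm by (intro nn_integral_liminf) auto
  also have "\<dots> = liminf (\<lambda>n. ennreal (J (f (k n))))"
    unfolding J_def using sq by (subst nn_integral_eq_integral) auto
  also have "\<dots> \<le> liminf (\<lambda>n. ennreal (m + 1 / Suc (k n)))"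
    using f(2) by (intro Liminf_mono always_eventually allI ennreal_leI less_imp_le)
  also have "\<dots> = ennreal m"
  proof (rule lim_imp_Liminf)
    have "(\<lambda>n. m + 1 / Suc n) \<longlonglongrightarrow> m + 0" by (intro tendsto_intros LIMSEQ_Suc lim_1_over_n)
    then have "(\<lambda>n. m + 1 / Suc (k n)) \<longlonglongrightarrow> m"
      using LIMSEQ_subseq_LIMSEQ[OF _ k, of "\<lambda>n. m + 1 / Suc n" m] by (simp add: o_def)
    then show "(\<lambda>n. ennreal (m + 1 / Suc (k n))) \<longlonglongrightarrow> ennreal m" by (intro tendsto_intros)
  qed simp
  finally have le: "(\<integral>\<^sup>+t. ennreal ((g t - x t)\<^sup>2) \<partial>?M) \<le> ennreal m" .
  have int_g: "integrable ?M (\<lambda>t. (g t - x t)\<^sup>2)"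
  proof (rule integrableI_nonneg)
    show "(\<integral>\<^sup>+t. ennreal ((g t - x t)\<^sup>2) \<partial>?M) < \<infinity>" 
      using le_less_trans[OF le ennreal_less_top] by simp
  qed (use meas[OF g(1)] xm in auto)
  have m0: "0 \<le> m" unfolding m_def using ne J0 by (intro cInf_greatest) auto
  have "ennreal (J g) \<le> ennreal m"
    using le nn_integral_eq_integral[OF int_g] by (simp add: J_def)
  then have "J g \<le> m" using m0 by (simp add: ennreal_le_iff)
  moreover have "m \<le> J f" if "f \<in> K" for f
    unfolding m_def using bdd that by (intro cInf_lower) auto
  ultimately have "J g \<le> J f" if "f \<in> K" for f using that by fastforce
  then have "\<forall>f. convex_on {a<..<b} f \<longrightarrow> integrable ?M (\<lambda>t. (f t - x t)\<^sup>2) \<longrightarrow> J g \<le> J f"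
    by (simp add: K_def)
  then show ?thesis unfolding J_def using g(1,2) G int_g by blast
qed

text \<open>
  The first order condition at a minimum over a convex cone. The expansion of the square leaves
  \<open>0 \<le> 2 \<integral> (g - x) h + e \<integral> h\<^sup>2\<close> for small positive \<open>e\<close>.
\<close>
lemma least_squares_variation:
  fixes g h x :: "real \<Rightarrow> real"
  assumes x: "continuous_on {a..b} x" and g: "convex_on {a<..<b} g"
    and sq: "integrable (interval_lborel a b) (\<lambda>t. (g t - x t)\<^sup>2)"
    and opt: "\<forall>f. convex_on {a<..<b} f \<longrightarrow> integrable (interval_lborel a b) (\<lambda>t. (f t - x t)\<^sup>2) \<longrightarrow>
        (\<integral>t. (g t - x t)\<^sup>2 \<partial>interval_lborel a b) \<le> (\<integral>t. (f t - x t)\<^sup>2 \<partial>interval_lborel a b)"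
    and h: "continuous_on {a..b} h"
    and dir: "\<And>e. 0 < e \<Longrightarrow> e \<le> 1 \<Longrightarrow> convex_on {a<..<b} (\<lambda>t. g t + e * h t)"
  shows "integrable (interval_lborel a b) (\<lambda>t. (g t - x t) * h t)"
    and "0 \<le> (\<integral>t. (g t - x t) * h t \<partial>interval_lborel a b)"
proof -
  let ?M = "interval_lborel a b"
  have hm: "h \<in> borel_measurable ?M" and xm: "x \<in> borel_measurable ?M"
    by (intro measurable_interval_lborel continuous_on_subset[OF h] continuous_on_subset[OF x]; auto)+
  have gm: "g \<in> borel_measurable ?M"
    using convex_on_open_interval_continuous[OF g]
    by (intro measurable_interval_lborel) (simp add: continuous_on_eq_continuous_at)
  have h2: "integrable ?M (\<lambda>t. (h t)\<^sup>2)"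
    by (intro integrable_continuous_interval_lborel continuous_intros h)
  show rh: "integrable ?M (\<lambda>t. (g t - x t) * h t)"
    using gm xm hm by (intro integrable_mult_squares sq h2) auto
  define p q where "p = (\<integral>t. (g t - x t) * h t \<partial>?M)" and "q = (\<integral>t. (h t)\<^sup>2 \<partial>?M)"
  have q0: "0 \<le> q" by (simp add: q_def)
  have quad: "0 \<le> 2 * p + e * q" if e: "0 < e" "e \<le> 1" for e
  proof -
    have eq: "(g t + e * h t - x t)\<^sup>2 = (g t - x t)\<^sup>2 + (2 * e * ((g t - x t) * h t) + e\<^sup>2 * (h t)\<^sup>2)" for t
      by (simp add: power2_eq_square algebra_simps)
    have int: "integrable ?M (\<lambda>t. (g t + e * h t - x t)\<^sup>2)"
      unfolding eq by (intro Bochner_Integration.integrable_add integrable_mult_right sq rh h2)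
    have "(\<integral>t. (g t - x t)\<^sup>2 \<partial>?M) \<le> (\<integral>t. (g t + e * h t - x t)\<^sup>2 \<partial>?M)"
      using opt dir[OF e] int by blast
    also have "\<dots> = (\<integral>t. (g t - x t)\<^sup>2 \<partial>?M) + (2 * e * p + e\<^sup>2 * q)"
      unfolding eq p_def q_def using sq rh h2 by simp
    finally have "0 \<le> e * (2 * p + e * q)" by (simp add: algebra_simps power2_eq_square)
    then show ?thesis using e by (simp add: zero_le_mult_iff)
  qed
  show "0 \<le> (\<integral>t. (g t - x t) * h t \<partial>?M)"
  proof (rule ccontr)
    assume "\<not> ?thesis"
    then have p: "p < 0" by (simp add: p_def)
    \<comment> \<open>For a negative first order term \<open>p\<close> this step would decrease the distance.\<close>
    define e where "e = min 1 (- p / (q + 1))"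
    have "0 < - p / (q + 1)" using p q0 by (intro divide_pos_pos) auto
    then have e: "0 < e" "e \<le> 1" "e \<le> - p / (q + 1)" unfolding e_def by auto
    then have "e * (q + 1) \<le> - p" using q0 by (simp add: field_simps)
    then have "2 * p + e * q < 0" using p e by (simp add: algebra_simps)
    then show False using quad[OF e(1,2)] by simp
  qed
qed

section \<open>Existence for continuously differentiable paths\<close>

lemma convex_hinge: "convex_on S (\<lambda>t. max 0 (t - s) :: real)" if "convex S"
proof (rule convex_onI[OF _ that])
  fix u x y :: real assume u: "0 < u" "u < 1"
  have "(1 - u) * (x - s) \<le> (1 - u) * max 0 (x - s)" "u * (y - s) \<le> u * max 0 (y - s)"
    "0 \<le> (1 - u) * max 0 (x - s)" "0 \<le> u * max 0 (y - s)"
    using u by (auto intro: mult_left_mono)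
  moreover have "(1 - u) *\<^sub>R x + u *\<^sub>R y - s = (1 - u) * (x - s) + u * (y - s)"
    by (simp add: algebra_simps)
  ultimately show "max 0 ((1 - u) *\<^sub>R x + u *\<^sub>R y - s) \<le> (1 - u) * max 0 (x - s) + u * max 0 (y - s)"
    by (intro max.boundedI) linarith+
qed

lemma has_right_derivative_transform:
  fixes f h :: "real \<Rightarrow> real"
  assumes "(f has_real_derivative l) (at_right t)" "t < u"
    and "\<And>s. t \<le> s \<Longrightarrow> s < u \<Longrightarrow> f s = h s"
  shows "(h has_real_derivative l) (at_right t)"
proof -
  have eq: "\<forall>\<^sub>F s in at_right t. (f s - f t) / (s - t) = (h s - h t) / (s - t)"
    unfolding eventually_at_right_field using assms(2,3) by (intro exI[of _ u]) auto
  show ?thesis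
    using assms(1) unfolding has_field_derivative_iff by (rule Lim_transform_eventually[OF _ eq])
qed

text \<open>
  The function \<open>\<phi>\<close> equals \<open>g\<close> on \<open>[c, d]\<close> and continues along right tangents outside, so that its
  second derivative is that of \<open>g\<close> restricted to \<open>(c, d]\<close>. A fraction of it can be removed from \<open>g\<close>
  without loss of convexity, which makes both \<open>\<phi>\<close> and \<open>- \<phi>\<close> admissible directions at a minimum.
\<close>
lemma convex_localization:
  fixes g g' :: "real \<Rightarrow> real"
  assumes g: "convex_on {a<..<b} g"
    and g': "\<And>t. t \<in> {a<..<b} \<Longrightarrow> (g has_real_derivative g' t) (at_right t)"
    and cd: "a < c" "c < d" "d < b"
  obtains \<phi> where "continuous_on UNIV \<phi>" "convex_on {a<..<b} \<phi>"
    "\<And>t. t \<in> {a<..<b} \<Longrightarrow> (\<phi> has_real_derivative g' (max c (min d t))) (at_right t)"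
    "\<And>e. 0 < e \<Longrightarrow> e \<le> 1 \<Longrightarrow> convex_on {a<..<b} (\<lambda>t. g t + e * (- \<phi> t))"
proof -
  define cl where "cl t = max c (min d t)" for t
  have cl: "cl t \<in> {a<..<b}" for t using cd by (auto simp: cl_def)
  define \<phi> where "\<phi> t = g (cl t) + g' c * min (t - c) 0 + g' d * max (t - d) 0" for t
  have gcont: "continuous_on {a<..<b} g"
    using convex_on_open_interval_continuous[OF g] by (simp add: continuous_on_eq_continuous_at)
  have mono: "mono_on {a<..<b} g'" by (rule convex_right_derivative_mono[OF g g'])
  have \<phi>cont: "continuous_on S \<phi>" for S
    unfolding \<phi>_def
    by (intro continuous_intros continuous_on_compose2[OF gcont])
      (use cl in \<open>auto simp: cl_def[abs_def] intro!: continuous_intros\<close>)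
  have \<phi>': "(\<phi> has_real_derivative g' (cl t)) (at_right t)" if t: "t \<in> {a<..<b}" for t
  proof -
    consider "t < c" | "c \<le> t" "t < d" | "d \<le> t" by linarith
    then show ?thesis
    proof cases
      case 1
      then have clt: "cl t = c" using cd by (simp add: cl_def)
      show ?thesis unfolding clt
      proof (rule has_right_derivative_transform[OF _ 1])
        show "((\<lambda>s. g c + g' c * (s - c)) has_real_derivative g' c) (at_right t)"
          by (auto intro!: derivative_eq_intros)
      qed (use 1 cd in \<open>auto simp: \<phi>_def cl_def\<close>)
    next
      case 2
      then have clt: "cl t = t" using cd by (simp add: cl_def)
      show ?thesis unfolding clt
        by (rule has_right_derivative_transform[OF g'[OF t] 2(2)]) (use 2 cd in \<open>auto simp: \<phi>_def cl_def\<close>)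
    next
      case 3
      then have clt: "cl t = d" using cd by (simp add: cl_def)
      show ?thesis unfolding clt
      proof (rule has_right_derivative_transform[of _ _ _ "t + 1"])
        show "((\<lambda>s. g d + g' d * (s - d)) has_real_derivative g' d) (at_right t)"
          by (auto intro!: derivative_eq_intros)
      qed (use 3 cd in \<open>auto simp: \<phi>_def cl_def\<close>)
    qed
  qed
  show ?thesis
  proof (rule that[of \<phi>])
    show "continuous_on UNIV \<phi>" by (rule \<phi>cont)
    show "convex_on {a<..<b} \<phi>"
    proof (rule convex_on_if_right_derivative_mono[OF \<phi>cont \<phi>'])
      show "mono_on {a<..<b} (\<lambda>t. g' (cl t))"
        by (intro mono_onI mono_onD[OF mono] cl) (auto simp: cl_def)
    qed
    show "(\<phi> has_real_derivative g' (max c (min d t))) (at_right t)" if "t \<in> {a<..<b}" for t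
      using \<phi>'[OF that] by (simp add: cl_def)
    fix e :: real assume e: "0 < e" "e \<le> 1"
    show "convex_on {a<..<b} (\<lambda>t. g t + e * (- \<phi> t))"
    proof (rule convex_on_if_right_derivative_mono[where f' = "\<lambda>t. g' t + e * (- g' (cl t))"])
      show "continuous_on {a<..<b} (\<lambda>t. g t + e * (- \<phi> t))"
        by (intro continuous_intros gcont \<phi>cont)
      show "((\<lambda>t. g t + e * (- \<phi> t)) has_real_derivative g' t + e * (- g' (cl t))) (at_right t)"
        if "t \<in> {a<..<b}" for t
        by (intro DERIV_add DERIV_cmult DERIV_minus g' \<phi>' that)
      show "mono_on {a<..<b} (\<lambda>t. g' t + e * (- g' (cl t)))"
      proof (rule mono_onI)
        fix s t assume st: "s \<in> {a<..<b}" "t \<in> {a<..<b}" "s \<le> t"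
        have "0 \<le> g' (cl t) - g' (cl s)" using mono_onD[OF mono cl cl, of s t] st by (auto simp: cl_def)
        moreover have "g' (cl t) - g' (cl s) \<le> g' t - g' s"
        proof (cases "t \<le> c \<or> d \<le> s")
          case True
          then have "cl t = cl s" using st cd by (auto simp: cl_def)
          then show ?thesis using mono_onD[OF mono st] by simp
        next
          case False
          then have "g' (cl t) \<le> g' t" "g' s \<le> g' (cl s)"
            using st cd by (auto intro!: mono_onD[OF mono] simp: cl_def)
          then show ?thesis by simp
        qed
        ultimately have "e * (g' (cl t) - g' (cl s)) \<le> g' t - g' s"
          using e mult_left_le_one_le[of "g' (cl t) - g' (cl s)" e] by linarith
        then show "g' s + e * (- g' (cl s)) \<le> g' t + e * (- g' (cl t))" by (simp add: algebra_simps)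
      qed
    qed
  qed
qed

text \<open>
  Let \<open>g\<close> minimize the distance to \<open>x = X'\<close>, let \<open>r = g - x\<close>, and let \<open>D = H - Y\<close>, so that
  \<open>D'' = r\<close>. Testing optimality with \<open>\<plusminus> 1\<close> and \<open>\<plusminus> t\<close> gives the boundary conditions at \<open>b\<close>, and the
  hinge at \<open>s\<close> gives \<open>D s \<ge> 0\<close>. If \<open>D \<ge> m > 0\<close> on \<open>[c, d]\<close>, the localization \<open>\<phi>\<close> of \<open>g\<close> to
  \<open>[c, d]\<close> satisfies \<open>\<integral> r \<phi> = 0\<close>, while integration by parts bounds this integral from below by
  \<open>m\<close> times the increase of \<open>g'\<close> over \<open>[c, d]\<close>; hence \<open>g\<close> is affine there.
\<close>
theorem contact_invelope_exists_smooth: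
  fixes X x :: "real \<Rightarrow> real"
  assumes ab: "a < b" and X: "\<forall>t\<in>{a..b}. (X has_real_derivative x t) (at t within {a..b})"
    and x: "continuous_on {a..b} x"
  shows "\<exists>H H1 H2. contact_invelope a b X (primitive a X) H H1 H2"
proof -
  let ?M = "interval_lborel a b"
  obtain g G where g: "convex_on {a<..<b} g" and G: "continuous_on {a..b} G"
    and Gg: "\<forall>t\<in>{a<..<b}. (G has_real_derivative g t) (at t)"
    and sq: "integrable ?M (\<lambda>t. (g t - x t)\<^sup>2)"
    and opt: "\<forall>f. convex_on {a<..<b} f \<longrightarrow> integrable ?M (\<lambda>t. (f t - x t)\<^sup>2) \<longrightarrow>
        (\<integral>t. (g t - x t)\<^sup>2 \<partial>?M) \<le> (\<integral>t. (f t - x t)\<^sup>2 \<partial>?M)"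
    using convex_least_squares_exists[OF ab x] by blast
  define r where "r t = g t - x t" for t
  note variation = least_squares_variation[OF x g sq opt, folded r_def]
  define H1 where "H1 t = X a + (G t - G a)" for t
  define D1 where "D1 t = H1 t - X t" for t
  define H where "H = primitive a H1"
  define Y where "Y = primitive a X"
  define D where "D t = H t - Y t" for t
  have contX: "continuous_on {a..b} X" by (rule DERIV_continuous_on) (use X in blast)
  have contH1: "continuous_on {a..b} H1" unfolding H1_def by (intro continuous_intros G)
  have contD1: "continuous_on {a..b} D1" unfolding D1_def by (intro continuous_intros contH1 contX)
  have H: "(H has_real_derivative H1 t) (at t within {a..b})"
    and Y: "(Y has_real_derivative X t) (at t within {a..b})" if "t \<in> {a..b}" for t
    unfolding H_def Y_def using integral_has_real_derivative that contH1 contX by blast+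
  have D: "(D has_real_derivative D1 t) (at t within {a..b})" if "t \<in> {a..b}" for t
    unfolding D_def D1_def by (intro DERIV_diff H Y that)
  have contD: "continuous_on {a..b} D" by (rule DERIV_continuous_on) (rule D)
  have D': "(D has_real_derivative D1 t) (at t)" if "t \<in> {a<..<b}" for t
    using D[of t] that by (simp add: at_within_Icc_at)
  have H1': "(H1 has_real_derivative g t) (at t)" if "t \<in> {a<..<b}" for t
  proof -
    have "(H1 has_real_derivative 0 + (g t - 0)) (at t)"
      unfolding H1_def using Gg that by (intro DERIV_add DERIV_diff DERIV_const) auto
    then show ?thesis by simp
  qed
  have D1': "(D1 has_real_derivative r t) (at t)" if "t \<in> {a<..<b}" for t
  proof -
    have "(X has_real_derivative x t) (at t)"
      using X[rule_format, of t] that by (simp add: at_within_Icc_at)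
    then show ?thesis unfolding D1_def r_def using H1'[OF that] by (rule DERIV_diff[rotated])
  qed
  have Da: "D a = 0" "D1 a = 0" by (simp_all add: D_def H_def Y_def D1_def H1_def)
  have FTC: "(\<integral>t. r t * h t \<partial>?M) = \<Phi> b - \<Phi> a"
    if "integrable ?M (\<lambda>t. r t * h t)" "continuous_on {a..b} \<Phi>" "finite S"
      "\<And>t. t \<in> {a<..<b} - S \<Longrightarrow> (\<Phi> has_real_derivative r t * h t) (at t)" for h \<Phi> S
    using ab that by (intro integral_interval_lborel_FTC[where S = S]) auto
  have line: "convex_on {a<..<b} (\<lambda>t. g t + e * (u + v * t))" for e u v
  proof -
    have "convex_on {a<..<b} (\<lambda>t. u * e + v * e * t)"
      by (rule convex_on_realI[where f' = "\<lambda>t. v * e"]) (auto intro!: derivative_eq_intros)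
    from convex_on_add[OF g this] have "convex_on {a<..<b} (\<lambda>t. g t + (u * e + v * e * t))" .
    then show ?thesis by (simp add: algebra_simps)
  qed
  have affine_eq: "(\<integral>t. r t * (u + v * t) \<partial>?M) = 0" for u v
  proof -
    have "integrable ?M (\<lambda>t. r t * (u + v * t))" "0 \<le> (\<integral>t. r t * (u + v * t) \<partial>?M)"
      by (rule variation; intro continuous_intros line)+
    moreover have "0 \<le> (\<integral>t. r t * (- u + (- v) * t) \<partial>?M)"
      by (rule variation; intro continuous_intros line)
    moreover have "(\<integral>t. r t * (- u + (- v) * t) \<partial>?M) = - (\<integral>t. r t * (u + v * t) \<partial>?M)"
      by (subst integral_minus[symmetric]) (simp add: algebra_simps)
    ultimately show ?thesis by linarith
  qed
  have int_affine: "integrable ?M (\<lambda>t. r t * (u + v * t))" for u v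
    by (rule variation; intro continuous_intros line)
  have "(\<integral>t. r t * (1 + 0 * t) \<partial>?M) = D1 b - D1 a"
    by (rule FTC[OF int_affine contD1, of "{}"]) (use D1' in auto)
  \<comment> \<open>The test function \<open>1\<close>.\<close>
  then have D1b: "D1 b = 0" using affine_eq[of 1 0] Da by simp
  have "(\<integral>t. r t * (0 + 1 * t) \<partial>?M) = (b * D1 b - D b) - (a * D1 a - D a)"
  proof (rule FTC[OF int_affine, of "\<lambda>t. t * D1 t - D t" "{}"])
    show "continuous_on {a..b} (\<lambda>t. t * D1 t - D t)" by (intro continuous_intros contD1 contD)
    fix t assume "t \<in> {a<..<b} - {}"
    then have "((\<lambda>t. t * D1 t - D t) has_real_derivative (1 * D1 t + r t * t) - D1 t) (at t)"
      by (intro DERIV_diff DERIV_mult D1' D' DERIV_ident) auto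
    then show "((\<lambda>t. t * D1 t - D t) has_real_derivative r t * (0 + 1 * t)) (at t)" by simp
  qed simp
  \<comment> \<open>The test function \<open>t\<close>, integrated by parts.\<close>
  then have Db: "D b = 0" using affine_eq[of 0 1] Da D1b by simp
  have D_nonneg: "0 \<le> D s" if s: "s \<in> {a..b}" for s
  proof -
    have dir: "convex_on {a<..<b} (\<lambda>t. g t + e * max 0 (t - s))" if "0 < e" for e
      using that g by (intro convex_on_add convex_on_cmul convex_hinge) auto
    have conth: "continuous_on {a..b} (\<lambda>t. max 0 (t - s))" by (intro continuous_intros)
    have hinge: "integrable ?M (\<lambda>t. r t * max 0 (t - s))" "0 \<le> (\<integral>t. r t * max 0 (t - s) \<partial>?M)"
      by (rule variation[OF conth], erule dir)+
    \<comment> \<open>An antiderivative of \<open>r\<close> times the hinge, except at the kink \<open>s\<close>.\<close>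
    define \<Phi> where "\<Phi> t = max 0 (t - s) * D1 t - D (max s t)" for t
    have "(\<integral>t. r t * max 0 (t - s) \<partial>?M) = \<Phi> b - \<Phi> a"
    proof (rule FTC[OF hinge(1), of \<Phi> "{s}"])
      show "continuous_on {a..b} \<Phi>" unfolding \<Phi>_def
        using s by (intro continuous_intros contD1 continuous_on_compose2[OF contD]) auto
      fix t assume t: "t \<in> {a<..<b} - {s}"
      show "(\<Phi> has_real_derivative r t * max 0 (t - s)) (at t)"
      proof (cases "t < s")
        case True
        have "((\<lambda>t. - D s) has_real_derivative r t * max 0 (t - s)) (at t)" using True by simp
        then show ?thesis
          by (rule has_field_derivative_transform_within_open[of _ _ _ "{..<s}"])
            (use True in \<open>auto simp: \<Phi>_def\<close>)
      next
        case False
        then have "((\<lambda>t. (t - s) * D1 t - D t) has_real_derivative ((1 - 0) * D1 t + r t * (t - s)) - D1 t) (at t)"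
          using t by (intro DERIV_diff DERIV_mult D1' D' DERIV_ident DERIV_const) auto
        then have "((\<lambda>t. (t - s) * D1 t - D t) has_real_derivative r t * max 0 (t - s)) (at t)"
          using False by simp
        then show ?thesis
          by (rule has_field_derivative_transform_within_open[of _ _ _ "{s<..}"])
            (use False t in \<open>auto simp: \<Phi>_def\<close>)
      qed
    qed simp
    then show ?thesis using hinge(2) s D1b Db Da by (simp add: \<Phi>_def max_absorb1 max_absorb2)
  qed
  obtain g' where g': "\<forall>t\<in>{a<..<b}. (g has_real_derivative g' t) (at_right t)"
    using convex_has_right_derivative[OF g] by blast
  have slack: "\<exists>c d. a < c \<and> c < t \<and> t < d \<and> d < b \<and> affine_fun_on {c..d} g"
    if t: "t \<in> {a<..<b}" "Y t < H t" for t
  proof -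
    have "isCont D t" using DERIV_isCont[OF D'[OF t(1)]] .
    moreover have "0 < D t" using t by (simp add: D_def)
    ultimately have "\<forall>\<^sub>F s in at t. D t / 2 < D s"
      by (intro order_tendstoD(1)[of _ "D t"]) (auto simp: isCont_def)
    moreover have "\<forall>\<^sub>F s in at t. s \<in> {a<..<b}"
      using t by (intro eventually_at_in_open') auto
    ultimately have "\<forall>\<^sub>F s in at t. D t / 2 < D s \<and> s \<in> {a<..<b}" by (rule eventually_conj)
    then obtain e where e: "0 < e" "\<forall>s. s \<noteq> t \<and> dist s t < e \<longrightarrow> D t / 2 < D s \<and> s \<in> {a<..<b}"
      by (auto simp: eventually_at)
    have near: "D t / 2 < D s \<and> s \<in> {a<..<b}" if "\<bar>s - t\<bar> < e" for s
      using e(2) t \<open>0 < D t\<close> that by (cases "s = t") (auto simp: dist_real_def)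
    define c d m where "c = t - e / 2" and "d = t + e / 2" and "m = D t / 2"
    have cd: "a < c" "c < t" "t < d" "d < b" "c < d"
      using near[of c] near[of d] e(1) by (auto simp: c_def d_def)
    have m: "0 < m" using \<open>0 < D t\<close> by (simp add: m_def)
    have Dm: "m \<le> D s" if "c \<le> s" "s \<le> d" for s
    proof -
      have "\<bar>s - t\<bar> < e" using that e(1) unfolding c_def d_def by linarith
      then show ?thesis using near[of s] by (simp add: m_def)
    qed
    obtain \<phi> where \<phi>: "continuous_on UNIV \<phi>" "convex_on {a<..<b} \<phi>"
      "\<And>t. t \<in> {a<..<b} \<Longrightarrow> (\<phi> has_real_derivative g' (max c (min d t))) (at_right t)"
      "\<And>e. 0 < e \<Longrightarrow> e \<le> 1 \<Longrightarrow> convex_on {a<..<b} (\<lambda>t. g t + e * (- \<phi> t))"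
      using convex_localization[OF g _ cd(1,5,4), of g'] g' by blast
    have contphi: "continuous_on {a..b} \<phi>" by (rule continuous_on_subset[OF \<phi>(1)]) simp
    have dir: "convex_on {a<..<b} (\<lambda>t. g t + e * \<phi> t)" if "0 < e" for e
      using that g \<phi>(2) by (intro convex_on_add convex_on_cmul) auto
    have pos: "integrable ?M (\<lambda>t. r t * \<phi> t)" "0 \<le> (\<integral>t. r t * \<phi> t \<partial>?M)"
      by (rule variation[OF contphi], erule dir)+
    have "0 \<le> (\<integral>t. r t * (- \<phi> t) \<partial>?M)"
      by (rule variation(2)[OF continuous_on_minus[OF contphi]], erule \<phi>(4))
    then have zero: "(\<integral>t. r t * \<phi> t \<partial>?M) = 0" using pos by simp
    define R where "R = primitive a (\<lambda>t. r t * \<phi> t)"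
    note hi = integral_interval_lborel[OF pos(1)]
    have contR: "continuous_on {a..b} R"
      unfolding R_def using hi by (intro indefinite_integral_continuous_1) blast
    have Rends: "R a = 0" "R b = 0" using integral_unique[OF hi] zero by (auto simp: R_def)
    have R': "(R has_real_derivative r t * \<phi> t) (at t)" if t: "t \<in> {a<..<b}" for t
    proof -
      have "isCont x t" using continuous_on_interior[OF x, of t] t by simp
      moreover have "isCont \<phi> t" using \<phi>(1) by (simp add: continuous_on_eq_continuous_at)
      ultimately have "isCont (\<lambda>t. r t * \<phi> t) t"
        unfolding r_def using convex_on_open_interval_continuous[OF g t] by (intro continuous_intros)
      then show ?thesis unfolding R_def using hi t by (intro primitive_interior_derivative) auto
    qed
    \<comment> \<open>Integration by parts for \<open>D - m\<close> in place of \<open>D\<close>, which is negative only outside \<open>[c, d]\<close>.\<close>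
    let ?S = "\<lambda>t. R t - D1 t * \<phi> t + (D t - m) * g' (max c (min d t))"
    have mono: "mono_on {a<..<b} ?S"
    proof (rule integration_by_parts_monotone[where ?D2.0 = r])
      show "((\<lambda>t. D t - m) has_real_derivative D1 t) (at t)" if "t \<in> {a<..<b}" for t
        using DERIV_diff[OF D'[OF that] DERIV_const[of m]] by simp
      fix s assume s: "s \<in> {a<..<b}" "D s - m < 0"
      then have "s \<notin> {c..d}" using Dm[of s] by auto
      then consider "s < c" | "d < s" by fastforce
      then show "\<forall>\<^sub>F y in at s. g' (max c (min d y)) = g' (max c (min d s))"
      proof cases
        case 1
        then have "\<forall>\<^sub>F y in at s. y \<in> {..<c}" by (intro eventually_at_in_open') auto
        then show ?thesis by eventually_elim (use 1 cd in \<open>simp add: min_def max_def\<close>)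
      next
        case 2
        then have "\<forall>\<^sub>F y in at s. y \<in> {d<..}" by (intro eventually_at_in_open') auto
        then show ?thesis by eventually_elim (use 2 cd in \<open>simp add: min_def max_def\<close>)
      qed
    qed (use D1' R' \<phi> in auto)
    have contS: "continuous_on {a..b} (\<lambda>t. R t - D1 t * \<phi> t + (D t - m) * v)" for v
      by (intro continuous_intros contR contD1 contphi contD)
    \<comment> \<open>Near \<open>a\<close> the function \<open>?S\<close> tends to \<open>- m g' c\<close>, near \<open>b\<close> to \<open>- m g' d\<close>, as \<open>R\<close>, \<open>D\<close> and
        \<open>D1\<close> vanish at both ends.\<close>
    have "- m * g' c \<le> - m * g' d"
    proof -
      have "- m * g' c \<le> ?S v" if v: "d < v" "v < b" for v
      proof (rule tendsto_upperbound)
        show "((\<lambda>t. R t - D1 t * \<phi> t + (D t - m) * g' c) \<longlongrightarrow> - m * g' c) (at_right a)"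
          using continuous_on_Icc_at_rightD[OF contS[of "g' c"] ab] Da Rends by simp
        show "\<forall>\<^sub>F u in at_right a. R u - D1 u * \<phi> u + (D u - m) * g' c \<le> ?S v"
          unfolding eventually_at_right_field
        proof (intro exI[of _ c] conjI allI impI cd)
          fix u assume u: "a < u" "u < c"
          have "?S u \<le> ?S v" using u v cd by (intro mono_onD[OF mono]) auto
          then show "R u - D1 u * \<phi> u + (D u - m) * g' c \<le> ?S v" using u cd by simp
        qed
      qed simp
      then have le: "- m * g' c \<le> R v - D1 v * \<phi> v + (D v - m) * g' d" if "d < v" "v < b" for v
        using that cd by fastforce
      show ?thesis
      proof (rule tendsto_lowerbound)
        show "((\<lambda>t. R t - D1 t * \<phi> t + (D t - m) * g' d) \<longlongrightarrow> - m * g' d) (at_left b)"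
          using continuous_on_Icc_at_leftD[OF contS[of "g' d"] ab] Db D1b Rends by simp
        show "\<forall>\<^sub>F v in at_left b. - m * g' c \<le> R v - D1 v * \<phi> v + (D v - m) * g' d"
          unfolding eventually_at_left_field using le cd by (intro exI[of _ d]) auto
      qed simp
    qed
    then have "g' d \<le> g' c" using m by simp
    then have "affine_fun_on {c..d} g"
      by (intro affine_if_right_derivative_eq[OF g]) (use g' cd in auto)
    then show ?thesis using cd by blast
  qed
  have "contact_invelope a b X Y H H1 g"
    unfolding contact_invelope_def
  proof (intro conjI ballI impI)
    show "Y t \<le> H t" if "t \<in> {a..b}" for t using D_nonneg[OF that] by (simp add: D_def)
    show "H a = Y a" "H1 a = X a" "H b = Y b" "H1 b = X b"
      using Da Db D1b by (auto simp: D_def D1_def)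
  qed (use H contH1 H1' g slack in blast)+
  then show ?thesis unfolding Y_def by blast
qed

section \<open>Existence and continuous dependence for continuous paths\<close>

text \<open>
  The Bernstein polynomial on \<open>[a, b]\<close> as a function of an arbitrary vector \<open>v\<close> of coefficients, so
  that continuity in the coefficients can be stated; only \<open>v 0, \<dots>, v n\<close> matter.
\<close>
definition bernstein_interp :: "real \<Rightarrow> real \<Rightarrow> nat \<Rightarrow> (nat \<Rightarrow> real) \<Rightarrow> real \<Rightarrow> real" where
  "bernstein_interp a b n v t = (\<Sum>k\<le>n. v k * Bernstein n k ((t - a) / (b - a)))"

definition bernstein_node :: "real \<Rightarrow> real \<Rightarrow> nat \<Rightarrow> nat \<Rightarrow> real" where
  "bernstein_node a b n k = a + (b - a) * (k / n)"

lemma bernstein_interp_uniform_limit: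
  assumes ab: "a < b" and X: "continuous_on {a..b} X"
  shows "uniform_limit {a..b} (\<lambda>n. bernstein_interp a b n (\<lambda>k. X (bernstein_node a b n k))) X sequentially"
proof (rule uniform_limitI)
  fix e :: real assume e: "0 < e"
  have sc: "a + (b - a) * u \<in> {a..b}" if "u \<in> {0..1}" for u
  proof -
    have "0 \<le> (b - a) * u" "(b - a) * u \<le> (b - a) * 1"
      using ab that by (auto intro!: mult_left_mono mult_nonneg_nonneg simp del: mult_1_right)
    then show ?thesis by simp
  qed
  have "continuous_on {0..1} (\<lambda>u. X (a + (b - a) * u))"
    by (intro continuous_on_compose2[OF X] continuous_intros) (use sc in blast)
  from Bernstein_Weierstrass[OF this e] obtain N where N: "\<And>n u. N \<le> n \<Longrightarrow> u \<in> {0..1} \<Longrightarrow>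
      \<bar>X (a + (b - a) * u) - (\<Sum>k\<le>n. X (a + (b - a) * (k / n)) * Bernstein n k u)\<bar> < e" by blast
  have "dist (bernstein_interp a b n (\<lambda>k. X (bernstein_node a b n k)) t) (X t) < e"
    if n: "N \<le> n" and t: "t \<in> {a..b}" for n t
  proof -
    have "(t - a) / (b - a) \<in> {0..1}" "a + (b - a) * ((t - a) / (b - a)) = t" using ab t by auto
    then show ?thesis
      using N[OF n, of "(t - a) / (b - a)"]
      by (simp add: dist_real_def bernstein_interp_def bernstein_node_def abs_minus_commute)
  qed
  then show "\<forall>\<^sub>F n in sequentially. \<forall>t\<in>{a..b}.
      dist (bernstein_interp a b n (\<lambda>k. X (bernstein_node a b n k)) t) (X t) < e"
    unfolding eventually_sequentially by blast
qed

lemma bernstein_interp_smooth: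
  "\<exists>x. continuous_on S x \<and> (\<forall>t. (bernstein_interp a b n v has_real_derivative x t) (at t))"
proof -
  have lin: "real_polynomial_function (\<lambda>t. (t - a) / (b - a))"
  proof -
    have "real_polynomial_function (\<lambda>t. t * (1 / (b - a)) + - a / (b - a))"
      by (intro real_polynomial_function.intros bounded_linear_ident)
    then show ?thesis by (simp add: diff_divide_distrib)
  qed
  have lin': "real_polynomial_function (\<lambda>t. 1 - (t - a) / (b - a))"
  proof -
    have "real_polynomial_function (\<lambda>t. 1 + (- 1) * ((t - a) / (b - a)))"
      by (intro real_polynomial_function.intros lin)
    then show ?thesis by (simp only: mult_minus1 add_uminus_conv_diff)
  qed
  have "real_polynomial_function (\<lambda>t. \<Sum>k\<le>n. v k * Bernstein n k ((t - a) / (b - a)))"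
    unfolding Bernstein_def
    by (intro real_polynomial_function_sum real_polynomial_function.intros(2,4)
        real_polynomial_function_power lin lin') simp
  then obtain x where x: "real_polynomial_function x"
      "\<And>t. ((\<lambda>t. \<Sum>k\<le>n. v k * Bernstein n k ((t - a) / (b - a))) has_real_derivative x t) (at t)"
    using has_real_derivative_polynomial_function by blast
  have "continuous_on S x"
    using continuous_real_polymonial_function[OF x(1)] by (simp add: continuous_at_imp_continuous_on)
  then show ?thesis using x(2) unfolding bernstein_interp_def[abs_def] by blast
qed

lemma bernstein_interp_continuous: "continuous_on S (bernstein_interp a b n v)"
proof -
  obtain x where "\<And>t. (bernstein_interp a b n v has_real_derivative x t) (at t)"
    using bernstein_interp_smooth by metis
  then show ?thesis by (intro continuous_at_imp_continuous_on ballI) (rule DERIV_isCont)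
qed

theorem contact_invelope_exists:
  assumes ab: "a < b" and X: "continuous_on {a..b} X"
  shows "\<exists>H H1 H2. contact_invelope a b X (primitive a X) H H1 H2"
proof -
  define Xs where "Xs n = bernstein_interp a b n (\<lambda>k. X (bernstein_node a b n k))" for n
  have "\<exists>H H1 H2. contact_invelope a b (Xs n) (primitive a (Xs n)) H H1 H2" for n
  proof -
    obtain x where x: "continuous_on {a..b} x" "\<And>t. (Xs n has_real_derivative x t) (at t)"
      unfolding Xs_def using bernstein_interp_smooth by metis
    then have "\<forall>t\<in>{a..b}. (Xs n has_real_derivative x t) (at t within {a..b})"
      using has_field_derivative_at_within by blast
    then show ?thesis using contact_invelope_exists_smooth[OF ab _ x(1)] by blast
  qed
  then obtain H H1 H2 where "\<And>n. contact_invelope a b (Xs n) (primitive a (Xs n)) (H n) (H1 n) (H2 n)"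
    by metis
  moreover have "continuous_on {a..b} (Xs n)" for n unfolding Xs_def by (rule bernstein_interp_continuous)
  moreover have "uniform_limit {a..b} Xs X sequentially"
    unfolding Xs_def[abs_def] by (rule bernstein_interp_uniform_limit[OF ab X])
  ultimately show ?thesis using contact_invelope_stable[OF ab _ X] by blast
qed

definition invelope_of :: "real \<Rightarrow> real \<Rightarrow> (real \<Rightarrow> real) \<Rightarrow> real \<Rightarrow> real" where
  "invelope_of a b X = (SOME H. \<exists>H1 H2. contact_invelope a b X (primitive a X) H H1 H2)"

lemma contact_invelope_invelope_of:
  assumes "a < b" "continuous_on {a..b} X"
  shows "\<exists>H1 H2. contact_invelope a b X (primitive a X) (invelope_of a b X) H1 H2"
  unfolding invelope_of_def by (rule someI_ex[OF contact_invelope_exists[OF assms]])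

text \<open>
  By uniqueness all subsequential limits supplied by stability are the same.
\<close>
theorem invelope_of_tendsto:
  assumes ab: "a < b" and Xs: "\<And>n. continuous_on {a..b} (Xs n)" and X: "continuous_on {a..b} X"
    and lim: "uniform_limit {a..b} Xs X sequentially" and t: "t \<in> {a..b}"
  shows "(\<lambda>n. invelope_of a b (Xs n) t) \<longlonglongrightarrow> invelope_of a b X t"
proof (rule ccontr)
  let ?l = "invelope_of a b X t"
  assume "\<not> ?thesis"
  then obtain e where e: "0 < e" "\<And>N. \<exists>n\<ge>N. \<not> dist (invelope_of a b (Xs n) t) ?l < e"
    unfolding lim_sequentially by blast
  define B where "B = {n. \<not> dist (invelope_of a b (Xs n) t) ?l < e}"
  have "infinite B" unfolding infinite_nat_iff_unbounded_le B_def using e(2) by blast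
  then obtain r :: "nat \<Rightarrow> nat" where r: "strict_mono r" "\<And>n. r n \<in> B"
    using infinite_enumerate by blast
  have "\<forall>n. \<exists>H1 H2. contact_invelope a b (Xs (r n)) (primitive a (Xs (r n))) (invelope_of a b (Xs (r n))) H1 H2"
    using contact_invelope_invelope_of[OF ab Xs] by blast
  then obtain H1 H2 where inv: "\<And>n. contact_invelope a b (Xs (r n)) (primitive a (Xs (r n)))
      (invelope_of a b (Xs (r n))) (H1 n) (H2 n)" by metis
  have "uniform_limit {a..b} (\<lambda>n. Xs (r n)) X sequentially"
    using filterlim_compose[OF lim filterlim_subseq[OF r(1)]] .
  from contact_invelope_stable[OF ab Xs X this inv] obtain k G G1 G2
    where k: "strict_mono (k :: nat \<Rightarrow> nat)" and G: "contact_invelope a b X (primitive a X) G G1 G2"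
      and conv: "\<forall>t\<in>{a..b}. (\<lambda>n. invelope_of a b (Xs (r (k n))) t) \<longlonglongrightarrow> G t"
    by blast
  have "G t = ?l"
    using contact_invelope_invelope_of[OF ab X] contact_invelope_unique[OF ab G _ t] by blast
  then have "(\<lambda>n. invelope_of a b (Xs (r (k n))) t) \<longlonglongrightarrow> ?l" using conv t by metis
  then obtain N where "\<And>n. n \<ge> N \<Longrightarrow> dist (invelope_of a b (Xs (r (k n))) t) ?l < e"
    using e(1) unfolding lim_sequentially by blast
  then show False using r(2)[of "k N"] by (auto simp: B_def)
qed

section \<open>The random invelope\<close>

lemma invelope_of_bernstein_continuous:
  assumes ab: "a < b" and t: "t \<in> {a..b}"
  shows "continuous_on UNIV (\<lambda>v. invelope_of a b (bernstein_interp a b n v) t)"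
  unfolding continuous_on_sequentially o_def
proof (intro allI ballI impI)
  fix vs :: "nat \<Rightarrow> nat \<Rightarrow> real" and v
  assume "(\<forall>j. vs j \<in> UNIV) \<and> vs \<longlonglongrightarrow> v"
  then have vs: "vs \<longlonglongrightarrow> v" by blast
  have coord: "(\<lambda>j. vs j k) \<longlonglongrightarrow> v k" for k
    using continuous_on_tendsto_compose[OF continuous_on_product_coordinates vs] by auto
  show "(\<lambda>j. invelope_of a b (bernstein_interp a b n (vs j)) t)
      \<longlonglongrightarrow> invelope_of a b (bernstein_interp a b n v) t"
  proof (rule invelope_of_tendsto[OF ab bernstein_interp_continuous bernstein_interp_continuous _ t])
    show "uniform_limit {a..b} (\<lambda>j. bernstein_interp a b n (vs j)) (bernstein_interp a b n v) sequentially"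
    proof (rule uniform_limitI)
      fix e :: real assume e: "0 < e"
      have "(\<lambda>j. \<Sum>k\<le>n. \<bar>vs j k - v k\<bar>) \<longlonglongrightarrow> (\<Sum>k\<le>n. \<bar>v k - v k\<bar>)"
        by (intro tendsto_intros coord)
      then have "\<forall>\<^sub>F j in sequentially. (\<Sum>k\<le>n. \<bar>vs j k - v k\<bar>) < e"
        using e by (intro order_tendstoD(2)) auto
      then show "\<forall>\<^sub>F j in sequentially. \<forall>s\<in>{a..b}.
          dist (bernstein_interp a b n (vs j) s) (bernstein_interp a b n v s) < e"
      proof (eventually_elim, intro ballI)
        fix j s assume j: "(\<Sum>k\<le>n. \<bar>vs j k - v k\<bar>) < e" and s: "s \<in> {a..b}"
        define u where "u = (s - a) / (b - a)"
        have u: "0 \<le> u" "u \<le> 1" using s ab by (auto simp: u_def)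
        have B: "0 \<le> Bernstein n k u" for k using u by (intro Bernstein_nonneg)
        have B1: "Bernstein n k u \<le> 1" if "k \<in> {..n}" for k
          using member_le_sum[OF that, of "\<lambda>k. Bernstein n k u"] B by simp
        have "bernstein_interp a b n (vs j) s - bernstein_interp a b n v s
            = (\<Sum>k\<le>n. (vs j k - v k) * Bernstein n k u)"
          by (simp add: bernstein_interp_def u_def sum_subtractf left_diff_distrib)
        also have "\<bar>\<dots>\<bar> \<le> (\<Sum>k\<le>n. \<bar>(vs j k - v k) * Bernstein n k u\<bar>)" by (rule sum_abs)
        also have "\<dots> \<le> (\<Sum>k\<le>n. \<bar>vs j k - v k\<bar>)"
          using B B1 by (intro sum_mono) (simp add: abs_mult mult_left_le)
        finally show "dist (bernstein_interp a b n (vs j) s) (bernstein_interp a b n v s) < e"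
          using j by (simp add: dist_real_def)
      qed
    qed
  qed
qed

lemma measurable_invelope_bernstein:
  assumes ab: "a < b" and t: "t \<in> {a..b}" and X: "\<And>s. (\<lambda>\<omega>. X \<omega> s) \<in> borel_measurable M"
  shows "(\<lambda>\<omega>. invelope_of a b (bernstein_interp a b n (\<lambda>k. X \<omega> (bernstein_node a b n k))) t) \<in> borel_measurable M"
proof -
  have "(\<lambda>\<omega> k. X \<omega> (bernstein_node a b n k)) \<in> borel_measurable M"
    by (rule measurable_coordinatewise_then_product) (rule X)
  moreover have "(\<lambda>v. invelope_of a b (bernstein_interp a b n v) t) \<in> borel_measurable borel"
    by (intro borel_measurable_continuous_onI invelope_of_bernstein_continuous ab t)
  ultimately show ?thesis by (rule measurable_compose)
qed

text \<open>
  Used for the random constant \<open>Y a\<close>, an integral of \<open>X\<close> over \<open>[0, a]\<close>: its approximations are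
  linear combinations of finitely many values of \<open>X\<close>.
\<close>
lemma measurable_primitive_bernstein:
  assumes X: "\<And>s. (\<lambda>\<omega>. X \<omega> s) \<in> borel_measurable M"
  shows "(\<lambda>\<omega>. primitive 0 (bernstein_interp 0 a n (\<lambda>k. X \<omega> (bernstein_node 0 a n k))) a) \<in> borel_measurable M"
proof -
  have B: "(\<lambda>t. Bernstein n k ((t - 0) / (a - 0))) integrable_on {0..a}" for k
    unfolding Bernstein_def divide_inverse
    by (intro integrable_continuous_real continuous_intros)
  have "primitive 0 (bernstein_interp 0 a n v) a
      = (\<Sum>k\<le>n. v k * integral {0..a} (\<lambda>t. Bernstein n k ((t - 0) / (a - 0))))" for v
    unfolding bernstein_interp_def
    by (subst integral_sum) (auto intro!: integrable_on_mult_right simp: B[simplified])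
  then show ?thesis using X by simp
qed

lemma contact_invelope_translate:
  assumes inv: "contact_invelope a b X Y H H1 H2" and ab: "a < b"
    and Y': "\<And>t. t \<in> {a..b} \<Longrightarrow> Y' t = c + Y t" and H': "\<And>t. t \<in> {a..b} \<Longrightarrow> H' t = c + H t"
  shows "contact_invelope a b X Y' H' H1 H2"
proof -
  note HD = contact_invelopeD[OF inv]
  have ends: "Y' a = c + Y a" "Y' b = c + Y b" "H' a = c + H a" "H' b = c + H b" using Y' H' ab by auto
  show ?thesis
    unfolding contact_invelope_def
  proof (intro conjI ballI impI)
    fix t assume t: "t \<in> {a..b}"
    have "((\<lambda>t. c + H t) has_real_derivative 0 + H1 t) (at t within {a..b})"
      by (intro DERIV_add DERIV_const HD(1) t)
    then have "((\<lambda>t. c + H t) has_real_derivative H1 t) (at t within {a..b})" by simp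
    then show "(H' has_real_derivative H1 t) (at t within {a..b})"
      by (rule has_field_derivative_transform_within[OF _ zero_less_one t]) (simp add: H')
    show "Y' t \<le> H' t" using HD(3)[OF t] Y'[OF t] H'[OF t] by simp
  next
    fix t assume t: "t \<in> {a<..<b}" "Y' t < H' t"
    then have "Y t < H t" using Y'[of t] H'[of t] by simp
    then show "\<exists>c d. a < c \<and> c < t \<and> t < d \<and> d < b \<and> affine_fun_on {c..d} H2"
      by (rule HD(10)[OF t(1)])
  qed (use HD(2,4-9) ends in auto)
qed

lemma real_distribution_convex_density:
  assumes "convex_density f"
  shows "real_distribution (density lborel (\<lambda>x. ennreal (indicator {0..} x * f x)))" (is "real_distribution ?N")
proof -
  have f: "\<And>x. 0 \<le> indicator {0..} x * f x" and int: "integrable lborel (\<lambda>x. indicator {0..} x * f x)"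
    and one: "(\<integral>x. indicator {0..} x * f x \<partial>lborel) = 1"
    using assms unfolding convex_density_def set_integrable_def set_lebesgue_integral_def
    by (auto simp: indicator_def)
  have "emeasure ?N (space ?N) = (\<integral>\<^sup>+x. ennreal (indicator {0..} x * f x) \<partial>lborel)"
    using borel_measurable_integrable[OF int] by (subst emeasure_density) (auto intro!: nn_integral_cong)
  also have "\<dots> = 1" using nn_integral_eq_integral[OF int] f one by simp
  finally have "prob_space ?N" by (rule prob_spaceI)
  then show ?thesis by (simp add: real_distribution_def real_distribution_axioms_def)
qed

lemma density_cdf_bounds:
  assumes "convex_density f"
  shows "density_cdf f t \<in> {0..1}"
proof -
  interpret real_distribution "density lborel (\<lambda>x. ennreal (indicator {0..} x * f x))"
    by (rule real_distribution_convex_density[OF assms])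
  show ?thesis unfolding density_cdf_def using cdf_nonneg cdf_bounded_prob by simp
qed

lemma density_cdf_continuous:
  assumes "convex_density f"
  shows "continuous_on S (density_cdf f)"
proof -
  let ?N = "density lborel (\<lambda>x. ennreal (indicator {0..} x * f x))"
  interpret real_distribution ?N
    by (rule real_distribution_convex_density[OF assms])
  interpret finite_borel_measure ?N by (rule finite_borel_measure_M)
  have meas: "(\<lambda>x. ennreal (indicator {0..} x * f x)) \<in> borel_measurable lborel"
    using assms borel_measurable_integrable
    unfolding convex_density_def set_integrable_def by fastforce
  have "{t} \<in> null_sets lborel" for t :: real by (rule null_setsI) simp_all
  then have "{t} \<in> null_sets ?N" for t
    using absolutely_continuousI_density[OF meas] unfolding absolutely_continuous_def by blast
  then have "measure ?N {t} = 0" for t by (simp add: null_sets_def measure_def)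
  then show ?thesis unfolding density_cdf_def
    by (intro continuous_at_imp_continuous_on ballI) (simp add: isCont_cdf)
qed

theorem theorem2p10:
  fixes M :: "'w measure" and U :: "real \<Rightarrow> 'w \<Rightarrow> real"
    and f\<^sub>0 F\<^sub>0 :: "real \<Rightarrow> real" and a b :: real
    and X Y :: "'w \<Rightarrow> real \<Rightarrow> real"
  assumes f0: "convex_density f\<^sub>0" and F0: "F\<^sub>0 = density_cdf f\<^sub>0"
    and ab: "0 \<le> a" "a < b"
    and pos: "\<forall>x\<in>{a<..<b}. 0 < f\<^sub>0 x"
    and lin: "affine_fun_on {a<..<b} f\<^sub>0"
    and maximal: "\<not> (\<exists>a' b'. {a<..<b} \<subset> {a'<..<b'} \<and> {a'<..<b'} \<subseteq> {0<..} \<and>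
                    affine_fun_on {a'<..<b'} f\<^sub>0)"
    and U: "brownian_bridge M U"
    and X: "\<And>\<omega> t. X \<omega> t = U (F\<^sub>0 t) \<omega>"
    and Y: "\<And>\<omega> t. Y \<omega> t = (LBINT s:{0..t}. X \<omega> s)"
  shows "\<exists>H :: 'w \<Rightarrow> real \<Rightarrow> real.
           (\<forall>t\<in>{a..b}. (\<lambda>\<omega>. H \<omega> t) \<in> borel_measurable M) \<and>
           (AE \<omega> in M. invelope_on a b (X \<omega>) (Y \<omega>) (H \<omega>) \<and>
              (\<forall>G. invelope_on a b (X \<omega>) (Y \<omega>) G \<longrightarrow> (\<forall>t\<in>{a..b}. G t = H \<omega> t)))"
proof -
  have F0_bounds: "F\<^sub>0 t \<in> {0..1}" for t unfolding F0 by (rule density_cdf_bounds[OF f0])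
  have gauss: "gaussian_process M {0..1} U" and cont: "AE \<omega> in M. continuous_on {0..1} (\<lambda>t. U t \<omega>)"
    using U by (simp_all add: brownian_bridge_def)
  have X_meas: "(\<lambda>\<omega>. X \<omega> t) \<in> borel_measurable M" for t
  proof -
    have "gaussian_rv M (\<lambda>\<omega>. \<Sum>s\<in>{F\<^sub>0 t}. 1 * U s \<omega>)"
      by (rule gauss[unfolded gaussian_process_def, rule_format]) (use F0_bounds in auto)
    then show ?thesis by (simp add: gaussian_rv_def X)
  qed
  define Xs where "Xs \<omega> n = bernstein_interp a b n (\<lambda>k. X \<omega> (bernstein_node a b n k))" for \<omega> n
  define Zs where "Zs \<omega> n = primitive 0 (bernstein_interp 0 a n (\<lambda>k. X \<omega> (bernstein_node 0 a n k))) a" for \<omega> n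
  \<comment> \<open>Taking \<open>invelope_of\<close> of the path itself would leave measurability open on the null set where the
      path is not continuous, so \<open>H\<close> is defined by the approximations.\<close>
  define H where "H \<omega> t = lim (Zs \<omega>) + lim (\<lambda>n. invelope_of a b (Xs \<omega> n) t)" for \<omega> t
  have "(\<lambda>\<omega>. H \<omega> t) \<in> borel_measurable M" if t: "t \<in> {a..b}" for t
    unfolding H_def Zs_def Xs_def
    by (intro borel_measurable_add borel_measurable_lim_metric measurable_invelope_bernstein
        measurable_primitive_bernstein X_meas ab t)
  moreover have "AE \<omega> in M. invelope_on a b (X \<omega>) (Y \<omega>) (H \<omega>) \<and>
              (\<forall>G. invelope_on a b (X \<omega>) (Y \<omega>) G \<longrightarrow> (\<forall>t\<in>{a..b}. G t = H \<omega> t))"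
    using cont
  proof eventually_elim
    case (elim \<omega>)
    have Xc: "continuous_on S (X \<omega>)" for S
      unfolding X[abs_def] using F0_bounds density_cdf_continuous[OF f0]
      by (intro continuous_on_compose2[OF elim]) (auto simp: F0)
    have Y_eq: "Y \<omega> t = primitive 0 (X \<omega>) t" for t
    proof -
      have "set_integrable lborel {0..t} (X \<omega>)"
        unfolding set_integrable_def by (intro borel_integrable_compact Xc) simp
      then show ?thesis unfolding Y by (rule set_borel_integral_eq_integral(2))
    qed
    have Y_split: "Y \<omega> t = Y \<omega> a + primitive a (X \<omega>) t" if "t \<in> {a..b}" for t
      unfolding Y_eq
      using Henstock_Kurzweil_Integration.integral_combine[OF ab(1) _ integrable_continuous_real[OF Xc], of t] that
      by simp
    have "Zs \<omega> \<longlonglongrightarrow> Y \<omega> a"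
    proof (cases "a = 0")
      case False
      then have a: "0 < a" using ab by simp
      have "uniform_limit {0..a} (\<lambda>n. primitive 0 (bernstein_interp 0 a n (\<lambda>k. X \<omega> (bernstein_node 0 a n k))))
          (primitive 0 (X \<omega>)) sequentially"
        by (intro uniform_limit_primitive bernstein_interp_continuous Xc bernstein_interp_uniform_limit a)
      then show ?thesis unfolding Y_eq Zs_def[abs_def] using a by (intro tendsto_uniform_limitI[where S="{0..a}"]) auto
    qed (simp add: Zs_def[abs_def] Y_eq)
    then have Z: "lim (Zs \<omega>) = Y \<omega> a" by (rule limI)
    have lim: "(\<lambda>n. invelope_of a b (Xs \<omega> n) t) \<longlonglongrightarrow> invelope_of a b (X \<omega>) t" if "t \<in> {a..b}" for t
      unfolding Xs_def
      by (intro invelope_of_tendsto bernstein_interp_continuous bernstein_interp_uniform_limit Xc ab that)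
    have H_eq: "H \<omega> t = Y \<omega> a + invelope_of a b (X \<omega>) t" if "t \<in> {a..b}" for t
      unfolding H_def Z limI[OF lim[OF that]] ..
    obtain H1 H2 where "contact_invelope a b (X \<omega>) (primitive a (X \<omega>)) (invelope_of a b (X \<omega>)) H1 H2"
      using contact_invelope_invelope_of[OF ab(2) Xc] by blast
    then have inv: "contact_invelope a b (X \<omega>) (Y \<omega>) (H \<omega>) H1 H2"
      by (rule contact_invelope_translate[OF _ ab(2) Y_split H_eq])
    have contY: "continuous_on {a..b} (Y \<omega>)"
    proof -
      have "continuous_on {a..b} (\<lambda>t. Y \<omega> a + primitive a (X \<omega>) t)"
        by (intro continuous_intros indefinite_integral_continuous_1 integrable_continuous_real Xc)
      then show ?thesis by (rule continuous_on_eq) (rule Y_split[symmetric])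
    qed
    have "invelope_on a b (X \<omega>) (Y \<omega>) (H \<omega>)"
      by (rule contact_invelope_imp_invelope_on[OF contY inv])
    moreover have "G t = H \<omega> t" if "invelope_on a b (X \<omega>) (Y \<omega>) G" "t \<in> {a..b}" for G t
      using invelope_on_imp_contact_invelope[OF contY that(1)]
        contact_invelope_unique[OF ab(2) _ inv that(2)] by blast
    ultimately show ?case by blast
  qed
  ultimately show ?thesis by blast
qed

end
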